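(* For every integer $k\ge 2$ there is a constant $t_0(k)$ such that for every integer $t\ge t_0(k)$, $$\operatorname{ex}(n,E^+_{k,t})=\Theta\left(n^{\frac{3k-1}{2k-1}}\right)\quad\text{as } n\to\infty,$$ where the implied constants may depend on $k$ and $t$.
   Context: All graphs are finite and simple. The extremal number $\operatorname{ex}(n,H)$ is the maximum number of edges in an $n$-vertex graph containing no (not necessarily induced) subgraph isomorphic to $H$. For $k,t\ge 2$, the theta graph $\theta_{k,t}$ consists of two vertices joined by $t$ internally vertex-disjoint paths of length $k$ (that is, with $k$ edges); it is a connected bipartite graph, with bipartition $A\cup B$. The graph $E_{k,t}$ is obtained from $\theta_{k,t}$ by adding two new vertices $x,y$, joining $x$ to every vertex of $A$ and $y$ to every vertex of $B$. The graph $E^+_{k,t}$ is obtained from $E_{k,t}$ by adding the edge $xy$. *)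

theory Defs
  imports "HOL-Library.Landau_Symbols"
begin

datatype 'a graph = Graph (verts: "'a set") (edges: "'a set set")

definition simple_graph :: "'a graph \<Rightarrow> bool" where
  "simple_graph G \<longleftrightarrow> finite (verts G) \<and> (\<forall>e\<in>edges G. e \<subseteq> verts G \<and> card e = 2)"

definition subgraph :: "'a graph \<Rightarrow> 'a graph \<Rightarrow> bool" where
  "subgraph K G \<longleftrightarrow> simple_graph K \<and> verts K \<subseteq> verts G \<and> edges K \<subseteq> edges G"

definition isomorphic :: "'a graph \<Rightarrow> 'b graph \<Rightarrow> bool" where
  "isomorphic G H \<longleftrightarrow>
     (\<exists>f. bij_betw f (verts G) (verts H) \<and>
          (\<forall>u\<in>verts G. \<forall>v\<in>verts G. {u, v} \<in> edges G \<longleftrightarrow> {f u, f v} \<in> edges H))"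

definition contains_copy :: "'a graph \<Rightarrow> 'b graph \<Rightarrow> bool" where
  "contains_copy G H \<longleftrightarrow> (\<exists>K. subgraph K G \<and> isomorphic K H)"

definition bipartition :: "'a graph \<Rightarrow> 'a set \<Rightarrow> 'a set \<Rightarrow> bool" where
  "bipartition G A B \<longleftrightarrow> A \<union> B = verts G \<and> A \<inter> B = {} \<and>
     (\<forall>e\<in>edges G. \<exists>a\<in>A. \<exists>b\<in>B. e = {a, b})"

text \<open>Every finite graph is isomorphic to one with vertices in \<open>nat\<close>, so host graphs
  of that type suffice. The value is meaningful when \<open>H\<close> has at least one edge, so that
  some host graph is \<open>H\<close>-free (lemma \<open>host_edge_counts\<close>).\<close>
definition extremal_number :: "nat \<Rightarrow> 'a graph \<Rightarrow> nat" where
  "extremal_number n H =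
     Max {card (edges G) | G :: nat graph.
            simple_graph G \<and> card (verts G) = n \<and> \<not> contains_copy G H}"

datatype theta_vertex = Source | Sink | Inner nat nat

text \<open>The vertex at distance \<open>j\<close> from the source along the \<open>i\<close>-th path, \<open>0 \<le> j \<le> k\<close>.\<close>
definition theta_pos :: "nat \<Rightarrow> nat \<Rightarrow> nat \<Rightarrow> theta_vertex" where
  "theta_pos k i j = (if j = 0 then Source else if j = k then Sink else Inner i j)"

definition theta :: "nat \<Rightarrow> nat \<Rightarrow> theta_vertex graph" where
  "theta k t = Graph {theta_pos k i j | i j. i < t \<and> j \<le> k}
                     {{theta_pos k i j, theta_pos k i (Suc j)} | i j. i < t \<and> j < k}"

text \<open>The two classes of the bipartition, by parity of the position. As the graph is
  connected, this bipartition is unique up to swapping the classes, and swapping them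
  does not change the graphs \<open>E_graph\<close> and \<open>E_plus\<close> below up to isomorphism.\<close>
definition theta_A :: "nat \<Rightarrow> nat \<Rightarrow> theta_vertex set" where
  "theta_A k t = {theta_pos k i j | i j. i < t \<and> j \<le> k \<and> even j}"

definition theta_B :: "nat \<Rightarrow> nat \<Rightarrow> theta_vertex set" where
  "theta_B k t = {theta_pos k i j | i j. i < t \<and> j \<le> k \<and> odd j}"

datatype E_vertex = Theta theta_vertex | X | Y

definition E_graph :: "nat \<Rightarrow> nat \<Rightarrow> E_vertex graph" where
  "E_graph k t = Graph (Theta ` verts (theta k t) \<union> {X, Y})
     ((\<lambda>e. Theta ` e) ` edges (theta k t)
        \<union> {{X, Theta a} | a. a \<in> theta_A k t}
        \<union> {{Y, Theta b} | b. b \<in> theta_B k t})"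

definition E_plus :: "nat \<Rightarrow> nat \<Rightarrow> E_vertex graph" where
  "E_plus k t = Graph (verts (E_graph k t)) (insert {X, Y} (edges (E_graph k t)))"

lemma simple_graph_theta:
  assumes "k \<ge> 2"
  shows "simple_graph (theta k t)"
proof -
  have "{theta_pos k i j | i j. i < t \<and> j \<le> k} = (\<lambda>(i, j). theta_pos k i j) ` ({..<t} \<times> {..k})"
    by auto
  then have "finite {theta_pos k i j | i j. i < t \<and> j \<le> k}"
    by simp
  moreover have "theta_pos k i j \<noteq> theta_pos k i (Suc j)" for i j
    using assms by (auto simp: theta_pos_def)
  moreover have "theta_pos k i j \<in> verts (theta k t)" if "i < t" "j \<le> k" for i j
    using that unfolding theta_def graph.sel by blast
  ultimately show ?thesis
    unfolding simple_graph_def by (auto simp: theta_def card_insert_if Suc_le_eq)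
qed

lemma bipartition_theta:
  assumes "k \<ge> 2"
  shows "bipartition (theta k t) (theta_A k t) (theta_B k t)"
proof -
  have "theta_A k t \<union> theta_B k t = verts (theta k t)"
    by (auto simp: theta_A_def theta_B_def theta_def)
  moreover have "theta_A k t \<inter> theta_B k t = {}"
    by (auto simp: theta_A_def theta_B_def theta_pos_def split: if_splits)
  moreover have A: "theta_pos k i j \<in> theta_A k t" if "i < t" "j \<le> k" "even j" for i j
    using that unfolding theta_A_def by blast
  moreover have B: "theta_pos k i j \<in> theta_B k t" if "i < t" "j \<le> k" "odd j" for i j
    using that unfolding theta_B_def by blast
  moreover have "\<exists>a\<in>theta_A k t. \<exists>b\<in>theta_B k t.
      {theta_pos k i j, theta_pos k i (Suc j)} = {a, b}" if "i < t" "j < k" for i j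
  proof (cases "even j")
    case True
    then have "theta_pos k i j \<in> theta_A k t" "theta_pos k i (Suc j) \<in> theta_B k t"
      using that by (auto intro: A B)
    then show ?thesis by blast
  next
    case False
    then have "theta_pos k i j \<in> theta_B k t" "theta_pos k i (Suc j) \<in> theta_A k t"
      using that by (auto intro: A B)
    then show ?thesis by blast
  qed
  ultimately show ?thesis
    unfolding bipartition_def by (auto simp: theta_def)
qed

lemma simple_graph_E_plus:
  assumes "k \<ge> 2"
  shows "simple_graph (E_plus k t)"
proof -
  have th: "finite (verts (theta k t))" "\<And>e. e \<in> edges (theta k t) \<Longrightarrow> e \<subseteq> verts (theta k t) \<and> card e = 2"
    using simple_graph_theta[OF assms] by (auto simp: simple_graph_def)
  have AB: "theta_A k t \<subseteq> verts (theta k t)" "theta_B k t \<subseteq> verts (theta k t)"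
    using bipartition_theta[OF assms, of t] by (auto simp: bipartition_def)
  have "card (Theta ` e) = card e" for e
    by (rule card_image) (simp add: inj_on_def)
  then have *: "Theta ` e \<subseteq> Theta ` verts (theta k t) \<and> card (Theta ` e) = 2"
    if "e \<in> edges (theta k t)" for e
    using th(2)[OF that] by auto
  have "finite (verts (E_plus k t))"
    using th(1) by (simp add: E_plus_def E_graph_def)
  moreover have "e \<subseteq> verts (E_plus k t) \<and> card e = 2" if "e \<in> edges (E_plus k t)" for e
  proof -
    have "e = {X, Y} \<or> (\<exists>e'\<in>edges (theta k t). e = Theta ` e')
      \<or> (\<exists>a\<in>theta_A k t. e = {X, Theta a}) \<or> (\<exists>b\<in>theta_B k t. e = {Y, Theta b})"
      using that unfolding E_plus_def E_graph_def graph.sel by blast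
    moreover have "e \<subseteq> verts (E_plus k t) \<and> card e = 2"
      if "e' \<in> edges (theta k t)" "e = Theta ` e'" for e'
      using *[OF that(1)] that(2) by (auto simp: E_plus_def E_graph_def)
    moreover have "{X, Theta a} \<subseteq> verts (E_plus k t)" if "a \<in> theta_A k t" for a
      using AB(1) that by (auto simp: E_plus_def E_graph_def)
    moreover have "{Y, Theta b} \<subseteq> verts (E_plus k t)" if "b \<in> theta_B k t" for b
      using AB(2) that by (auto simp: E_plus_def E_graph_def)
    moreover have "{X, Y} \<subseteq> verts (E_plus k t)"
      by (simp add: E_plus_def E_graph_def)
    ultimately show ?thesis
      by (elim disjE bexE) simp_all
  qed
  ultimately show ?thesis
    by (simp add: simple_graph_def)
qed

lemma host_edge_counts:
  fixes H :: "'a graph" and n :: nat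
  defines "S \<equiv> {card (edges G) | G :: nat graph.
                  simple_graph G \<and> card (verts G) = n \<and> \<not> contains_copy G H}"
  assumes H: "simple_graph H" "edges H \<noteq> {}"
  shows "finite S" "S \<noteq> {}"
proof -
  have "S \<subseteq> {..2 ^ n}"
  proof
    fix m assume "m \<in> S"
    then obtain G :: "nat graph" where G: "m = card (edges G)" "simple_graph G" "card (verts G) = n"
      unfolding S_def by blast
    then have "edges G \<subseteq> Pow (verts G)" "finite (verts G)"
      by (auto simp: simple_graph_def)
    then have "m \<le> card (Pow (verts G))"
      unfolding G(1) by (intro card_mono) simp_all
    then show "m \<in> {..2 ^ n}"
      using G(3) \<open>finite (verts G)\<close> by (simp add: card_Pow)
  qed
  then show "finite S"
    by (rule finite_subset) simp
  define G where "G = Graph {..<n} {}"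
  have "\<not> contains_copy G H"
  proof
    assume "contains_copy G H"
    then obtain K :: "nat graph" and f where K: "edges K = {}" "bij_betw f (verts K) (verts H)"
      "\<forall>u\<in>verts K. \<forall>v\<in>verts K. {u, v} \<in> edges K \<longleftrightarrow> {f u, f v} \<in> edges H"
      unfolding contains_copy_def isomorphic_def subgraph_def G_def graph.sel subset_empty by blast
    from H obtain a b where ab: "{a, b} \<in> edges H" "a \<in> verts H" "b \<in> verts H"
    proof -
      from H(2) obtain e where e: "e \<in> edges H" by blast
      then have "card e = 2" "e \<subseteq> verts H" using H(1) by (auto simp: simple_graph_def)
      then obtain a b where "e = {a, b}" by (auto simp: card_2_iff)
      then show thesis using that[of a b] e \<open>e \<subseteq> verts H\<close> by simp
    qed
    then obtain u v where "u \<in> verts K" "v \<in> verts K" "a = f u" "b = f v"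
      using bij_betw_imp_surj_on[OF K(2)] by (metis imageE)
    then show False using K(1,3) ab(1) by simp
  qed
  moreover have "simple_graph G" "card (verts G) = n"
    by (auto simp: G_def simple_graph_def)
  ultimately show "S \<noteq> {}"
    unfolding S_def by (metis (mono_tags, lifting) empty_iff mem_Collect_eq)
qed

end

theory Submission
  imports Defs "HOL-Algebra.Algebraic_Closure_Type" "HOL-Library.Z2"
begin

text \<open>Lower bound. Let \<open>F\<close> be a field with \<open>q = 2 ^ r\<close> elements. The vertices are the pairs
  \<open>(a, P)\<close> on one side and \<open>(b, Q)\<close> on the other, with \<open>a\<close>, \<open>b\<close> in \<open>F ^ k\<close> and \<open>P\<close>, \<open>Q\<close> in
  \<open>F ^ (k - 1)\<close>; they are adjacent if \<open>P + Q = f(a, b)\<close>, where \<open>f\<close> is a polynomial map whose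
  coefficients \<open>y\<close> satisfy no polynomial relation of bounded degree over the prime field. In the link of
  an edge over \<open>(a0, b0)\<close>, \<open>a\<close> and \<open>b\<close> are adjacent iff \<open>f(a, b) + f(a, b0) + f(a0, b) + f(a0, b0) = 0\<close>.
  A path of length \<open>k\<close> has \<open>k (k - 1)\<close> coordinates at its inner vertices and imposes as many linear
  conditions on \<open>y\<close>. If the link contained a theta with many paths, then \<open>s = 4 k + 1\<close> of them
  would have a coordinate that is not algebraic, in bounded degree, over \<open>y\<close> and the earlier ones.
  Solving the linear conditions expresses \<open>y\<close> and these \<open>s\<close> coordinates rationally in only
  \<open>4 k\<close> more elements than \<open>y\<close> has entries, which forces a relation of bounded degree among them.

  Upper bound. In a breadth-first search from a vertex of a theta-free bipartite graph, consecutive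
  levels up to \<open>k\<close> span sparse graphs: in a dense one, either many vertices have neighbours in
  many branches below some ancestor, and a spider ending in distinct branches closes up to a theta, or
  one branch remains dense. Hence \<open>n\<close> vertices span \<open>O(n ^ (1 + 1 / k))\<close> edges. Applied to
  links, this bounds the number of four-cycles through an edge from above, and convexity bounds the number
  of four-cycles from below; vertices of large degree on both sides are handled by induction.\<close>

section \<open>Polynomial values over the prime field of characteristic two\<close>

text \<open>The exponent comes from two balances. For the lower bound, with q = 2 ^ r, there are 2 *
  q ^ (2 * k - 1) vertices and at least q ^ (3 * k - 1) edges. For the upper bound, a graph with d
  edges per vertex has about d ^ 4 four-cycles, while links cut down to O(d) vertices have O(d ^ (1
  + 1 / k)) edges each; comparing gives d ^ (2 - 1 / k) = O(n). The obstacle in the lower bound is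
  that every element of a finite field is algebraic over the prime field, so transcendence has to be
  measured in bounded degree, and that degree must be fixed in terms of \<open>k\<close> before the
  field is chosen. Characteristic two makes this a matter of counting finite sets: a polynomial over
  the prime field is a set of monomials, and signs disappear. The number \<open>4 * k\<close> counts
  the coordinates of the root edge and of the two ends of the theta. They are shared by all paths,
  whereas each chosen path contributes one independent element, so \<open>4 * k + 1\<close> paths
  are already too many.\<close>

text \<open>The field elements in \<open>V\<close> serve both as variables and as the point of
  evaluation. A polynomial with coefficients 0 and 1 is encoded by the set \<open>S\<close> of the
  exponent vectors of its monomials, and \<open>D\<close> bounds the degree in each variable
  separately.\<close>

definition poly_vals :: "'a set \<Rightarrow> nat \<Rightarrow> 'a::field set" where
  "poly_vals V D = (\<lambda>S. \<Sum>m\<in>S. \<Prod>v\<in>V. v ^ m v) ` Pow (V \<rightarrow>\<^sub>E {..D})"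

lemma finite_monoms: "finite V \<Longrightarrow> finite (V \<rightarrow>\<^sub>E {..D::nat})"
  by (simp add: finite_PiE)

lemma finite_poly_vals: "finite V \<Longrightarrow> finite (poly_vals V D)"
  by (simp add: poly_vals_def finite_monoms)

lemma card_poly_vals_le:
  assumes "finite V"
  shows "card (poly_vals V D) \<le> 2 ^ (Suc D ^ card V)"
proof -
  have "card (poly_vals V D) \<le> card (Pow (V \<rightarrow>\<^sub>E {..D}))"
    unfolding poly_vals_def by (rule card_image_le) (simp add: finite_monoms assms)
  also have "\<dots> = 2 ^ (Suc D ^ card V)"
    using assms by (simp add: card_Pow finite_monoms card_PiE)
  finally show ?thesis .
qed

lemma poly_vals_monom:
  assumes "\<And>v. v \<in> V \<Longrightarrow> m v \<le> D"
  shows "(\<Prod>v\<in>V. v ^ m v) \<in> poly_vals V D"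
proof -
  have "(\<Prod>v\<in>V. v ^ m v) = (\<Sum>m\<in>{restrict m V}. \<Prod>v\<in>V. v ^ m v)" by simp
  then show ?thesis
    unfolding poly_vals_def by (rule image_eqI) (use assms in auto)
qed

lemma poly_vals_0: "0 \<in> poly_vals V D"
  unfolding poly_vals_def by (rule image_eqI[where x = "{}"]) auto

lemma poly_vals_1: "1 \<in> poly_vals V D"
  using poly_vals_monom[of V "\<lambda>_. 0" D] by simp

lemma poly_vals_member:
  assumes "finite V" "v \<in> V" "D \<ge> 1"
  shows "v \<in> poly_vals V D"
proof -
  have "(\<Prod>u\<in>V. u ^ (if u = v then 1 else 0)) = (\<Prod>u\<in>V. if u = v then u else 1)"
    by (rule prod.cong) auto
  also have "\<dots> = v"
    using assms by (simp add: prod.delta')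
  finally show ?thesis
    using poly_vals_monom[of V "\<lambda>u. if u = v then 1 else 0" D] assms(3) by simp
qed

lemma poly_vals_mono:
  assumes "finite V'" "V \<subseteq> V'" "D \<le> D'"
  shows "poly_vals V D \<subseteq> poly_vals V' D'"
proof
  fix x assume "x \<in> poly_vals V D"
  then obtain S where S: "S \<subseteq> V \<rightarrow>\<^sub>E {..D}" "x = (\<Sum>m\<in>S. \<Prod>v\<in>V. v ^ m v)"
    by (auto simp: poly_vals_def)
  define h where "h m = (\<lambda>v\<in>V'. if v \<in> V then m v else (0::nat))" for m
  have inj: "inj_on h S"
  proof (rule inj_onI)
    fix m m' assume *: "m \<in> S" "m' \<in> S" "h m = h m'"
    have "m v = m' v" if "v \<in> V" for v
      using fun_cong[OF *(3), of v] that assms(2) by (auto simp: h_def subset_iff)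
    then show "m = m'"
      using *(1,2) S(1) by (intro PiE_ext[of m V _ m']) auto
  qed
  have "x = (\<Sum>m\<in>h ` S. \<Prod>v\<in>V'. v ^ m v)"
    unfolding S(2) sum.reindex[OF inj] o_def
  proof (rule sum.cong[OF refl])
    fix m
    show "(\<Prod>v\<in>V. v ^ m v) = (\<Prod>v\<in>V'. v ^ h m v)"
      by (rule prod.mono_neutral_cong_left) (use assms in \<open>auto simp: h_def\<close>)
  qed
  moreover have "h ` S \<subseteq> V' \<rightarrow>\<^sub>E {..D'}"
  proof (intro image_subsetI PiE_I)
    fix m v assume "m \<in> S" "v \<in> V'"
    then show "h m v \<in> {..D'}"
      using S(1) assms(3) by (auto simp: h_def PiE_iff subset_iff Ball_def intro: order_trans)
  qed (auto simp: h_def)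
  ultimately show "x \<in> poly_vals V' D'"
    unfolding poly_vals_def by blast
qed

locale char2_field =
  fixes dummy :: "'a::field itself"
  assumes one_add_one: "(1::'a) + 1 = 0"
begin

lemma add_self: "(x::'a) + x = 0"
  using one_add_one by (metis distrib_left mult.right_neutral mult_zero_right)

lemma add_eq_0_iff_eq: "(x::'a) + y = 0 \<longleftrightarrow> x = y"
  using add_self by (metis add_right_cancel)

text \<open>The terms over \<open>S \<inter> T\<close> occur twice and cancel. Addition of
  polynomials is thus the symmetric difference of their sets of monomials, and it keeps the degree
  bound.\<close>

lemma sum_sym_diff:
  fixes f :: "'b \<Rightarrow> 'a"
  assumes "finite S" "finite T"
  shows "sum f (S - T \<union> (T - S)) = sum f S + sum f T"
proof -
  have "sum f S = sum f (S \<inter> T) + sum f (S - T)" "sum f T = sum f (S \<inter> T) + sum f (T - S)"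
    using assms by (metis sum.Int_Diff, metis sum.Int_Diff inf_commute)
  moreover have "sum f (S - T \<union> (T - S)) = sum f (S - T) + sum f (T - S)"
    by (rule sum.union_disjoint) (use assms in auto)
  ultimately show ?thesis
    using add_self[of "sum f (S \<inter> T)"]
    by (metis (no_types, lifting) add.assoc add.commute add.right_neutral)
qed

lemma poly_vals_add:
  assumes V: "finite (V :: 'a set)" and "x \<in> poly_vals V D" "y \<in> poly_vals V D"
  shows "x + y \<in> poly_vals V D"
proof -
  obtain S where S: "S \<subseteq> V \<rightarrow>\<^sub>E {..D}" "x = (\<Sum>m\<in>S. \<Prod>v\<in>V. v ^ m v)"
    using assms(2) by (auto simp: poly_vals_def)
  obtain T where T: "T \<subseteq> V \<rightarrow>\<^sub>E {..D}" "y = (\<Sum>m\<in>T. \<Prod>v\<in>V. v ^ m v)"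
    using assms(3) by (auto simp: poly_vals_def)
  have "finite S" "finite T"
    using S T finite_monoms[OF V] finite_subset by blast+
  then have "x + y = (\<Sum>m\<in>S - T \<union> (T - S). \<Prod>v\<in>V. v ^ m v)"
    by (simp add: sum_sym_diff S(2) T(2))
  moreover have "S - T \<union> (T - S) \<in> Pow (V \<rightarrow>\<^sub>E {..D})"
    using S T by blast
  ultimately show ?thesis
    unfolding poly_vals_def by (rule image_eqI)
qed

lemma poly_vals_sum:
  assumes "finite (V :: 'a set)" "\<And>i. i \<in> I \<Longrightarrow> f i \<in> poly_vals V D"
  shows "(\<Sum>i\<in>I. f i) \<in> poly_vals V D"
  using assms(2)
  by (induction I rule: infinite_finite_induct) (auto intro: poly_vals_0 poly_vals_add[OF assms(1)])

lemma poly_vals_mult: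
  assumes V: "finite (V :: 'a set)" and "x \<in> poly_vals V D" "y \<in> poly_vals V D'"
  shows "x * y \<in> poly_vals V (D + D')"
proof -
  obtain S where S: "S \<subseteq> V \<rightarrow>\<^sub>E {..D}" "x = (\<Sum>m\<in>S. \<Prod>v\<in>V. v ^ m v)"
    using assms(2) by (auto simp: poly_vals_def)
  obtain T where T: "T \<subseteq> V \<rightarrow>\<^sub>E {..D'}" "y = (\<Sum>m\<in>T. \<Prod>v\<in>V. v ^ m v)"
    using assms(3) by (auto simp: poly_vals_def)
  have "x * y = (\<Sum>m\<in>S. \<Sum>m'\<in>T. \<Prod>v\<in>V. v ^ (m v + m' v))"
    unfolding S(2) T(2) by (simp add: sum_product prod.distrib power_add)
  \<comment> \<open>Different pairs of monomials can have the same product, so the sum is formed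
    inside \<open>poly_vals\<close>, where repetitions cancel, and not over a set of
    products.\<close>
  also have "\<dots> \<in> poly_vals V (D + D')"
  proof (intro poly_vals_sum[OF V] poly_vals_monom)
    fix m m' v assume "m \<in> S" "m' \<in> T" "v \<in> V"
    then have "m v \<le> D" "m' v \<le> D'" using S T by (auto dest!: subsetD)
    then show "m v + m' v \<le> D + D'" by simp
  qed
  finally show ?thesis .
qed

lemma poly_vals_power:
  assumes V: "finite (V :: 'a set)" and "x \<in> poly_vals V D"
  shows "x ^ n \<in> poly_vals V (n * D)"
  by (induction n) (auto intro: poly_vals_1 poly_vals_mult[OF V assms(2)])

lemma poly_vals_prod:
  assumes V: "finite (V :: 'a set)" and "finite I" "\<And>i. i \<in> I \<Longrightarrow> f i \<in> poly_vals V (d i)"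
  shows "(\<Prod>i\<in>I. f i) \<in> poly_vals V (\<Sum>i\<in>I. d i)"
  using assms(2,3)
  by (induction I rule: finite_induct) (auto intro: poly_vals_1 poly_vals_mult[OF V])

end

section \<open>Algebraic dependence in bounded degree\<close>

text \<open>One bound \<open>D\<close> serves for the degree of the polynomial and for the degrees
  in \<open>V\<close> of its coefficients. Because of it the set has a size bounded in terms of
  \<open>card V\<close> and \<open>D\<close> only, however large the field is.\<close>

definition algebraic_vals :: "'a set \<Rightarrow> nat \<Rightarrow> 'a::field set" where
  "algebraic_vals V D =
     {w. \<exists>p. p \<noteq> 0 \<and> degree p \<le> D \<and> (\<forall>i. coeff p i \<in> poly_vals V D) \<and> poly p w = 0}"

text \<open>The number of coefficient vectors of length \<open>Suc D\<close>, times the at most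
  \<open>D\<close> roots of each polynomial.\<close>

definition algebraic_bound :: "nat \<Rightarrow> nat \<Rightarrow> nat" where
  "algebraic_bound n D = (2 ^ (Suc D ^ n)) ^ Suc D * D"

lemma algebraic_vals_bound:
  fixes V :: "'a::field set"
  assumes V: "finite V" and n: "card V \<le> n"
  shows "finite (algebraic_vals V D)" "card (algebraic_vals V D) \<le> algebraic_bound n D"
proof -
  define P where "P = {p. p \<noteq> 0 \<and> degree p \<le> D \<and> (\<forall>i. coeff p i \<in> poly_vals V D)}"
  have inj: "inj_on (\<lambda>p. restrict (coeff p) {..D}) P"
  proof (rule inj_onI)
    fix p p' :: "'a poly"
    assume *: "p \<in> P" "p' \<in> P" "restrict (coeff p) {..D} = restrict (coeff p') {..D}"
    show "p = p'"
    proof (rule poly_eqI)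
      fix i show "coeff p i = coeff p' i"
      proof (cases "i \<le> D")
        case True then show ?thesis using fun_cong[OF *(3), of i] by simp
      next
        case False then show ?thesis using * by (simp add: P_def coeff_eq_0)
      qed
    qed
  qed
  have sub: "(\<lambda>p. restrict (coeff p) {..D}) ` P \<subseteq> {..D} \<rightarrow>\<^sub>E poly_vals V D"
    by (intro image_subsetI PiE_I) (auto simp: P_def)
  have finE: "finite ({..D} \<rightarrow>\<^sub>E poly_vals V D)"
    by (simp add: finite_PiE finite_poly_vals V)
  have finP: "finite P"
    using inj_on_finite[OF inj sub finE] .
  have "card P \<le> card ({..D} \<rightarrow>\<^sub>E poly_vals V D)"
    by (rule card_inj_on_le[OF inj sub finE])
  also have "\<dots> = card (poly_vals V D) ^ Suc D"
    by (simp add: card_PiE)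
  also have "\<dots> \<le> (2 ^ (Suc D ^ card V)) ^ Suc D"
    by (intro power_mono card_poly_vals_le V) simp
  also have "\<dots> \<le> (2 ^ (Suc D ^ n)) ^ Suc D"
    by (intro power_mono power_increasing n) auto
  finally have cardP: "card P \<le> (2 ^ (Suc D ^ n)) ^ Suc D" .
  have eq: "algebraic_vals V D = (\<Union>p\<in>P. {w. poly p w = 0})"
    by (auto simp: algebraic_vals_def P_def)
  show "finite (algebraic_vals V D)"
    unfolding eq by (intro finite_UN_I finP poly_roots_finite) (auto simp: P_def)
  have "card (algebraic_vals V D) \<le> (\<Sum>p\<in>P. card {w. poly p w = 0})"
    unfolding eq by (rule card_UN_le[OF finP])
  also have "\<dots> \<le> card P * D"
  proof -
    have "(\<Sum>p\<in>P. card {w. poly p w = 0}) \<le> of_nat (card P) * D"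
    proof (rule sum_bounded_above)
      fix p assume "p \<in> P"
      then have "p \<noteq> 0" "degree p \<le> D" by (auto simp: P_def)
      then show "card {w. poly p w = 0} \<le> D"
        using card_poly_roots_bound[of p] by simp
    qed
    then show ?thesis by simp
  qed
  also have "\<dots> \<le> algebraic_bound n D"
    unfolding algebraic_bound_def by (intro mult_right_mono cardP) simp
  finally show "card (algebraic_vals V D) \<le> algebraic_bound n D" .
qed

text \<open>Each new element avoids the \<open>algebraic_vals\<close> of the earlier ones. The set
  forgets the order of insertion; it only records that a suitable order exists.\<close>

inductive indep_vals :: "nat \<Rightarrow> 'a::field set \<Rightarrow> bool" for D where
  indep_empty: "indep_vals D {}"
| indep_insert: "indep_vals D Z \<Longrightarrow> z \<notin> algebraic_vals Z D \<Longrightarrow> indep_vals D (insert z Z)"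

lemma indep_vals_finite: "indep_vals D Z \<Longrightarrow> finite Z"
  by (induction rule: indep_vals.induct) auto

context char2_field
begin

text \<open>The witness is X + z, which vanishes at z since z + z = 0. An element outside
  \<open>algebraic_vals Z D\<close> is therefore new, so that insertions raise the
  cardinality.\<close>

lemma member_algebraic_vals:
  assumes "finite (Z :: 'a set)" "z \<in> Z" "D \<ge> 1"
  shows "z \<in> algebraic_vals Z D"
proof -
  have "coeff [:z, 1:] i \<in> poly_vals Z D" for i
    using poly_vals_member[OF assms] poly_vals_1 poly_vals_0
    by (auto simp: coeff_pCons split: nat.splits)
  then show ?thesis
    unfolding algebraic_vals_def mem_Collect_eq
    by (intro exI[of _ "[:z, 1:]"]) (use assms(3) in \<open>auto simp: add_self\<close>)
qed

text \<open>Sorting the monomials by the exponent \<open>i\<close> of the last element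
  \<open>z\<close> turns the sum into a polynomial in \<open>z\<close> whose coefficients
  \<open>c i\<close> are values over the earlier elements. One of them belongs to a non-empty set of
  monomials and is non-zero by induction, so a vanishing sum would make \<open>z\<close>
  algebraic.\<close>

lemma indep_vals_no_relation:
  assumes "indep_vals D (Z :: 'a set)" "D \<ge> 1" "T \<subseteq> Z \<rightarrow>\<^sub>E {..D}" "T \<noteq> {}"
  shows "(\<Sum>m\<in>T. \<Prod>v\<in>Z. v ^ m v) \<noteq> 0"
  using assms
proof (induction arbitrary: T rule: indep_vals.induct)
  case indep_empty
  then have "T = {\<lambda>_. undefined}" by auto
  then show ?case by simp
next
  case (indep_insert Z z)
  have fin: "finite Z" using indep_insert(1) by (rule indep_vals_finite)
  have z: "z \<notin> Z" using member_algebraic_vals[OF fin _ indep_insert(4)] indep_insert(2) by blast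
  have finT: "finite T"
    using indep_insert(5) by (rule finite_subset) (simp add: finite_monoms fin)
  define T' where "T' i = (\<lambda>m. restrict m Z) ` {m \<in> T. m z = i}" for i
  define c where "c i = (\<Sum>m\<in>T' i. \<Prod>v\<in>Z. v ^ m v)" for i
  have T'sub: "T' i \<subseteq> Z \<rightarrow>\<^sub>E {..D}" for i
    using indep_insert(5) by (fastforce simp: T'_def)
  have inj: "inj_on (\<lambda>m. restrict m Z) {m \<in> T. m z = i}" for i
  proof (rule inj_onI)
    fix m m' assume *: "m \<in> {m \<in> T. m z = i}" "m' \<in> {m \<in> T. m z = i}" "restrict m Z = restrict m' Z"
    have "m v = m' v" if "v \<in> insert z Z" for v
      using * that by (cases "v \<in> Z") (metis restrict_apply', auto)
    then show "m = m'"
      using * indep_insert(5) by (intro PiE_ext[of m "insert z Z" _ m']) auto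
  qed
  have le: "m z \<le> D" if "m \<in> T" for m
    using indep_insert(5) that by auto
  have "(\<Sum>m\<in>T. \<Prod>v\<in>insert z Z. v ^ m v) = (\<Sum>i\<le>D. \<Sum>m | m \<in> T \<and> m z = i. \<Prod>v\<in>insert z Z. v ^ m v)"
    using sum.group[OF finT, of "{..D}" "\<lambda>m. m z" "\<lambda>m. \<Prod>v\<in>insert z Z. v ^ m v"] le
    by (simp add: image_subset_iff)
  also have "\<dots> = (\<Sum>i\<le>D. c i * z ^ i)"
  proof (rule sum.cong[OF refl])
    fix i
    have "(\<Sum>m | m \<in> T \<and> m z = i. \<Prod>v\<in>insert z Z. v ^ m v)
        = (\<Sum>m | m \<in> T \<and> m z = i. (\<Prod>v\<in>Z. v ^ m v) * z ^ i)"
      by (rule sum.cong[OF refl]) (use fin z in \<open>auto simp: mult.commute\<close>)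
    also have "\<dots> = c i * z ^ i"
      unfolding c_def T'_def sum.reindex[OF inj] by (simp add: sum_distrib_right)
    finally show "(\<Sum>m | m \<in> T \<and> m z = i. \<Prod>v\<in>insert z Z. v ^ m v) = c i * z ^ i" .
  qed
  finally have eq: "(\<Sum>m\<in>T. \<Prod>v\<in>insert z Z. v ^ m v) = (\<Sum>i\<le>D. c i * z ^ i)" .
  obtain m0 where m0: "m0 \<in> T" using indep_insert(6) by blast
  have c0: "c (m0 z) \<noteq> 0"
    unfolding c_def
    by (rule indep_insert(3)[OF indep_insert(4) T'sub]) (use m0 in \<open>auto simp: T'_def\<close>)
  show ?case
  proof
    assume 0: "(\<Sum>m\<in>T. \<Prod>v\<in>insert z Z. v ^ m v) = 0"
    define p where "p = (\<Sum>i\<le>D. monom (c i) i)"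
    have coeff: "coeff p i = (if i \<le> D then c i else 0)" for i
      unfolding p_def coeff_sum by (simp add: sum.delta')
    have "p \<noteq> 0"
      using c0 coeff[of "m0 z"] le[OF m0] by auto
    moreover have "degree p \<le> D"
      by (rule degree_le) (simp add: coeff)
    moreover have "coeff p i \<in> poly_vals Z D" for i
      unfolding coeff c_def using T'sub by (auto simp: poly_vals_def intro: poly_vals_0[unfolded poly_vals_def])
    moreover have "poly p z = 0"
      using 0 eq by (simp add: p_def poly_sum poly_monom)
    ultimately show False
      using indep_insert(2) by (auto simp: algebraic_vals_def)
  qed
qed

text \<open>Pigeonhole substitute for transcendence degree: more elements than \<open>card V\<close>, rational
  in \<open>V\<close> with a common denominator, satisfy a relation over the prime field.\<close>
lemma relation_exists:
  assumes V: "finite (V :: 'a set)" and Z: "finite Z"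
    and \<Delta>: "\<Delta> \<noteq> 0" "\<Delta> \<in> poly_vals V d" "\<And>z. z \<in> Z \<Longrightarrow> \<Delta> * z \<in> poly_vals V d"
    and card: "Suc (D * card Z * d) ^ card V < Suc D ^ card Z"
  shows "\<exists>T. T \<subseteq> Z \<rightarrow>\<^sub>E {..D} \<and> T \<noteq> {} \<and> (\<Sum>m\<in>T. \<Prod>v\<in>Z. v ^ m v) = 0"
proof -
  \<comment> \<open>Every monomial has total degree at most \<open>E\<close>, so the factor
    \<open>\<Delta> ^ E\<close> clears all denominators at once.\<close>
  define E where "E = D * card Z"
  define h where "h S = \<Delta> ^ E * (\<Sum>m\<in>S. \<Prod>v\<in>Z. v ^ m v)" for S
  have mono: "\<Delta> ^ E * (\<Prod>v\<in>Z. v ^ m v) \<in> poly_vals V (E * d)" if m: "m \<in> Z \<rightarrow>\<^sub>E {..D}" for m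
  proof -
    define s where "s = (\<Sum>v\<in>Z. m v)"
    have "s \<le> of_nat (card Z) * D"
      unfolding s_def by (rule sum_bounded_above) (use m in auto)
    then have s: "s \<le> E" by (simp add: E_def mult.commute)
    have "\<Delta> ^ E * (\<Prod>v\<in>Z. v ^ m v) = \<Delta> ^ (E - s) * (\<Prod>v\<in>Z. (\<Delta> * v) ^ m v)"
      using s by (simp add: power_mult_distrib prod.distrib power_sum[symmetric] s_def[symmetric] power_add[symmetric])
    also have "\<dots> \<in> poly_vals V ((E - s) * d + (\<Sum>v\<in>Z. m v * d))"
      by (intro poly_vals_mult[OF V] poly_vals_power[OF V] poly_vals_prod[OF V Z] \<Delta>)
    also have "(E - s) * d + (\<Sum>v\<in>Z. m v * d) = E * d"
      using s by (simp add: sum_distrib_right[symmetric] s_def[symmetric] add_mult_distrib[symmetric])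
    finally show ?thesis .
  qed
  have "h ` Pow (Z \<rightarrow>\<^sub>E {..D}) \<subseteq> poly_vals V (E * d)"
    unfolding h_def by (auto simp: sum_distrib_left intro!: poly_vals_sum[OF V] mono)
  then have "card (h ` Pow (Z \<rightarrow>\<^sub>E {..D})) \<le> card (poly_vals V (E * d))"
    by (rule card_mono[OF finite_poly_vals[OF V]])
  also have "\<dots> \<le> 2 ^ (Suc (E * d) ^ card V)"
    by (rule card_poly_vals_le[OF V])
  also have "\<dots> < 2 ^ (Suc D ^ card Z)"
    using card by (intro power_strict_increasing) (auto simp: E_def)
  also have "\<dots> = card (Pow (Z \<rightarrow>\<^sub>E {..D}))"
    using Z by (simp add: card_Pow finite_monoms card_PiE)
  finally have "\<not> inj_on h (Pow (Z \<rightarrow>\<^sub>E {..D}))"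
    using card_image[of h] by fastforce
  then obtain S S' where S: "S \<subseteq> Z \<rightarrow>\<^sub>E {..D}" "S' \<subseteq> Z \<rightarrow>\<^sub>E {..D}" "S \<noteq> S'" "h S = h S'"
    by (auto simp: inj_on_def)
  have fin: "finite S" "finite S'"
    using S finite_monoms[OF Z] finite_subset by blast+
  have "(\<Sum>m\<in>S. \<Prod>v\<in>Z. v ^ m v) = (\<Sum>m\<in>S'. \<Prod>v\<in>Z. v ^ m v)"
    using S(4) \<Delta>(1) by (simp add: h_def)
  \<comment> \<open>Two different sets of monomials with the same value leave a non-empty symmetric
    difference with value 0.\<close>
  then have "(\<Sum>m\<in>S - S' \<union> (S' - S). \<Prod>v\<in>Z. v ^ m v) = 0"
    by (simp add: sum_sym_diff[OF fin] add_self)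
  moreover have "S - S' \<union> (S' - S) \<noteq> {}" "S - S' \<union> (S' - S) \<subseteq> Z \<rightarrow>\<^sub>E {..D}"
    using S by auto
  ultimately show ?thesis by blast
qed

text \<open>For fixed \<open>d\<close> and \<open>card Z\<close> and large \<open>D\<close> the
  inequality forces \<open>card Z \<le> card V\<close>: independent elements cannot outnumber the
  elements in which they are rational with a common denominator.\<close>

lemma indep_vals_card_le:
  assumes "finite (V :: 'a set)" "indep_vals D Z" "D \<ge> 1"
    and "\<Delta> \<noteq> 0" "\<Delta> \<in> poly_vals V d" "\<And>z. z \<in> Z \<Longrightarrow> \<Delta> * z \<in> poly_vals V d"
  shows "Suc D ^ card Z \<le> Suc (D * card Z * d) ^ card V"
proof (rule ccontr)
  assume "\<not> ?thesis"
  then have "\<exists>T. T \<subseteq> Z \<rightarrow>\<^sub>E {..D} \<and> T \<noteq> {} \<and> (\<Sum>m\<in>T. \<Prod>v\<in>Z. v ^ m v) = 0"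
    by (intro relation_exists[OF assms(1) indep_vals_finite[OF assms(2)] assms(4-6)]) auto
  then show False
    using indep_vals_no_relation[OF assms(2,3)] by blast
qed

text \<open>Greedy choice: the elements algebraic over those chosen so far number at most
  \<open>algebraic_bound n D\<close>, so \<open>F\<close> always offers another one.\<close>

lemma indep_vals_exists:
  assumes "finite (F :: 'a set)" "algebraic_bound n D < card F" "D \<ge> 1" "m \<le> n"
  shows "\<exists>Z\<subseteq>F. indep_vals D Z \<and> card Z = m"
  using assms(4)
proof (induction m)
  case 0
  then show ?case by (intro exI[of _ "{}"]) (auto intro: indep_empty)
next
  case (Suc m)
  then obtain Z where Z: "Z \<subseteq> F" "indep_vals D Z" "card Z = m" by auto
  have finZ: "finite Z" using Z(2) by (rule indep_vals_finite)
  have "\<not> F \<subseteq> algebraic_vals Z D"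
    using algebraic_vals_bound[OF finZ, of n D] Z(3) Suc.prems assms(2)
    by (meson Suc_leD card_mono leD le_trans)
  then obtain z where "z \<in> F" "z \<notin> algebraic_vals Z D" by blast
  moreover from this have "z \<notin> Z"
    using member_algebraic_vals[OF finZ _ assms(3)] by blast
  ultimately show ?case
    using Z finZ by (intro exI[of _ "insert z Z"]) (auto intro: indep_insert)
qed

end

text \<open>Supplies the degree at which \<open>indep_vals_card_le\<close> becomes contradictory.
  The left side loses only the factor \<open>Suc c ^ a\<close>, which is constant; with this factor
  as \<open>D\<close>, one more power of \<open>Suc D\<close> absorbs it.\<close>

lemma ex_degree_bound:
  assumes "a < (b::nat)"
  shows "\<exists>D\<ge>1. Suc (D * c) ^ a < Suc D ^ b"
proof -
  define D where "D = Suc c ^ a"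
  have "Suc (D * c) ^ a \<le> (Suc D * Suc c) ^ a"
    by (intro power_mono) auto
  also have "\<dots> = Suc D ^ a * D"
    by (simp add: power_mult_distrib D_def del: mult_Suc mult_Suc_right)
  also have "\<dots> < Suc D ^ a * Suc D"
    by simp
  also have "\<dots> = Suc D ^ Suc a" by simp
  also have "\<dots> \<le> Suc D ^ b"
    using assms by (intro power_increasing) auto
  finally have "Suc (D * c) ^ a < Suc D ^ b" .
  moreover have "D \<ge> 1" by (simp add: D_def)
  ultimately show ?thesis by blast
qed

section \<open>Elimination and interpolation\<close>

text \<open>Degree growth of elimination without division: a new entry is a product of an old one,
  of degree \<open>elim_deg len n\<close>, and an entry of the reduced new row, whose degree is
  larger by \<open>len\<close>.\<close>

primrec elim_deg :: "nat \<Rightarrow> nat \<Rightarrow> nat" where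
  "elim_deg len 0 = 0"
| "elim_deg len (Suc n) = 2 * elim_deg len n + len"

context char2_field
begin

text \<open>Gaussian elimination without division: \<open>P\<close> is the set of pivot columns and
  \<open>\<Delta>\<close> the common denominator of the solution. Linear independence enters through
  test vectors: for each row, some common zero of the earlier rows is not a zero of it.\<close>

lemma elimination:
  fixes row :: "nat \<Rightarrow> 'w \<Rightarrow> 'a"
  assumes W: "finite W" and U: "finite U"
    and "\<And>i w. i < n \<Longrightarrow> w \<in> W \<Longrightarrow> row i w \<in> poly_vals U len"
    and "\<And>i. i < n \<Longrightarrow> \<exists>g. (\<forall>j<i. (\<Sum>w\<in>W. row j w * g w) = 0) \<and> (\<Sum>w\<in>W. row i w * g w) \<noteq> 0"
  shows "\<exists>P \<Delta> N. P \<subseteq> W \<and> card P = n \<and> \<Delta> \<noteq> 0 \<and> \<Delta> \<in> poly_vals U (elim_deg len n) \<and>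
    (\<forall>p\<in>P. \<forall>w\<in>W - P. N p w \<in> poly_vals U (elim_deg len n)) \<and>
    (\<forall>y. (\<forall>i<n. (\<Sum>w\<in>W. row i w * y w) = 0) \<longrightarrow> (\<forall>p\<in>P. \<Delta> * y p = (\<Sum>w\<in>W - P. N p w * y w)))"
  using assms(3,4)
proof (induction n)
  case 0
  show ?case
    by (rule exI[of _ "{}"], rule exI[of _ 1]) (auto intro: poly_vals_1)
next
  case (Suc n)
  let ?e = "elim_deg len n"
  have prem1: "row i w \<in> poly_vals U len" if "i < n" "w \<in> W" for i w
    using Suc.prems(1) that by simp
  have prem2: "\<exists>g. (\<forall>j<i. (\<Sum>w\<in>W. row j w * g w) = 0) \<and> (\<Sum>w\<in>W. row i w * g w) \<noteq> 0"
    if "i < n" for i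
    using Suc.prems(2) that by simp
  obtain P \<Delta> N where P: "P \<subseteq> W" "card P = n" "\<Delta> \<noteq> 0" "\<Delta> \<in> poly_vals U ?e"
    and N: "\<And>p w. p \<in> P \<Longrightarrow> w \<in> W - P \<Longrightarrow> N p w \<in> poly_vals U ?e"
    and sol: "\<And>y p. (\<forall>i<n. (\<Sum>w\<in>W. row i w * y w) = 0) \<Longrightarrow> p \<in> P \<Longrightarrow> \<Delta> * y p = (\<Sum>w\<in>W - P. N p w * y w)"
    using Suc.IH[OF prem1 prem2] by blast
  have finP: "finite P" using P(1) W finite_subset by blast
  \<comment> \<open>Row \<open>n\<close> times \<open>\<Delta>\<close>, with the pivot unknowns
    replaced by their expressions in the free ones.\<close>
  define c where "c w = \<Delta> * row n w + (\<Sum>p\<in>P. row n p * N p w)" for w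
  have c_mem: "c w \<in> poly_vals U (?e + len)" if "w \<in> W - P" for w
  proof -
    have "row n p * N p w \<in> poly_vals U (len + ?e)" if "p \<in> P" for p
      using poly_vals_mult[OF U Suc.prems(1)[of n p] N[OF that \<open>w \<in> W - P\<close>]] P(1) that by auto
    moreover have "\<Delta> * row n w \<in> poly_vals U (?e + len)"
      using poly_vals_mult[OF U P(4) Suc.prems(1)[of n w]] that by auto
    ultimately show ?thesis
      unfolding c_def by (intro poly_vals_add[OF U] poly_vals_sum[OF U]) (simp_all add: add.commute)
  qed
  have row_eq: "\<Delta> * (\<Sum>w\<in>W. row n w * y w) = (\<Sum>w\<in>W - P. c w * y w)"
    if "\<forall>i<n. (\<Sum>w\<in>W. row i w * y w) = 0" for y
  proof -
    have "\<Delta> * (\<Sum>w\<in>W. row n w * y w)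
        = (\<Sum>w\<in>W - P. \<Delta> * row n w * y w) + (\<Sum>p\<in>P. row n p * (\<Delta> * y p))"
      by (subst sum.subset_diff[OF P(1) W]) (simp add: sum_distrib_left distrib_left mult_ac)
    also have "(\<Sum>p\<in>P. row n p * (\<Delta> * y p)) = (\<Sum>p\<in>P. \<Sum>w\<in>W - P. row n p * N p w * y w)"
      by (rule sum.cong[OF refl]) (simp add: sol[OF that] sum_distrib_left mult_ac)
    also have "\<dots> = (\<Sum>w\<in>W - P. (\<Sum>p\<in>P. row n p * N p w) * y w)"
      by (subst sum.swap) (simp add: sum_distrib_right)
    also have "(\<Sum>w\<in>W - P. \<Delta> * row n w * y w) + \<dots> = (\<Sum>w\<in>W - P. c w * y w)"
      by (simp add: c_def sum.distrib distrib_right)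
    finally show ?thesis .
  qed
  obtain g where g: "\<forall>j<n. (\<Sum>w\<in>W. row j w * g w) = 0" "(\<Sum>w\<in>W. row n w * g w) \<noteq> 0"
    using Suc.prems(2)[of n] by auto
  have "(\<Sum>w\<in>W - P. c w * g w) \<noteq> 0"
    using row_eq[OF g(1)] g(2) P(3) by (simp flip: row_eq[OF g(1)])
  then obtain w0 where w0: "w0 \<in> W - P" "c w0 \<noteq> 0"
    by (metis (no_types, lifting) mult_zero_left sum.neutral)
  define P' where "P' = insert w0 P"
  \<comment> \<open>The old formulas are multiplied by the new pivot \<open>c w0\<close> and the
    unknown at \<open>w0\<close> is then eliminated by the new row; no minus sign appears because
    \<open>1 + 1 = 0\<close>. The formula for \<open>w0\<close> is multiplied by
    \<open>\<Delta>\<close> to reach the same denominator.\<close>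
  define N' where "N' p w = (if p = w0 then \<Delta> * c w else c w0 * N p w + N p w0 * c w)" for p w
  have split: "(\<Sum>w\<in>W - P. h w) = h w0 + (\<Sum>w\<in>W - P'. h w)" for h :: "'w \<Rightarrow> 'a"
  proof -
    have "W - P = insert w0 (W - P')" using w0 by (auto simp: P'_def)
    moreover have "w0 \<notin> W - P'" by (auto simp: P'_def)
    ultimately show ?thesis using W by simp
  qed
  have sol': "\<Delta> * c w0 * y p = (\<Sum>w\<in>W - P'. N' p w * y w)"
    if y: "\<forall>i<Suc n. (\<Sum>w\<in>W. row i w * y w) = 0" and p: "p \<in> P'" for y p
  proof -
    have y': "\<forall>i<n. (\<Sum>w\<in>W. row i w * y w) = 0" using y by simp
    have "(\<Sum>w\<in>W - P. c w * y w) = 0" using row_eq[OF y'] y by simp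
    then have "c w0 * y w0 + (\<Sum>w\<in>W - P'. c w * y w) = 0"
      by (simp only: split)
    then have c0: "c w0 * y w0 = (\<Sum>w\<in>W - P'. c w * y w)"
      by (simp only: add_eq_0_iff_eq)
    show ?thesis
    proof (cases "p = w0")
      case True
      have "\<Delta> * c w0 * y w0 = \<Delta> * (\<Sum>w\<in>W - P'. c w * y w)"
        using c0 by (simp add: mult.assoc)
      then show ?thesis using True by (simp add: N'_def sum_distrib_left mult.assoc)
    next
      case False
      then have "\<Delta> * y p = N p w0 * y w0 + (\<Sum>w\<in>W - P'. N p w * y w)"
        using sol[OF y', of p] p by (simp add: P'_def split)
      then have "c w0 * (\<Delta> * y p) = c w0 * (N p w0 * y w0 + (\<Sum>w\<in>W - P'. N p w * y w))"
        by (rule arg_cong)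
      then have "\<Delta> * c w0 * y p = N p w0 * (c w0 * y w0) + c w0 * (\<Sum>w\<in>W - P'. N p w * y w)"
        by (simp add: distrib_left mult_ac)
      then show ?thesis using False
        by (simp add: c0 N'_def sum_distrib_left sum.distrib distrib_right distrib_left mult_ac add_ac)
    qed
  qed
  have e: "elim_deg len (Suc n) = ?e + (?e + len)" "elim_deg len (Suc n) = (?e + len) + ?e" by simp_all
  have "N' p w \<in> poly_vals U (elim_deg len (Suc n))" if "p \<in> P'" "w \<in> W - P'" for p w
  proof (cases "p = w0")
    case True
    then show ?thesis
      unfolding e(1) N'_def using that by (auto simp: P'_def intro!: poly_vals_mult[OF U P(4)] c_mem)
  next
    case False
    have "c w0 * N p w \<in> poly_vals U (elim_deg len (Suc n))"
      unfolding e(2) using that False by (intro poly_vals_mult[OF U] c_mem N w0(1)) (auto simp: P'_def)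
    moreover have "N p w0 * c w \<in> poly_vals U (elim_deg len (Suc n))"
      unfolding e(1) using that False by (intro poly_vals_mult[OF U] c_mem N w0(1)) (auto simp: P'_def)
    ultimately show ?thesis using False by (simp add: N'_def poly_vals_add[OF U])
  qed
  moreover have "\<Delta> * c w0 \<in> poly_vals U (elim_deg len (Suc n))"
    unfolding e(1) by (intro poly_vals_mult[OF U P(4)] c_mem w0(1))
  moreover have "P' \<subseteq> W" "card P' = Suc n" "\<Delta> * c w0 \<noteq> 0"
    using P w0 finP by (auto simp: P'_def)
  ultimately show ?case
    using sol' by (intro exI[of _ P'] exI[of _ "\<Delta> * c w0"] exI[of _ N']) blast
qed

end

section \<open>Polynomial maps, linear in their coefficients\<close>

text \<open>A word spells a monomial letter by letter: 0 stands for the constant 1, the letters 1 to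
  \<open>k\<close> for the coordinates of \<open>a\<close>, and \<open>k + 1\<close> to
  \<open>2 * k\<close> for those of \<open>b\<close>. Several words may give one monomial; in
  exchange a product of \<open>len\<close> affine forms expands with exactly one term per
  word.\<close>

definition words :: "nat \<Rightarrow> nat \<Rightarrow> (nat \<Rightarrow> nat) set" where
  "words k len = {..<len} \<rightarrow>\<^sub>E {..2 * k}"

definition coord :: "nat \<Rightarrow> (nat \<Rightarrow> 'a) \<Rightarrow> (nat \<Rightarrow> 'a) \<Rightarrow> nat \<Rightarrow> 'a::field" where
  "coord k a b c = (if c = 0 then 1 else if c \<le> k then a (c - 1) else b (c - Suc k))"

definition word_val :: "nat \<Rightarrow> nat \<Rightarrow> (nat \<Rightarrow> 'a) \<Rightarrow> (nat \<Rightarrow> 'a) \<Rightarrow> (nat \<Rightarrow> nat) \<Rightarrow> 'a::field" where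
  "word_val k len a b w = (\<Prod>i<len. coord k a b (w i))"

definition poly_map ::
    "nat \<Rightarrow> nat \<Rightarrow> (nat \<times> (nat \<Rightarrow> nat) \<Rightarrow> 'a) \<Rightarrow> nat \<Rightarrow> (nat \<Rightarrow> 'a) \<Rightarrow> (nat \<Rightarrow> 'a) \<Rightarrow> 'a::field" where
  "poly_map k len y m a b = (\<Sum>w\<in>words k len. y (m, w) * word_val k len a b w)"

text \<open>The coefficients of the condition on \<open>y\<close> for adjacency of \<open>a\<close>
  and \<open>b\<close> in a link over \<open>(a0, b0)\<close>: a mixed second difference, with all
  signs positive in characteristic two. The row is the same for each of the \<open>k - 1\<close>
  components of the map.\<close>

definition link_row ::
    "nat \<Rightarrow> nat \<Rightarrow> (nat \<Rightarrow> 'a) \<Rightarrow> (nat \<Rightarrow> 'a) \<Rightarrow> (nat \<Rightarrow> 'a) \<Rightarrow> (nat \<Rightarrow> 'a) \<Rightarrow> (nat \<Rightarrow> nat) \<Rightarrow> 'a::field" where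
  "link_row k len a0 b0 a b w = word_val k len a b w + word_val k len a b0 w
     + word_val k len a0 b w + word_val k len a0 b0 w"

lemma finite_words: "finite (words k len)"
  by (simp add: words_def finite_PiE)

lemma card_words: "card (words k len) = Suc (2 * k) ^ len"
  by (simp add: words_def card_PiE)

lemma sum_link_row:
  "(\<Sum>w\<in>words k len. link_row k len a0 b0 a b w * y (m, w)) =
     poly_map k len y m a b + poly_map k len y m a b0 + poly_map k len y m a0 b + poly_map k len y m a0 b0"
  by (simp add: link_row_def poly_map_def sum.distrib distrib_right distrib_left mult.commute)

context char2_field
begin

lemma link_row_poly_vals:
  assumes U: "finite (U :: 'a set)" and "\<And>c. c < k \<Longrightarrow> a0 c \<in> U \<and> b0 c \<in> U \<and> a c \<in> U \<and> b c \<in> U"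
    and w: "w \<in> words k len"
  shows "link_row k len a0 b0 a b w \<in> poly_vals U len"
proof -
  have *: "word_val k len a b w \<in> poly_vals U len" if "\<And>c. c < k \<Longrightarrow> a c \<in> U \<and> b c \<in> U" for a b
  proof -
    have "coord k a b (w i) \<in> poly_vals U 1" if "i < len" for i
    proof -
      have "w i \<le> 2 * k" using w that by (auto simp: words_def)
      then consider "w i = 0" | "w i \<noteq> 0" "w i - 1 < k" "w i \<le> k" | "w i > k" "w i - Suc k < k"
        by linarith
      then show ?thesis
        by cases (auto simp: coord_def poly_vals_1 intro!: poly_vals_member[OF U] simp: \<open>\<And>c. c < k \<Longrightarrow> a c \<in> U \<and> b c \<in> U\<close>)
    qed
    then have "word_val k len a b w \<in> poly_vals U (\<Sum>i<len. 1)"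
      unfolding word_val_def by (intro poly_vals_prod[OF U]) auto
    then show ?thesis by simp
  qed
  show ?thesis
    unfolding link_row_def by (intro poly_vals_add[OF U] *) (use assms(2) in auto)
qed

text \<open>\<open>g\<close> holds the coefficients of a product of \<open>Suc n\<close> affine
  forms, none of which vanishes at point \<open>i\<close>. For \<open>l < n\<close> and
  \<open>l \<noteq> i\<close> factor \<open>l\<close> vanishes at point \<open>l\<close>; factor
  \<open>i\<close> vanishes wherever \<open>a = a0\<close>, and factor \<open>n\<close> wherever
  \<open>b = b0\<close>. The last two kill the three correction terms in \<open>link_row\<close>, so
  that the row just evaluates the product. This is the origin of the word length
  \<open>Suc n\<close>.\<close>

lemma interpolation:
  fixes pa pb :: "nat \<Rightarrow> nat \<Rightarrow> 'a"
  assumes i: "i < n"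
    and a0: "\<exists>c<k. pa i c \<noteq> a0 c" and b0: "\<exists>c<k. pb i c \<noteq> b0 c"
    and dist: "\<And>j. j < n \<Longrightarrow> j \<noteq> i \<Longrightarrow> \<exists>c<k. pa i c \<noteq> pa j c \<or> pb i c \<noteq> pb j c"
  shows "\<exists>g. (\<forall>j<n. j \<noteq> i \<longrightarrow> (\<Sum>w\<in>words k (Suc n). link_row k (Suc n) a0 b0 (pa j) (pb j) w * g w) = 0)
    \<and> (\<Sum>w\<in>words k (Suc n). link_row k (Suc n) a0 b0 (pa i) (pb i) w * g w) \<noteq> 0"
proof -
  define Q where "Q l c v \<longleftrightarrow> c \<noteq> 0 \<and> c \<le> 2 * k \<and> coord k (pa i) (pb i) c \<noteq> v \<and>
      (l < n \<longrightarrow> l \<noteq> i \<longrightarrow> coord k (pa l) (pb l) c = v) \<and>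
      (l = i \<longrightarrow> (\<forall>b. coord k a0 b c = v)) \<and> (l = n \<longrightarrow> (\<forall>a. coord k a b0 c = v))" for l c v
  have "\<exists>c v. Q l c v" for l
  proof -
    consider "l = i" | "l = n" "l \<noteq> i" | "l < n" "l \<noteq> i" | "l > n" by linarith
    then show ?thesis
    proof cases
      case 1
      then obtain c where "c < k" "pa i c \<noteq> a0 c" using a0 by blast
      then show ?thesis
        using 1 i by (intro exI[of _ "Suc c"] exI[of _ "a0 c"]) (auto simp: Q_def coord_def)
    next
      case 2
      then obtain c where "c < k" "pb i c \<noteq> b0 c" using b0 by blast
      then show ?thesis
        using 2 by (intro exI[of _ "Suc (k + c)"] exI[of _ "b0 c"]) (auto simp: Q_def coord_def)
    next
      case 3
      then obtain c where c: "c < k" "pa i c \<noteq> pa l c \<or> pb i c \<noteq> pb l c" using dist by blast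
      then show ?thesis
        using 3 c
        by (cases "pa i c \<noteq> pa l c")
          (intro exI[of _ "Suc c"] exI[of _ "pa l c"], force simp: Q_def coord_def,
           intro exI[of _ "Suc (k + c)"] exI[of _ "pb l c"], force simp: Q_def coord_def)
    next
      \<comment> \<open>Such an \<open>l\<close> indexes no factor; any form will do to make the
        choice total.\<close>
      case 4
      then obtain c where "c < k" "pb i c \<noteq> b0 c" using b0 by blast
      then show ?thesis
        using 4 i by (intro exI[of _ "Suc (k + c)"] exI[of _ "b0 c"]) (auto simp: Q_def coord_def)
    qed
  qed
  then obtain cc vv where "\<And>l. Q l (cc l) (vv l)"
    by metis
  note cv = this[unfolded Q_def]
  \<comment> \<open>The affine form \<open>coord k a b (cc l) + vv l\<close>, written out over the
    letters.\<close>
  define coef where "coef l c = (if c = cc l then 1 else if c = 0 then vv l else (0::'a))" for l c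
  define g where "g w = (\<Prod>l<Suc n. coef l (w l))" for w
  define G where "G a b = (\<Prod>l<Suc n. coord k a b (cc l) + vv l)" for a b
  have lin: "(\<Sum>c\<le>2 * k. coord k a b c * coef l c) = coord k a b (cc l) + vv l" for a b l
  proof -
    have "(\<Sum>c\<le>2 * k. coord k a b c * coef l c) = (\<Sum>c\<in>{0, cc l}. coord k a b c * coef l c)"
      by (rule sum.mono_neutral_right) (use cv[of l] in \<open>auto simp: coef_def\<close>)
    also have "\<dots> = coord k a b (cc l) + vv l"
      using cv[of l] by (simp add: coef_def coord_def)
    finally show ?thesis .
  qed
  have wv: "(\<Sum>w\<in>words k (Suc n). word_val k (Suc n) a b w * g w) = G a b" for a b
  proof -
    have "G a b = (\<Prod>l<Suc n. \<Sum>c\<le>2 * k. coord k a b c * coef l c)"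
      unfolding G_def lin ..
    also have "\<dots> = (\<Sum>w\<in>words k (Suc n). \<Prod>l<Suc n. coord k a b (w l) * coef l (w l))"
      unfolding words_def by (subst prod_sum_PiE) auto
    finally show ?thesis
      by (simp only: word_val_def g_def prod.distrib)
  qed
  have zero: "G a b = 0" if "l < Suc n" "coord k a b (cc l) = vv l" for a b l
    unfolding G_def prod_zero_iff[OF finite_lessThan] using that by (intro bexI[of _ l]) (auto simp: add_self)
  have G0: "G a b0 = 0" "G a0 b = 0" for a b
    using zero[of n a b0] zero[of i a0 b] cv i by auto
  have row_eq: "(\<Sum>w\<in>words k (Suc n). link_row k (Suc n) a0 b0 a b w * g w) = G a b" for a b
    by (simp add: link_row_def distrib_right sum.distrib wv G0)
  have "G (pa i) (pb i) \<noteq> 0"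
    unfolding G_def prod_zero_iff[OF finite_lessThan] using cv by (auto simp: add_eq_0_iff_eq)
  moreover have "G (pa j) (pb j) = 0" if "j < n" "j \<noteq> i" for j
    using zero[of j] cv[of j] that by simp
  ultimately show ?thesis
    using row_eq by (intro exI[of _ g]) auto
qed

end

section \<open>Thetas in the links of the polynomial graph\<close>

lemma theta_pos_eq_iff:
  assumes "j \<le> k" "j' \<le> k"
  shows "theta_pos k i j = theta_pos k i' j' \<longleftrightarrow> j = j' \<and> (j = 0 \<or> j = k \<or> i = i')"
  using assms by (auto simp: theta_pos_def)

text \<open>If \<open>orient\<close> holds, the even positions of the theta lie on the \<open>b\<close>-side.\<close>
definition end_a :: "nat \<Rightarrow> bool \<Rightarrow> nat \<Rightarrow> nat \<Rightarrow> theta_vertex" where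
  "end_a k orient i j = theta_pos k i (if even j = orient then Suc j else j)"

definition end_b :: "nat \<Rightarrow> bool \<Rightarrow> nat \<Rightarrow> nat \<Rightarrow> theta_vertex" where
  "end_b k orient i j = theta_pos k i (if even j = orient then j else Suc j)"

text \<open>Only the first coordinates of the vertices are recorded, since adjacency to the root
  edge determines the others. Vertices on different sides are not compared: equal coordinates do not
  make them equal.\<close>

definition link_theta ::
    "nat \<Rightarrow> nat \<Rightarrow> (nat \<times> (nat \<Rightarrow> nat) \<Rightarrow> 'a::field) \<Rightarrow> nat \<Rightarrow> bool \<Rightarrow>
      (nat \<Rightarrow> 'a) \<Rightarrow> (nat \<Rightarrow> 'a) \<Rightarrow> (theta_vertex \<Rightarrow> nat \<Rightarrow> 'a) \<Rightarrow> bool" where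
  "link_theta k len y t orient a0 b0 g \<longleftrightarrow>
     (\<forall>i<t. \<forall>j\<le>k. \<exists>c<k. g (theta_pos k i j) c \<noteq> (if even j = orient then b0 c else a0 c)) \<and>
     (\<forall>i<t. \<forall>i'<t. \<forall>j\<le>k. \<forall>j'\<le>k. even j = even j' \<longrightarrow> theta_pos k i j \<noteq> theta_pos k i' j' \<longrightarrow>
        (\<exists>c<k. g (theta_pos k i j) c \<noteq> g (theta_pos k i' j') c)) \<and>
     (\<forall>i<t. \<forall>j<k. \<forall>m<k - 1.
        (\<Sum>w\<in>words k len. link_row k len a0 b0 (g (end_a k orient i j)) (g (end_b k orient i j)) w * y (m, w)) = 0)"

text \<open>Since \<open>k \<ge> 2\<close>, every edge has an inner vertex as one of its ends, and
  that vertex carries the index of its path.\<close>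

lemma end_ab_inj:
  assumes "k \<ge> 2" "j < k" "j' < k"
    and "end_a k orient i j = end_a k orient i' j'" "end_b k orient i j = end_b k orient i' j'"
  shows "i = i' \<and> j = j'"
proof -
  have "(if even j = orient then Suc j else j) = (if even j' = orient then Suc j' else j')"
    "(if even j = orient then j else Suc j) = (if even j' = orient then j' else Suc j')"
    using assms by (auto simp: end_a_def end_b_def theta_pos_eq_iff split: if_splits)
  then have j: "j = j'" by (auto split: if_splits)
  have "theta_pos k i j = theta_pos k i' j \<and> theta_pos k i (Suc j) = theta_pos k i' (Suc j)"
    using assms(4,5) unfolding j end_a_def end_b_def by (auto split: if_splits)
  then have "i = i'"
    using assms(1-3) j by (auto simp: theta_pos_eq_iff)
  then show ?thesis using j by simp
qed

context char2_field
begin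

text \<open>Pigeonhole: the first inner vertices of the paths are distinct, so at most
  \<open>algebraic_bound (card Z + s) D ^ k\<close> of them have only coordinates algebraic over the
  elements chosen so far. Some path not yet chosen therefore supplies a new independent
  coordinate.\<close>

lemma link_theta_independent_coords:
  fixes g :: "theta_vertex \<Rightarrow> nat \<Rightarrow> 'a"
  assumes k: "k \<ge> 2" and D: "D \<ge> 1" and Z: "indep_vals D Z"
    and th: "link_theta k len y t orient a0 b0 g"
    and t: "algebraic_bound (card Z + s) D ^ k + s \<le> t" and m: "m \<le> s"
  shows "\<exists>I U. I \<subseteq> {..<t} \<and> card I = m \<and> U \<subseteq> (\<Union>i\<in>I. g (Inner i 1) ` {..<k}) \<and>
    indep_vals D (Z \<union> U) \<and> card (Z \<union> U) = card Z + m"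
  using m
proof (induction m)
  case 0
  then show ?case using Z by (intro exI[of _ "{}"]) auto
next
  case (Suc m)
  then obtain I U where I: "I \<subseteq> {..<t}" "card I = m" and U: "U \<subseteq> (\<Union>i\<in>I. g (Inner i 1) ` {..<k})"
    "indep_vals D (Z \<union> U)" "card (Z \<union> U) = card Z + m" by auto
  define A where "A = algebraic_vals (Z \<union> U) D"
  have fin: "finite (Z \<union> U)" using U(2) by (rule indep_vals_finite)
  have A: "finite A" "card A \<le> algebraic_bound (card Z + s) D"
    unfolding A_def using algebraic_vals_bound[OF fin, of "card Z + s" D] U(3) Suc.prems by simp_all
  have "\<exists>i\<in>{..<t} - I. \<exists>c<k. g (Inner i 1) c \<notin> A"
  proof (rule ccontr)
    assume "\<not> ?thesis"
    then have all: "\<And>i c. i \<in> {..<t} - I \<Longrightarrow> c < k \<Longrightarrow> g (Inner i 1) c \<in> A" by blast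
    have "inj_on (\<lambda>i. restrict (g (Inner i 1)) {..<k}) ({..<t} - I)"
    proof (rule inj_onI)
      fix i i' assume *: "i \<in> {..<t} - I" "i' \<in> {..<t} - I"
        "restrict (g (Inner i 1)) {..<k} = restrict (g (Inner i' 1)) {..<k}"
      have pos: "theta_pos k i 1 = Inner i 1" for i using k by (simp add: theta_pos_def)
      have "g (Inner i 1) c = g (Inner i' 1) c" if "c < k" for c
        using fun_cong[OF *(3), of c] that by simp
      then have "\<not> (\<exists>c<k. g (theta_pos k i 1) c \<noteq> g (theta_pos k i' 1) c)"
        unfolding pos by blast
      then have "theta_pos k i 1 = theta_pos k i' 1"
        using th[unfolded link_theta_def, THEN conjunct2, THEN conjunct1, rule_format, of i i' 1 1] * k
        by auto
      then show "i = i'" unfolding pos by simp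
    qed
    moreover have "(\<lambda>i. restrict (g (Inner i 1)) {..<k}) ` ({..<t} - I) \<subseteq> {..<k} \<rightarrow>\<^sub>E A"
      using all by (intro image_subsetI PiE_I) auto
    ultimately have "card ({..<t} - I) \<le> card ({..<k} \<rightarrow>\<^sub>E A)"
      by (rule card_inj_on_le) (simp add: finite_PiE A)
    also have "\<dots> \<le> algebraic_bound (card Z + s) D ^ k"
      using A by (simp add: card_PiE power_mono)
    also have "\<dots> < t - m" using t Suc.prems by linarith
    also have "\<dots> = card ({..<t} - I)"
      using I finite_subset[OF I(1)] by (simp add: card_Diff_subset)
    finally show False by simp
  qed
  then obtain i c where ic: "i < t" "i \<notin> I" "c < k" "g (Inner i 1) c \<notin> A" by auto
  define w where "w = g (Inner i 1) c"
  have "w \<notin> Z \<union> U"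
    using ic(4) member_algebraic_vals[OF fin _ D] unfolding A_def w_def by blast
  moreover have "indep_vals D (insert w (Z \<union> U))"
    using U(2) ic(4) unfolding A_def w_def by (rule indep_insert)
  moreover have "insert w U \<subseteq> (\<Union>i\<in>insert i I. g (Inner i 1) ` {..<k})"
    using U(1) ic(3) by (auto simp: w_def)
  moreover have "card (insert i I) = Suc m"
    using I ic finite_subset[OF I(1)] by simp
  ultimately show ?case
    using I ic fin U(3) by (intro exI[of _ "insert i I"] exI[of _ "insert w U"]) auto
qed

text \<open>The \<open>s * k\<close> edges of \<open>s\<close> paths impose \<open>s * k * (k - 1)\<close> independent conditions on \<open>y\<close>,
  as many as there are coordinates of their inner vertices.\<close>
lemma link_theta_degree_count:
  fixes y :: "nat \<times> (nat \<Rightarrow> nat) \<Rightarrow> 'a"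
  assumes k: "k \<ge> 2" and D: "D \<ge> 1"
    and len: "len = Suc (s * k)"
    and M: "M = (k - 1) * Suc (2 * k) ^ len"
    and th: "link_theta k len y t orient a0 b0 g"
    and I: "I \<subseteq> {..<t}" "card I = s"
    and U: "U \<subseteq> (\<Union>i\<in>I. g (Inner i 1) ` {..<k})"
    and Z: "indep_vals D (y ` ({..<k - 1} \<times> words k len) \<union> U)"
    and card: "card (y ` ({..<k - 1} \<times> words k len) \<union> U) = r"
  shows "Suc D ^ r \<le> Suc (D * r * Suc (elim_deg len (s * k))) ^ (M + 4 * k)"
proof -
  define W where "W = words k len"
  define n where "n = s * k"
  have finW: "finite W" by (simp add: W_def finite_words)
  have finI: "finite I" using I finite_subset by blast
  obtain \<sigma> where \<sigma>: "bij_betw \<sigma> {..<s} I"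
    using ex_bij_betw_nat_finite[OF finI] I(2) by (auto simp: atLeast0LessThan)
  \<comment> \<open>The \<open>s * k\<close> edges of the chosen paths are numbered by
    \<open>e\<close>: path \<open>e div k\<close>, and edge \<open>e mod k\<close> on that
    path.\<close>
  define va where "va e = end_a k orient (\<sigma> (e div k)) (e mod k)" for e
  define vb where "vb e = end_b k orient (\<sigma> (e div k)) (e mod k)" for e
  define row where "row e w = link_row k len a0 b0 (g (va e)) (g (vb e)) w" for e w
  have \<sigma>I: "\<sigma> (e div k) \<in> I" if "e < n" for e
    using that \<sigma> by (auto simp: n_def bij_betw_def less_mult_imp_div_less)
  have modk: "e mod k < k" for e using k by simp
  have th1: "\<And>i j. i < t \<Longrightarrow> j \<le> k \<Longrightarrow> \<exists>c<k. g (theta_pos k i j) c \<noteq> (if even j = orient then b0 c else a0 c)"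
    and th2: "\<And>i i' j j'. i < t \<Longrightarrow> i' < t \<Longrightarrow> j \<le> k \<Longrightarrow> j' \<le> k \<Longrightarrow> even j = even j' \<Longrightarrow>
      theta_pos k i j \<noteq> theta_pos k i' j' \<Longrightarrow> \<exists>c<k. g (theta_pos k i j) c \<noteq> g (theta_pos k i' j') c"
    and th3: "\<And>i j m. i < t \<Longrightarrow> j < k \<Longrightarrow> m < k - 1 \<Longrightarrow>
        (\<Sum>w\<in>W. link_row k len a0 b0 (g (end_a k orient i j)) (g (end_b k orient i j)) w * y (m, w)) = 0"
    using th[unfolded link_theta_def, THEN conjunct1]
      th[unfolded link_theta_def, THEN conjunct2, THEN conjunct1]
      th[unfolded link_theta_def, THEN conjunct2, THEN conjunct2, folded W_def]
    by simp_all
  \<comment> \<open>All coordinates that enter the rows: \<open>4 * k\<close> for the root edge and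
    the two common ends, and \<open>(k - 1) * k\<close> for the inner vertices of each path.\<close>
  define X0 where "X0 = a0 ` {..<k} \<union> b0 ` {..<k} \<union> g Source ` {..<k} \<union> g Sink ` {..<k}
    \<union> (\<lambda>(i, j, c). g (Inner i j) c) ` (I \<times> {1..<k} \<times> {..<k})"
  have finX: "finite X0" by (simp add: X0_def finI)
  have gX: "g (theta_pos k i j) c \<in> X0" if "i \<in> I" "j \<le> k" "c < k" for i j c
    using that by (force simp: X0_def theta_pos_def image_iff)
  have vaX: "g (va e) c \<in> X0" "g (vb e) c \<in> X0" if "e < n" "c < k" for e c
    using gX[OF \<sigma>I[OF that(1)] _ that(2)] modk[of e] by (auto simp: va_def vb_def end_a_def end_b_def)
  have rowX: "row e w \<in> poly_vals X0 len" if "e < n" "w \<in> W" for e w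
    unfolding row_def
    by (rule link_row_poly_vals[OF finX _ that(2)[unfolded W_def]]) (use that vaX in \<open>auto simp: X0_def\<close>)
  have interp: "\<exists>h. (\<forall>j<i. (\<Sum>w\<in>W. row j w * h w) = 0) \<and> (\<Sum>w\<in>W. row i w * h w) \<noteq> 0"
    if i: "i < n" for i
  proof -
    have "\<sigma> (i div k) < t" using \<sigma>I[OF i] I by auto
    then have a: "\<exists>c<k. g (va i) c \<noteq> a0 c" and b: "\<exists>c<k. g (vb i) c \<noteq> b0 c"
      using th1[of "\<sigma> (i div k)" "i mod k"] th1[of "\<sigma> (i div k)" "Suc (i mod k)"] modk[of i]
      by (auto simp: va_def vb_def end_a_def end_b_def split: if_splits)
    have dist: "\<exists>c<k. g (va i) c \<noteq> g (va j) c \<or> g (vb i) c \<noteq> g (vb j) c" if j: "j < n" "j \<noteq> i" for j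
    proof -
      have "\<not> (va i = va j \<and> vb i = vb j)"
      proof
        assume "va i = va j \<and> vb i = vb j"
        then have "\<sigma> (i div k) = \<sigma> (j div k) \<and> i mod k = j mod k"
          unfolding va_def vb_def using end_ab_inj[OF k modk modk] by blast
        moreover have "i div k < s" "j div k < s"
          using i j by (auto simp: n_def less_mult_imp_div_less)
        ultimately have "i div k = j div k \<and> i mod k = j mod k"
          using \<sigma> by (auto simp: bij_betw_def inj_on_def)
        then show False using j(2) by (metis div_mult_mod_eq)
      qed
      moreover have "\<sigma> (i div k) < t" "\<sigma> (j div k) < t" using \<sigma>I i j(1) I by auto
      moreover have "\<exists>c<k. g (va i) c \<noteq> g (va j) c" if "va i \<noteq> va j"
        unfolding va_def end_a_def
        by (rule th2) (use that modk[of i] modk[of j] \<open>\<sigma> (i div k) < t\<close> \<open>\<sigma> (j div k) < t\<close> in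
          \<open>auto simp: va_def end_a_def Suc_le_eq less_imp_le\<close>)
      moreover have "\<exists>c<k. g (vb i) c \<noteq> g (vb j) c" if "vb i \<noteq> vb j"
        unfolding vb_def end_b_def
        by (rule th2) (use that modk[of i] modk[of j] \<open>\<sigma> (i div k) < t\<close> \<open>\<sigma> (j div k) < t\<close> in
          \<open>auto simp: vb_def end_b_def Suc_le_eq less_imp_le\<close>)
      ultimately show ?thesis by blast
    qed
    from interpolation[OF i, of k "\<lambda>e. g (va e)" a0 "\<lambda>e. g (vb e)" b0, OF a b dist]
    obtain h where "\<forall>j<n. j \<noteq> i \<longrightarrow> (\<Sum>w\<in>W. row j w * h w) = 0" "(\<Sum>w\<in>W. row i w * h w) \<noteq> 0"
      unfolding row_def W_def len n_def by blast
    then show ?thesis using i by (intro exI[of _ h]) auto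
  qed
  let ?e = "elim_deg len n"
  have elim: "\<exists>P \<Delta> N. P \<subseteq> W \<and> card P = n \<and> \<Delta> \<noteq> 0 \<and> \<Delta> \<in> poly_vals X0 ?e \<and>
    (\<forall>p\<in>P. \<forall>w\<in>W - P. N p w \<in> poly_vals X0 ?e) \<and>
    (\<forall>z. (\<forall>i<n. (\<Sum>w\<in>W. row i w * z w) = 0) \<longrightarrow> (\<forall>p\<in>P. \<Delta> * z p = (\<Sum>w\<in>W - P. N p w * z w)))"
    by (rule elimination[OF finW finX]) (simp_all only: rowX interp)
  obtain P \<Delta> N where P: "P \<subseteq> W" "card P = n" "\<Delta> \<noteq> 0" "\<Delta> \<in> poly_vals X0 ?e"
    and N: "\<forall>p\<in>P. \<forall>w\<in>W - P. N p w \<in> poly_vals X0 ?e"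
    and sol: "\<forall>z. (\<forall>i<n. (\<Sum>w\<in>W. row i w * z w) = 0) \<longrightarrow> (\<forall>p\<in>P. \<Delta> * z p = (\<Sum>w\<in>W - P. N p w * z w))"
    using elim by (elim exE conjE) (rule that)
  \<comment> \<open>The entries of \<open>y\<close> in the pivot columns are left out; the
    elimination recovers them rationally from \<open>V\<close>.\<close>
  define V where "V = X0 \<union> y ` ({..<k - 1} \<times> (W - P))"
  have finV: "finite V" using finX finW by (simp add: V_def)
  have upV: "x \<in> poly_vals X0 d \<Longrightarrow> x \<in> poly_vals V d" for x d
    using poly_vals_mono[OF finV, of X0 d d] by (auto simp: V_def)
  have memV: "\<Delta> * v \<in> poly_vals V (Suc ?e)" if "v \<in> V" for v
    using poly_vals_mult[OF finV upV[OF P(4)] poly_vals_member[OF finV that, of 1]] by simp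
  have main: "\<Delta> * z \<in> poly_vals V (Suc ?e)" if z: "z \<in> y ` ({..<k - 1} \<times> W) \<union> U" for z
  proof (cases "z \<in> V")
    case True then show ?thesis by (rule memV)
  next
    case False
    have "z \<notin> U"
    proof
      assume "z \<in> U"
      then obtain i c where "i \<in> I" "c < k" "z = g (Inner i 1) c" using U by auto
      then have "z \<in> X0" using gX[of i 1 c] k by (simp add: theta_pos_def split: if_splits)
      then show False using False by (simp add: V_def)
    qed
    then obtain m p where mp: "m < k - 1" "p \<in> W" "z = y (m, p)" using z by auto
    have "p \<in> P" using False mp by (auto simp: V_def)
    \<comment> \<open>The rows do not depend on \<open>m\<close>, so a single elimination serves all
      \<open>k - 1\<close> components of \<open>y\<close>.\<close>
    have "\<forall>i<n. (\<Sum>w\<in>W. row i w * y (m, w)) = 0"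
      using th3 \<sigma>I I(1) modk mp(1) unfolding row_def va_def vb_def by (meson lessThan_iff subsetD)
    from sol[rule_format, OF this[rule_format] \<open>p \<in> P\<close>] have "\<Delta> * z = (\<Sum>w\<in>W - P. N p w * y (m, w))"
      using mp(3) by simp
    also have "\<dots> \<in> poly_vals V (?e + 1)"
      by (intro poly_vals_sum[OF finV] poly_vals_mult[OF finV] upV N[rule_format] \<open>p \<in> P\<close> poly_vals_member[OF finV])
        (use mp(1) in \<open>auto simp: V_def\<close>)
    finally show ?thesis by simp
  qed
  have PW: "n \<le> card W" using P finW card_mono by metis
  have "card X0 \<le> 4 * k + s * ((k - 1) * k)"
  proof -
    have "card X0 \<le> card (a0 ` {..<k}) + card (b0 ` {..<k}) + card (g Source ` {..<k}) + card (g Sink ` {..<k})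
        + card ((\<lambda>(i, j, c). g (Inner i j) c) ` (I \<times> {1..<k} \<times> {..<k}))"
      unfolding X0_def by (intro order_trans[OF card_Un_le] add_mono order_refl)
    also have "\<dots> \<le> card {..<k} + card {..<k} + card {..<k} + card {..<k} + card (I \<times> {1..<k} \<times> {..<k})"
      by (intro add_mono card_image_le) (auto simp: finI)
    also have "\<dots> = 4 * k + s * ((k - 1) * k)"
      by (simp add: card_cartesian_product I(2))
    finally show ?thesis .
  qed
  moreover have "card (y ` ({..<k - 1} \<times> (W - P))) \<le> (k - 1) * (card W - n)"
  proof -
    have "card (y ` ({..<k - 1} \<times> (W - P))) \<le> card ({..<k - 1} \<times> (W - P))"
      by (rule card_image_le) (simp add: finW)
    also have "\<dots> = (k - 1) * (card W - n)"
      using P finite_subset[OF P(1) finW] by (simp add: card_cartesian_product card_Diff_subset)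
    finally show ?thesis .
  qed
  \<comment> \<open>The \<open>(k - 1) * n\<close> pivot entries removed balance the inner
    coordinates added, so \<open>V\<close> exceeds the \<open>M\<close> entries of \<open>y\<close>
    by at most \<open>4 * k\<close>.\<close>
  moreover have "s * ((k - 1) * k) + (k - 1) * (card W - n) = M"
  proof -
    have "s * ((k - 1) * k) + (k - 1) * (card W - n) = (k - 1) * (n + (card W - n))"
      by (simp add: n_def distrib_left)
    also have "n + (card W - n) = card W" using PW by simp
    finally show ?thesis by (simp add: M W_def card_words)
  qed
  ultimately have cardV: "card V \<le> M + 4 * k"
    using card_Un_le[of X0 "y ` ({..<k - 1} \<times> (W - P))"] unfolding V_def by linarith
  have "Suc D ^ r \<le> Suc (D * r * Suc ?e) ^ card V"
    unfolding card[symmetric]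
    by (rule indep_vals_card_le[OF finV Z D P(3)])
      (use upV[OF P(4)] poly_vals_mono[OF finV order_refl, of ?e "Suc ?e"] main in \<open>auto simp: W_def\<close>)
  also have "\<dots> \<le> Suc (D * r * Suc ?e) ^ (M + 4 * k)"
    by (rule power_increasing[OF cardV]) simp
  finally show ?thesis unfolding n_def .
qed

text \<open>The order of choices matters: \<open>s\<close> exceeds \<open>4 * k\<close> by one,
  \<open>D\<close> is then large enough to contradict \<open>link_theta_degree_count\<close>, and
  only afterwards is the field required to hold \<open>M\<close> independent elements, which become
  the entries of \<open>y\<close>. All thresholds depend on \<open>k\<close> alone.\<close>

lemma link_theta_free:
  fixes k :: nat
  assumes k: "k \<ge> 2"
  shows "\<exists>t0 q0 len. \<forall>F :: 'a set. finite F \<longrightarrow> q0 \<le> card F \<longrightarrow>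
    (\<exists>y. y ` ({..<k - 1} \<times> words k len) \<subseteq> F \<and>
      (\<forall>t\<ge>t0. \<forall>orient a0 b0 g. \<not> link_theta k len y t orient a0 b0 g))"
proof -
  define s where "s = Suc (4 * k)"
  define len where "len = Suc (s * k)"
  define M where "M = (k - 1) * Suc (2 * k) ^ len"
  obtain D where D: "D \<ge> 1" "Suc (D * ((M + s) * Suc (elim_deg len (s * k)))) ^ (M + 4 * k) < Suc D ^ (M + s)"
    using ex_degree_bound[of "M + 4 * k" "M + s" "(M + s) * Suc (elim_deg len (s * k))"]
    unfolding s_def by (metis add_less_cancel_left lessI)
  define t0 where "t0 = algebraic_bound (M + s) D ^ k + s"
  define J where "J = {..<k - 1} \<times> words k len"
  have J: "finite J" "card J = M"
    by (auto simp: J_def finite_words card_cartesian_product card_words M_def)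
  have "\<exists>y. y ` J \<subseteq> F \<and> (\<forall>t\<ge>t0. \<forall>orient a0 b0 g. \<not> link_theta k len y t orient a0 b0 g)"
    if F: "finite F" "Suc (algebraic_bound M D) \<le> card F" for F :: "'a set"
  proof -
    obtain Z where Z: "Z \<subseteq> F" "indep_vals D Z" "card Z = M"
      using indep_vals_exists[OF F(1), of M D M] F(2) D(1) by auto
    obtain y where y: "bij_betw y J Z"
      using finite_same_card_bij[OF J(1) indep_vals_finite[OF Z(2)]] J(2) Z(3) by auto
    then have yJ: "y ` J = Z" by (simp add: bij_betw_def)
    have "\<not> link_theta k len y t orient a0 b0 g" if t: "t \<ge> t0" for t orient a0 b0 g
    proof
      assume th: "link_theta k len y t orient a0 b0 g"
      from link_theta_independent_coords[OF k D(1) Z(2) th, of s s] t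
      obtain I U where I: "I \<subseteq> {..<t}" "card I = s" "U \<subseteq> (\<Union>i\<in>I. g (Inner i 1) ` {..<k})"
        and U: "indep_vals D (Z \<union> U)" "card (Z \<union> U) = M + s"
        by (auto simp: t0_def Z(3))
      from link_theta_degree_count[OF k D(1) len_def M_def th I U[folded yJ, unfolded J_def]]
      show False using D(2) by (simp add: algebra_simps)
    qed
    then show ?thesis using yJ Z(1) by blast
  qed
  then show ?thesis unfolding J_def by blast
qed

end

section \<open>Finite subfields of the algebraic closure of the field with two elements\<close>

interpretation char2_field "TYPE(bit alg_closure)"
proof
  have "(1 :: bit alg_closure) + 1 = to_ac (1 + 1)" unfolding to_ac_add to_ac_1 ..
  also have "\<dots> = 0" by simp
  finally show "(1 :: bit alg_closure) + 1 = 0" .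
qed

text \<open>The subfield with \<open>2 ^ r\<close> elements, as the fixed points of a power of the
  Frobenius map. As sets in one algebraically closed field, the finite fields of all these sizes
  share one type and its arithmetic.\<close>

definition frob_field :: "nat \<Rightarrow> bit alg_closure set" where
  "frob_field r = {x. x ^ (2 ^ r) = x}"

lemma frobenius_add: "(x + y :: bit alg_closure) ^ (2 ^ r) = x ^ (2 ^ r) + y ^ (2 ^ r)"
proof (induction r)
  case (Suc r)
  have sq: "(u + v) ^ 2 = u ^ 2 + v ^ 2" for u v :: "bit alg_closure"
    using add_self[of "u * v"] by (simp add: power2_eq_square algebra_simps)
  have "(x + y) ^ (2 ^ Suc r) = ((x + y) ^ (2 ^ r)) ^ 2" by (simp add: power_mult[symmetric] mult.commute)
  also have "\<dots> = x ^ (2 ^ Suc r) + y ^ (2 ^ Suc r)"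
    unfolding Suc sq by (simp add: power_mult[symmetric] mult.commute)
  finally show ?case .
qed simp

lemma frob_field_add: "x \<in> frob_field r \<Longrightarrow> y \<in> frob_field r \<Longrightarrow> x + y \<in> frob_field r"
  by (simp add: frob_field_def frobenius_add)

lemma frob_field_mult: "x \<in> frob_field r \<Longrightarrow> y \<in> frob_field r \<Longrightarrow> x * y \<in> frob_field r"
  by (simp add: frob_field_def power_mult_distrib)

lemma frob_field_0: "0 \<in> frob_field r" and frob_field_1: "1 \<in> frob_field r"
  by (simp_all add: frob_field_def)

lemma frob_field_sum: "(\<And>i. i \<in> I \<Longrightarrow> f i \<in> frob_field r) \<Longrightarrow> sum f I \<in> frob_field r"
  by (induction I rule: infinite_finite_induct) (auto intro: frob_field_add frob_field_0)

lemma frob_field_prod: "(\<And>i. i \<in> I \<Longrightarrow> f i \<in> frob_field r) \<Longrightarrow> prod f I \<in> frob_field r"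
  by (induction I rule: infinite_finite_induct) (auto intro: frob_field_mult frob_field_1)

text \<open>The polynomial X ^ q - X splits over the algebraic closure, and its derivative is -1, so
  that its \<open>q\<close> roots are distinct.\<close>

lemma card_frob_field:
  assumes "r \<ge> 1"
  shows "card (frob_field r) = 2 ^ r"
proof -
  define q where "q = (2::nat) ^ r"
  have q: "q \<ge> 2" using assms self_le_power[of "2::nat" r] by (simp add: q_def)
  define p :: "bit alg_closure poly" where "p = monom 1 q - monom 1 1"
  have coeff: "coeff p i = (if i = q then 1 else 0) - (if i = 1 then 1 else 0)" for i
    by (auto simp: p_def coeff_diff)
  have "degree p \<le> q" by (rule degree_le) (use q in \<open>auto simp: coeff\<close>)
  moreover have "coeff p q \<noteq> 0" using q by (simp add: coeff)
  ultimately have deg: "degree p = q" by (simp add: le_degree antisym)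
  then have p0: "p \<noteq> 0" using q by auto
  have "(of_nat q :: bit alg_closure) = 0"
  proof -
    have "(2 :: bit alg_closure) = 0" using one_add_one by simp
    then show ?thesis using assms by (simp add: q_def)
  qed
  then have deriv: "pderiv p = - 1"
    by (simp add: p_def pderiv_diff pderiv_monom flip: one_pCons)
  obtain A where A: "size A = degree p" "p = smult (lead_coeff p) (\<Prod>x\<in>#A. [:-x, 1:])"
    using alg_closed_imp_factorization[OF p0] by blast
  have "count A a \<le> 1" for a
  proof (rule ccontr)
    assume "\<not> count A a \<le> 1"
    then have "a \<in># A - {#a#}" "a \<in># A" by (auto simp: in_diff_count intro: count_inI)
    then obtain B where B: "A = add_mset a (add_mset a B)"
      by (metis insert_DiffM)
    define R where "R = smult (lead_coeff p) (\<Prod>x\<in>#B. [:-x, 1:])"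
    have "p = [:-a, 1:] * ([:-a, 1:] * R)"
      using A(2) unfolding B R_def by (simp add: mult_ac)
    then have "poly (pderiv p) a = 0"
      by (simp only: pderiv_mult poly_add poly_mult) simp
    then show False unfolding deriv by simp
  qed
  then have "count A a = 1" if "a \<in># A" for a
    using that by (metis One_nat_def le_antisym Suc_le_eq count_greater_zero_iff)
  then have "size A = card (set_mset A)"
    by (simp add: size_multiset_overloaded_eq)
  moreover have "{x. poly p x = 0} = set_mset A"
  proof -
    have "poly p x = 0 \<longleftrightarrow> x \<in># A" for x
    proof -
      have "poly p x = lead_coeff p * (\<Prod>y\<in>#A. x - y)"
        by (subst A(2)) (simp add: poly_prod_mset image_mset.compositionality o_def)
      then show ?thesis using p0 by (auto simp: prod_mset_zero_iff)
    qed
    then show ?thesis by blast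
  qed
  moreover have "frob_field r = {x. poly p x = 0}"
    by (simp add: frob_field_def p_def poly_monom q_def)
  ultimately show ?thesis using A(1) deg by (simp add: q_def)
qed

lemma finite_frob_field: "r \<ge> 1 \<Longrightarrow> finite (frob_field r)"
  using card_frob_field[of r] by (metis card.infinite power_not_zero zero_neq_numeral)

lemma poly_map_frob_field:
  assumes "y ` ({..<k - 1} \<times> words k len) \<subseteq> frob_field r" "m < k - 1"
    and "\<And>c. c < k \<Longrightarrow> a c \<in> frob_field r" "\<And>c. c < k \<Longrightarrow> b c \<in> frob_field r"
  shows "poly_map k len y m a b \<in> frob_field r"
proof -
  have "coord k a b c \<in> frob_field r" if "c \<le> 2 * k" for c
    using that assms(3,4) by (auto simp: coord_def frob_field_1)
  then have "word_val k len a b w \<in> frob_field r" if "w \<in> words k len" for w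
    unfolding word_val_def using that by (intro frob_field_prod) (auto simp: words_def)
  then show ?thesis
    unfolding poly_map_def using assms(1,2) by (intro frob_field_sum frob_field_mult) auto
qed

section \<open>The lower bound\<close>

lemma contains_copy_embedding:
  assumes "contains_copy G H"
  obtains \<phi> where "inj_on \<phi> (verts H)" "\<phi> ` verts H \<subseteq> verts G"
    "\<forall>u\<in>verts H. \<forall>v\<in>verts H. {u, v} \<in> edges H \<longrightarrow> {\<phi> u, \<phi> v} \<in> edges G"
proof -
  obtain C f where C: "subgraph C G" "bij_betw f (verts C) (verts H)"
    "\<forall>u\<in>verts C. \<forall>v\<in>verts C. {u, v} \<in> edges C \<longleftrightarrow> {f u, f v} \<in> edges H"
    using assms unfolding contains_copy_def isomorphic_def by blast
  let ?\<phi> = "inv_into (verts C) f"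
  have bij: "bij_betw ?\<phi> (verts H) (verts C)" by (rule bij_betw_inv_into[OF C(2)])
  have f\<phi>: "f (?\<phi> u) = u" "?\<phi> u \<in> verts C" if "u \<in> verts H" for u
    using bij_betw_inv_into_right[OF C(2) that] bij that by (auto simp: bij_betw_def)
  show ?thesis
  proof (rule that)
    show "inj_on ?\<phi> (verts H)" using bij by (simp add: bij_betw_def)
    show "?\<phi> ` verts H \<subseteq> verts G" using f\<phi>(2) C(1) by (auto simp: subgraph_def)
    show "\<forall>u\<in>verts H. \<forall>v\<in>verts H. {u, v} \<in> edges H \<longrightarrow> {?\<phi> u, ?\<phi> v} \<in> edges G"
      using C(1,3) f\<phi> by (auto simp: subgraph_def)
  qed
qed

text \<open>\<open>G\<close> is relabelled into \<open>{..<n}\<close> and padded with isolated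
  vertices. A copy of \<open>H\<close> cannot touch the padding because every vertex of
  \<open>H\<close> lies on an edge, so it pulls back to \<open>G\<close>.\<close>

lemma extremal_number_ge:
  fixes G :: "'v graph" and H :: "'a graph"
  assumes H: "simple_graph H" "edges H \<noteq> {}" and isol: "\<And>u. u \<in> verts H \<Longrightarrow> \<exists>v\<in>verts H. {u, v} \<in> edges H"
    and G: "simple_graph G" "card (verts G) \<le> n"
    and free: "\<not> (\<exists>\<phi>. inj_on \<phi> (verts H) \<and>
      (\<forall>u\<in>verts H. \<forall>v\<in>verts H. {u, v} \<in> edges H \<longrightarrow> {\<phi> u, \<phi> v} \<in> edges G))"
  shows "card (edges G) \<le> extremal_number n H"
proof -
  have finG: "finite (verts G)" using G(1) by (simp add: simple_graph_def)
  obtain h where h: "bij_betw h (verts G) {..<card (verts G)}"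
    using ex_bij_betw_finite_nat[OF finG] by (auto simp: atLeast0LessThan)
  then have inj: "inj_on h (verts G)" and hn: "h ` verts G \<subseteq> {..<n}"
    using G(2) by (auto simp: bij_betw_def)
  have sub: "e \<subseteq> verts G" "card e = 2" if "e \<in> edges G" for e
    using G(1) that by (auto simp: simple_graph_def)
  define G' where "G' = Graph {..<n} ((`) h ` edges G)"
  have "simple_graph G'"
    unfolding simple_graph_def G'_def graph.sel
  proof (intro conjI ballI)
    fix e assume "e \<in> (`) h ` edges G"
    then obtain e' where e': "e' \<in> edges G" "e = h ` e'" by blast
    show "e \<subseteq> {..<n}" using e' sub(1)[OF e'(1)] hn by blast
    show "card e = 2"
      using card_image[OF inj_on_subset[OF inj sub(1)[OF e'(1)]]] sub(2) e' by simp
  qed simp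
  moreover have "card (edges G') = card (edges G)"
    unfolding G'_def graph.sel
    by (rule card_image) (meson inj inj_on_image inj_on_subset PowI sub(1) subsetI inj_on_image_Pow)
  moreover have "\<not> contains_copy G' H"
  proof
    assume "contains_copy G' H"
    then obtain \<phi> where \<phi>: "inj_on \<phi> (verts H)" "\<phi> ` verts H \<subseteq> verts G'"
      "\<forall>u\<in>verts H. \<forall>v\<in>verts H. {u, v} \<in> edges H \<longrightarrow> {\<phi> u, \<phi> v} \<in> edges G'"
      by (rule contains_copy_embedding)
    define \<psi> where "\<psi> u = inv_into (verts G) h (\<phi> u)" for u
    have edge: "{\<psi> u, \<psi> v} \<in> edges G \<and> \<phi> u \<in> h ` verts G"
      if uv: "u \<in> verts H" "v \<in> verts H" "{u, v} \<in> edges H" for u v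
    proof -
      obtain e where e: "e \<in> edges G" "h ` e = {\<phi> u, \<phi> v}"
        using \<phi>(3)[rule_format, OF uv] by (auto simp: G'_def)
      have "inv_into (verts G) h ` (h ` e) = e"
        using sub(1)[OF e(1)] inj by (simp add: inv_into_image_cancel)
      moreover have "inv_into (verts G) h ` (h ` e) = {\<psi> u, \<psi> v}"
        unfolding e(2) \<psi>_def by simp
      moreover have "\<phi> u \<in> h ` verts G" using e sub(1)[OF e(1)] by blast
      ultimately show ?thesis using e(1) by simp
    qed
    have "inj_on \<psi> (verts H)"
    proof (rule inj_onI)
      fix u v assume uv: "u \<in> verts H" "v \<in> verts H" "\<psi> u = \<psi> v"
      then have "\<phi> u \<in> h ` verts G" "\<phi> v \<in> h ` verts G" using isol edge by blast+
      then have "\<phi> u = \<phi> v" using uv(3) unfolding \<psi>_def by (metis f_inv_into_f)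
      then show "u = v" using \<phi>(1) uv by (simp add: inj_on_def)
    qed
    then show False using free edge by blast
  qed
  moreover have "card (verts G') = n" by (simp add: G'_def)
  ultimately have "card (edges G) \<in> {card (edges G) | G :: nat graph.
      simple_graph G \<and> card (verts G) = n \<and> \<not> contains_copy G H}"
    by (metis (mono_tags, lifting) mem_Collect_eq)
  then show ?thesis
    unfolding extremal_number_def using host_edge_counts(1)[OF H, of n] by (rule Max_ge[rotated])
qed

lemma E_plus_edges:
  shows "{E_vertex.X, E_vertex.Y} \<in> edges (E_plus k t)"
    and "i < t \<Longrightarrow> j \<le> k \<Longrightarrow> even j \<Longrightarrow> {E_vertex.X, Theta (theta_pos k i j)} \<in> edges (E_plus k t)"
    and "i < t \<Longrightarrow> j \<le> k \<Longrightarrow> odd j \<Longrightarrow> {E_vertex.Y, Theta (theta_pos k i j)} \<in> edges (E_plus k t)"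
    and "i < t \<Longrightarrow> j < k \<Longrightarrow> {Theta (theta_pos k i j), Theta (theta_pos k i (Suc j))} \<in> edges (E_plus k t)"
    and "E_vertex.X \<in> verts (E_plus k t)" "E_vertex.Y \<in> verts (E_plus k t)"
    and "i < t \<Longrightarrow> j \<le> k \<Longrightarrow> Theta (theta_pos k i j) \<in> verts (E_plus k t)"
proof -
  show "{E_vertex.X, E_vertex.Y} \<in> edges (E_plus k t)" by (simp add: E_plus_def)
  show "i < t \<Longrightarrow> j \<le> k \<Longrightarrow> even j \<Longrightarrow> {E_vertex.X, Theta (theta_pos k i j)} \<in> edges (E_plus k t)"
    unfolding E_plus_def E_graph_def theta_A_def graph.sel by blast
  show "i < t \<Longrightarrow> j \<le> k \<Longrightarrow> odd j \<Longrightarrow> {E_vertex.Y, Theta (theta_pos k i j)} \<in> edges (E_plus k t)"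
    unfolding E_plus_def E_graph_def theta_B_def graph.sel by blast
  show "{Theta (theta_pos k i j), Theta (theta_pos k i (Suc j))} \<in> edges (E_plus k t)" if "i < t" "j < k"
  proof -
    have "{theta_pos k i j, theta_pos k i (Suc j)} \<in> edges (theta k t)"
      unfolding theta_def graph.sel using that by blast
    from imageI[OF this, of "\<lambda>e. Theta ` e"] show ?thesis
      by (simp add: E_plus_def E_graph_def)
  qed
  show "E_vertex.X \<in> verts (E_plus k t)" "E_vertex.Y \<in> verts (E_plus k t)" by (simp_all add: E_plus_def E_graph_def)
  show "i < t \<Longrightarrow> j \<le> k \<Longrightarrow> Theta (theta_pos k i j) \<in> verts (E_plus k t)"
    unfolding E_plus_def E_graph_def theta_def graph.sel by blast
qed

lemma verts_E_plus:
  "verts (E_plus k t) = insert E_vertex.X (insert E_vertex.Y {Theta (theta_pos k i j) | i j. i < t \<and> j \<le> k})"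
  by (auto simp: E_plus_def E_graph_def theta_def)

lemma E_plus_no_isolated:
  assumes "u \<in> verts (E_plus k t)"
  shows "\<exists>v\<in>verts (E_plus k t). {u, v} \<in> edges (E_plus k t)"
proof -
  have "u = E_vertex.X \<or> u = E_vertex.Y \<or> (\<exists>i j. u = Theta (theta_pos k i j) \<and> i < t \<and> j \<le> k)"
    using assms[unfolded verts_E_plus] by blast
  then consider "u = E_vertex.X" | "u = E_vertex.Y" | i j where "u = Theta (theta_pos k i j)" "i < t" "j \<le> k" "even j"
    | i j where "u = Theta (theta_pos k i j)" "i < t" "j \<le> k" "odd j"
    by blast
  then show ?thesis
  proof cases
    case 1 then show ?thesis using E_plus_edges(1,6) by blast
  next
    case 2 then show ?thesis using E_plus_edges(1,5)[of k t] by (auto simp: insert_commute)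
  next
    case 3 then show ?thesis using E_plus_edges(2)[OF 3(2-4)] E_plus_edges(5) by (auto simp: insert_commute)
  next
    case 4 then show ?thesis using E_plus_edges(3)[OF 4(2-4)] E_plus_edges(6) by (auto simp: insert_commute)
  qed
qed

section \<open>The polynomial graph and its edge count\<close>

text \<open>The Boolean is the side: \<open>False\<close> for the pairs (a, P) and
  \<open>True\<close> for the pairs (b, Q).\<close>

type_synonym 'a pvert = "bool \<times> (nat \<Rightarrow> 'a) \<times> (nat \<Rightarrow> 'a)"

definition pverts :: "nat \<Rightarrow> 'a set \<Rightarrow> 'a pvert set" where
  "pverts k F = UNIV \<times> ({..<k} \<rightarrow>\<^sub>E F) \<times> ({..<k - 1} \<rightarrow>\<^sub>E F)"

definition padj :: "nat \<Rightarrow> nat \<Rightarrow> (nat \<times> (nat \<Rightarrow> nat) \<Rightarrow> 'a) \<Rightarrow> 'a pvert \<Rightarrow> 'a::field pvert \<Rightarrow> bool" where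
  "padj k len y u v \<longleftrightarrow> fst u \<noteq> fst v \<and> (\<forall>m<k - 1. snd (snd u) m + snd (snd v) m =
     (if fst u then poly_map k len y m (fst (snd v)) (fst (snd u))
      else poly_map k len y m (fst (snd u)) (fst (snd v))))"

definition poly_graph :: "nat \<Rightarrow> nat \<Rightarrow> (nat \<times> (nat \<Rightarrow> nat) \<Rightarrow> 'a) \<Rightarrow> 'a set \<Rightarrow> 'a::field pvert graph" where
  "poly_graph k len y F =
     Graph (pverts k F) {{u, v} | u v. u \<in> pverts k F \<and> v \<in> pverts k F \<and> padj k len y u v}"

lemma padj_commute: "padj k len y u v \<longleftrightarrow> padj k len y v u"
  by (auto simp: padj_def add.commute)

lemma poly_graph_edge:
  "{u, v} \<in> edges (poly_graph k len y F) \<longleftrightarrow> u \<in> pverts k F \<and> v \<in> pverts k F \<and> padj k len y u v"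
  unfolding poly_graph_def graph.sel mem_Collect_eq doubleton_eq_iff using padj_commute by metis

lemma simple_poly_graph: "finite F \<Longrightarrow> simple_graph (poly_graph k len y F)"
  by (auto simp: simple_graph_def poly_graph_def pverts_def finite_PiE card_insert_if padj_def)

lemma card_pverts: "finite F \<Longrightarrow> card (pverts k F) = 2 * (card F ^ k * card F ^ (k - 1))"
  by (simp add: pverts_def card_cartesian_product card_PiE)

text \<open>Given the neighbour \<open>w\<close>, the equations in \<open>padj\<close> determine the
  last \<open>k - 1\<close> coordinates from the first \<open>k\<close>. Distinct neighbours of one
  vertex hence differ in their first coordinates, which yields the inequalities in
  \<open>link_theta\<close>.\<close>

lemma padj_same_coords:
  assumes "padj k len y w u" "padj k len y w v" "u \<in> pverts k F" "v \<in> pverts k F"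
    and "\<And>c. c < k \<Longrightarrow> fst (snd u) c = fst (snd v) c"
  shows "u = v"
proof -
  have s: "fst u = fst v" using assms(1,2) by (auto simp: padj_def)
  have a: "fst (snd u) = fst (snd v)"
    by (rule PiE_ext[of _ "{..<k}" "\<lambda>_. F"]) (use assms in \<open>auto simp: pverts_def\<close>)
  have "snd (snd u) m = snd (snd v) m" if "m < k - 1" for m
  proof -
    have "snd (snd w) m + snd (snd u) m = snd (snd w) m + snd (snd v) m"
      using assms(1,2) that unfolding padj_def a by (auto split: if_splits)
    then show ?thesis by simp
  qed
  then have "snd (snd u) = snd (snd v)"
    by (intro PiE_ext[of _ "{..<k - 1}" "\<lambda>_. F"]) (use assms in \<open>auto simp: pverts_def\<close>)
  then show ?thesis using s a by (simp add: prod_eq_iff)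
qed

context char2_field
begin

text \<open>The edge XY of a copy becomes the root edge, and every edge of the theta closes a
  four-cycle with it. Adding the four adjacency equations of the cycle cancels all second
  coordinates and leaves a condition linear in \<open>y\<close>.\<close>

lemma poly_graph_free:
  fixes y :: "nat \<times> (nat \<Rightarrow> nat) \<Rightarrow> 'a"
  assumes k: "k \<ge> 2" and free: "\<And>orient a0 b0 g. \<not> link_theta k len y t orient a0 b0 g"
  shows "\<not> (\<exists>\<phi>. inj_on \<phi> (verts (E_plus k t)) \<and> (\<forall>u\<in>verts (E_plus k t). \<forall>v\<in>verts (E_plus k t).
    {u, v} \<in> edges (E_plus k t) \<longrightarrow> {\<phi> u, \<phi> v} \<in> edges (poly_graph k len y F)))"
proof
  assume "\<exists>\<phi>. inj_on \<phi> (verts (E_plus k t)) \<and> (\<forall>u\<in>verts (E_plus k t). \<forall>v\<in>verts (E_plus k t).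
    {u, v} \<in> edges (E_plus k t) \<longrightarrow> {\<phi> u, \<phi> v} \<in> edges (poly_graph k len y F))"
  then obtain \<phi> where inj: "inj_on \<phi> (verts (E_plus k t))"
    and edge: "\<And>u v. u \<in> verts (E_plus k t) \<Longrightarrow> v \<in> verts (E_plus k t) \<Longrightarrow> {u, v} \<in> edges (E_plus k t) \<Longrightarrow>
      \<phi> u \<in> pverts k F \<and> \<phi> v \<in> pverts k F \<and> padj k len y (\<phi> u) (\<phi> v)"
    unfolding poly_graph_edge by blast
  let ?T = "\<lambda>i j. Theta (theta_pos k i j)"
  \<comment> \<open>If X lies on the \<open>False\<close> side, then its neighbours, the even
    positions, lie on the b-side.\<close>
  define orient where "orient \<longleftrightarrow> \<not> fst (\<phi> E_vertex.X)"
  define wa where "wa = (if orient then \<phi> E_vertex.X else \<phi> E_vertex.Y)"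
  define wb where "wb = (if orient then \<phi> E_vertex.Y else \<phi> E_vertex.X)"
  define g where "g v = fst (snd (\<phi> (Theta v)))" for v
  have XY: "\<phi> E_vertex.X \<in> pverts k F" "\<phi> E_vertex.Y \<in> pverts k F" "padj k len y (\<phi> E_vertex.X) (\<phi> E_vertex.Y)"
    using edge[OF E_plus_edges(5,6,1)] by auto
  have side: "\<not> fst wa" "fst wb"
    using XY(3) by (auto simp: wa_def wb_def orient_def padj_def)
  have Xadj: "padj k len y (\<phi> E_vertex.X) (\<phi> (?T i j))" "\<phi> (?T i j) \<in> pverts k F" if "i < t" "j \<le> k" "even j" for i j
    using edge[OF E_plus_edges(5) E_plus_edges(7)[OF that(1,2)] E_plus_edges(2)[OF that]] by auto
  have Yadj: "padj k len y (\<phi> E_vertex.Y) (\<phi> (?T i j))" "\<phi> (?T i j) \<in> pverts k F" if "i < t" "j \<le> k" "odd j" for i j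
    using edge[OF E_plus_edges(6) E_plus_edges(7)[OF that(1,2)] E_plus_edges(3)[OF that]] by auto
  have neq: "\<phi> u \<noteq> \<phi> v" if "u \<in> verts (E_plus k t)" "v \<in> verts (E_plus k t)" "u \<noteq> v" for u v
    using inj that by (auto simp: inj_on_def)
  have c1: "\<exists>c<k. g (theta_pos k i j) c \<noteq> (if even j = orient then fst (snd wb) c else fst (snd wa) c)"
    if ij: "i < t" "j \<le> k" for i j
  proof (cases "even j")
    case True
    have "\<phi> (?T i j) \<noteq> \<phi> E_vertex.Y" by (rule neq[OF E_plus_edges(7)[OF ij] E_plus_edges(6)]) simp
    then have "\<exists>c<k. fst (snd (\<phi> (?T i j))) c \<noteq> fst (snd (\<phi> E_vertex.Y)) c"
      using padj_same_coords[OF Xadj(1)[OF ij True] XY(3) Xadj(2)[OF ij True] XY(2)] by blast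
    then show ?thesis using True by (auto simp: g_def wa_def wb_def)
  next
    case False
    have "\<phi> (?T i j) \<noteq> \<phi> E_vertex.X" by (rule neq[OF E_plus_edges(7)[OF ij] E_plus_edges(5)]) simp
    then have "\<exists>c<k. fst (snd (\<phi> (?T i j))) c \<noteq> fst (snd (\<phi> E_vertex.X)) c"
      using padj_same_coords[OF Yadj(1)[OF ij False] XY(3)[unfolded padj_commute[of _ _ _ "\<phi> E_vertex.X"]] Yadj(2)[OF ij False] XY(1)]
      by blast
    then show ?thesis using False by (auto simp: g_def wa_def wb_def)
  qed
  have c2: "\<exists>c<k. g (theta_pos k i j) c \<noteq> g (theta_pos k i' j') c"
    if ij: "i < t" "i' < t" "j \<le> k" "j' \<le> k" "even j = even j'" "theta_pos k i j \<noteq> theta_pos k i' j'" for i i' j j'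
  proof -
    have n: "\<phi> (?T i j) \<noteq> \<phi> (?T i' j')"
      by (rule neq[OF E_plus_edges(7)[OF ij(1,3)] E_plus_edges(7)[OF ij(2,4)]]) (use ij(6) in simp)
    show ?thesis
    proof (cases "even j")
      case True
      then have "even j'" using ij(5) by simp
      from padj_same_coords[OF Xadj(1)[OF ij(1,3) True] Xadj(1)[OF ij(2,4) this] Xadj(2)[OF ij(1,3) True] Xadj(2)[OF ij(2,4) this]]
      show ?thesis using n unfolding g_def by blast
    next
      case False
      then have "odd j'" using ij(5) by simp
      from padj_same_coords[OF Yadj(1)[OF ij(1,3) False] Yadj(1)[OF ij(2,4) this] Yadj(2)[OF ij(1,3) False] Yadj(2)[OF ij(2,4) this]]
      show ?thesis using n unfolding g_def by blast
    qed
  qed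
  have c3: "(\<Sum>w\<in>words k len. link_row k len (fst (snd wa)) (fst (snd wb)) (g (end_a k orient i j)) (g (end_b k orient i j)) w * y (m, w)) = 0"
    if ij: "i < t" "j < k" "m < k - 1" for i j m
  proof -
    let ?u = "\<phi> (Theta (end_a k orient i j))" and ?v = "\<phi> (Theta (end_b k orient i j))"
    have "padj k len y (\<phi> (?T i j)) (\<phi> (?T i (Suc j)))"
      using edge[OF E_plus_edges(7) E_plus_edges(7) E_plus_edges(4)[OF ij(1,2)]] ij by auto
    moreover from this have "padj k len y (\<phi> (?T i (Suc j))) (\<phi> (?T i j))"
      by (rule iffD1[OF padj_commute])
    ultimately have uv: "padj k len y ?u ?v"
      unfolding end_a_def end_b_def by simp
    have u: "padj k len y wb ?u"
      unfolding end_a_def wb_def using Xadj(1)[OF ij(1)] Yadj(1)[OF ij(1)] ij(2) by (auto split: if_splits)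
    have v: "padj k len y wa ?v"
      unfolding end_b_def wa_def using Xadj(1)[OF ij(1)] Yadj(1)[OF ij(1)] ij(2) by (auto split: if_splits)
    have w: "padj k len y wa wb"
      unfolding wa_def wb_def using XY(3) iffD1[OF padj_commute XY(3)] by (simp split: if_splits)
    have su: "\<not> fst ?u" "fst ?v" using u v side by (auto simp: padj_def)
    let ?p = "poly_map k len y m"
    have "?p (fst (snd ?u)) (fst (snd ?v)) = snd (snd ?u) m + snd (snd ?v) m"
      "?p (fst (snd ?u)) (fst (snd wb)) = snd (snd wb) m + snd (snd ?u) m"
      "?p (fst (snd wa)) (fst (snd ?v)) = snd (snd wa) m + snd (snd ?v) m"
      "?p (fst (snd wa)) (fst (snd wb)) = snd (snd wa) m + snd (snd wb) m"
      using u v w uv side su ij(3) by (simp_all add: padj_def)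
    \<comment> \<open>Each of the four vertices lies on two edges of the four-cycle, so each second
      coordinate occurs twice.\<close>
    moreover have "(a + b) + (c + a) + (d + b) + (d + c) = 0" for a b c d :: 'a
    proof -
      have "(a + b) + (c + a) + (d + b) + (d + c) = (a + a) + (b + b) + (c + c) + (d + d)"
        by (simp only: ac_simps)
      then show ?thesis by (simp add: add_self)
    qed
    ultimately show ?thesis
      unfolding sum_link_row g_def by simp
  qed
  have "link_theta k len y t orient (fst (snd wa)) (fst (snd wb)) g"
    unfolding link_theta_def using c1 c2 c3 by blast
  then show False using free by blast
qed

end

text \<open>For an edge, \<open>a\<close>, \<open>b\<close> and \<open>P\<close> are free and
  \<open>Q\<close> is then forced; this gives the exponent \<open>k + k + (k - 1)\<close>.\<close>

lemma card_poly_graph_edges_ge: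
  assumes r: "r \<ge> 1" and y: "y ` ({..<k - 1} \<times> words k len) \<subseteq> frob_field r"
  shows "(2 ^ r) ^ k * ((2 ^ r) ^ k * (2 ^ r) ^ (k - 1)) \<le> card (edges (poly_graph k len y (frob_field r)))"
proof -
  let ?F = "frob_field r"
  define h where "h = (\<lambda>(a, b, p). {(False, a, p),
    (True, b, \<lambda>m\<in>{..<k - 1}. p m + poly_map k len y m a b)} :: bit alg_closure pvert set)"
  let ?D = "({..<k} \<rightarrow>\<^sub>E ?F) \<times> ({..<k} \<rightarrow>\<^sub>E ?F) \<times> ({..<k - 1} \<rightarrow>\<^sub>E ?F)"
  have "inj_on h ?D"
    by (auto simp: inj_on_def h_def doubleton_eq_iff)
  moreover have "h ` ?D \<subseteq> edges (poly_graph k len y ?F)"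
  proof clarify
    fix a b p assume *: "a \<in> {..<k} \<rightarrow>\<^sub>E ?F" "b \<in> {..<k} \<rightarrow>\<^sub>E ?F" "p \<in> {..<k - 1} \<rightarrow>\<^sub>E ?F"
    have "p m + poly_map k len y m a b \<in> ?F" if "m < k - 1" for m
      using * that by (intro frob_field_add poly_map_frob_field[OF y]) auto
    moreover have "p m + (p m + poly_map k len y m a b) = poly_map k len y m a b" for m
      by (simp add: add.assoc[symmetric] add_self)
    ultimately show "h (a, b, p) \<in> edges (poly_graph k len y ?F)"
      unfolding h_def prod.case poly_graph_edge using * by (auto simp: pverts_def padj_def)
  qed
  moreover have "finite (edges (poly_graph k len y ?F))"
    using simple_poly_graph[OF finite_frob_field[OF r], of k len y]
    by (auto simp: simple_graph_def intro: finite_subset[of _ "Pow (verts (poly_graph k len y ?F))"])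
  ultimately have "card ?D \<le> card (edges (poly_graph k len y ?F))"
    by (rule card_inj_on_le)
  then show ?thesis
    by (simp add: card_cartesian_product card_PiE card_frob_field[OF r])
qed

lemma extremal_number_lower:
  assumes k: "k \<ge> 2"
  shows "\<exists>t0 r0. \<forall>t\<ge>t0. \<forall>r\<ge>r0. \<forall>n. 2 * (2 ^ r) ^ (2 * k - 1) \<le> n \<longrightarrow>
    (2 ^ r) ^ (3 * k - 1) \<le> extremal_number n (E_plus k t)"
proof -
  obtain t0 q0 len where *: "\<forall>F :: bit alg_closure set. finite F \<longrightarrow> q0 \<le> card F \<longrightarrow>
    (\<exists>y. y ` ({..<k - 1} \<times> words k len) \<subseteq> F \<and>
      (\<forall>t\<ge>t0. \<forall>orient a0 b0 g. \<not> link_theta k len y t orient a0 b0 g))"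
    using link_theta_free[OF k] by (elim exE) (rule that)
  have "(2 ^ r) ^ (3 * k - 1) \<le> extremal_number n (E_plus k t)"
    if t: "t \<ge> max 1 t0" and r: "r \<ge> max 1 q0" and n: "2 * (2 ^ r) ^ (2 * k - 1) \<le> n" for t r n
  proof -
    let ?F = "frob_field r"
    have r1: "r \<ge> 1" using r by simp
    \<comment> \<open>\<open>r \<ge> q0\<close> is a crude way to get
      \<open>2 ^ r \<ge> q0\<close>.\<close>
    have "q0 \<le> card ?F"
      using r order_trans[OF _ less_imp_le[OF less_exp[of r]]] by (simp add: card_frob_field[OF r1])
    then obtain y where y: "y ` ({..<k - 1} \<times> words k len) \<subseteq> ?F"
      and free: "\<And>orient a0 b0 g. \<not> link_theta k len y t orient a0 b0 g"
      using *[rule_format, OF finite_frob_field[OF r1]] t by auto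
    let ?G = "poly_graph k len y ?F"
    have e: "k + (k + (k - 1)) = 3 * k - 1" "k + (k - 1) = 2 * k - 1" using k by auto
    have "(2 ^ r) ^ (3 * k - 1) \<le> card (edges ?G)"
      using card_poly_graph_edges_ge[OF r1 y] unfolding e(1)[symmetric] power_add .
    also have "\<dots> \<le> extremal_number n (E_plus k t)"
    proof (rule extremal_number_ge)
      show "simple_graph (E_plus k t)" by (rule simple_graph_E_plus[OF k])
      show "edges (E_plus k t) \<noteq> {}" using E_plus_edges(1) by blast
      show "simple_graph ?G" by (rule simple_poly_graph[OF finite_frob_field[OF r1]])
      have "2 * ((2 ^ r) ^ k * (2 ^ r) ^ (k - 1)) \<le> n"
        using n unfolding e(2)[symmetric] power_add .
      then show "card (verts ?G) \<le> n"
        by (simp add: poly_graph_def card_pverts[OF finite_frob_field[OF r1]] card_frob_field[OF r1])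
      show "\<exists>v\<in>verts (E_plus k t). {u, v} \<in> edges (E_plus k t)" if "u \<in> verts (E_plus k t)" for u
        by (rule E_plus_no_isolated[OF that])
      show "\<not> (\<exists>\<phi>. inj_on \<phi> (verts (E_plus k t)) \<and> (\<forall>u\<in>verts (E_plus k t). \<forall>v\<in>verts (E_plus k t).
          {u, v} \<in> edges (E_plus k t) \<longrightarrow> {\<phi> u, \<phi> v} \<in> edges ?G))"
        by (rule poly_graph_free[OF k free])
    qed
    finally show ?thesis .
  qed
  then show ?thesis by blast
qed

section \<open>Thetas in bipartite graphs\<close>

text \<open>A bipartite graph is a set of ordered pairs from one class to the other; the symmetric
  closure allows the source to lie in either class.\<close>

definition theta_copy :: "('v \<times> 'v) set \<Rightarrow> nat \<Rightarrow> nat \<Rightarrow> (theta_vertex \<Rightarrow> 'v) \<Rightarrow> bool" where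
  "theta_copy E k t g \<longleftrightarrow> inj_on g (verts (theta k t)) \<and>
     (\<forall>i<t. \<forall>j<k. (g (theta_pos k i j), g (theta_pos k i (Suc j))) \<in> E \<union> E\<inverse>)"

lemma theta_copyI:
  fixes p :: "nat \<Rightarrow> nat \<Rightarrow> 'v"
  assumes adj: "\<And>i j. i < t \<Longrightarrow> j < k \<Longrightarrow> (p i j, p i (Suc j)) \<in> E \<union> E\<inverse>"
    and ends: "\<And>i. i < t \<Longrightarrow> p i 0 = y" "\<And>i. i < t \<Longrightarrow> p i k = z"
    and inj: "\<And>i i' j j'. i < t \<Longrightarrow> i' < t \<Longrightarrow> j \<le> k \<Longrightarrow> j' \<le> k \<Longrightarrow> p i j = p i' j' \<Longrightarrow>
      j = j' \<and> (j = 0 \<or> j = k \<or> i = i')"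
  shows "\<exists>g. theta_copy E k t g"
proof -
  define g where "g v = (case v of Source \<Rightarrow> y | Sink \<Rightarrow> z | Inner i j \<Rightarrow> p i j)" for v
  have g: "g (theta_pos k i j) = p i j" if "i < t" "j \<le> k" for i j
    using that ends[OF that(1)] by (auto simp: g_def theta_pos_def)
  have "inj_on g (verts (theta k t))"
  proof (rule inj_onI)
    fix u v assume "u \<in> verts (theta k t)" "v \<in> verts (theta k t)" and eq: "g u = g v"
    then obtain i j i' j' where *: "u = theta_pos k i j" "i < t" "j \<le> k" "v = theta_pos k i' j'" "i' < t" "j' \<le> k"
      by (auto simp: theta_def)
    then have "p i j = p i' j'" using eq by (simp add: g)
    from inj[OF *(2,5,3,6) this] show "u = v"
      unfolding * by (auto simp: theta_pos_def)
  qed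
  moreover have "(g (theta_pos k i j), g (theta_pos k i (Suc j))) \<in> E \<union> E\<inverse>" if "i < t" "j < k" for i j
    using adj[OF that] that by (simp add: g)
  ultimately show ?thesis
    unfolding theta_copy_def by blast
qed

lemma theta_copy_mono: "theta_copy E k t g \<Longrightarrow> E \<subseteq> E' \<Longrightarrow> theta_copy E' k t g"
  unfolding theta_copy_def by blast

lemma card_edges_le: "finite E \<Longrightarrow> card E \<le> card (fst ` E) * card (snd ` E)"
  using card_mono[of "fst ` E \<times> snd ` E" E] by (simp add: subset_fst_snd card_cartesian_product)

text \<open>A vertex of degree below \<open>d\<close> is deleted with its fewer than
  \<open>d\<close> edges, which preserves the density hypothesis. Vertices are counted through the
  projections of \<open>E\<close>, so isolated ones disappear and each deletion lowers the
  count.\<close>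

lemma min_degree_subgraph:
  fixes E :: "('u \<times> 'v) set"
  assumes "finite E" "E \<noteq> {}" "d * (card (fst ` E) + card (snd ` E)) \<le> card E" "d \<ge> 1"
  shows "\<exists>E'\<subseteq>E. E' \<noteq> {} \<and> (\<forall>v\<in>fst ` E'. d \<le> card {w. (v, w) \<in> E'}) \<and> (\<forall>w\<in>snd ` E'. d \<le> card {v. (v, w) \<in> E'})"
  using assms
proof (induction "card E" arbitrary: E rule: less_induct)
  case less
  show ?case
  proof (cases "(\<forall>v\<in>fst ` E. d \<le> card {w. (v, w) \<in> E}) \<and> (\<forall>w\<in>snd ` E. d \<le> card {v. (v, w) \<in> E})")
    case True
    then show ?thesis using less.prems by blast
  next
    case False
    have "\<exists>R\<subseteq>E. R \<noteq> {} \<and> card R < d \<and>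
        card (fst ` (E - R)) + card (snd ` (E - R)) < card (fst ` E) + card (snd ` E)"
    proof -
      consider v where "v \<in> fst ` E" "card {w. (v, w) \<in> E} < d" | w where "w \<in> snd ` E" "card {v. (v, w) \<in> E} < d"
        using False by (meson not_le)
      then show ?thesis
      proof cases
        case 1
        define R where "R = {v} \<times> {w. (v, w) \<in> E}"
        have "card R < d" using 1 by (simp add: R_def card_cartesian_product)
        moreover have "fst ` (E - R) \<subset> fst ` E" using 1(1) by (force simp: R_def image_iff)
        moreover have "snd ` (E - R) \<subseteq> snd ` E" by blast
        ultimately show ?thesis
          using less.prems(1) 1(1)
          by (intro exI[of _ R]) (auto simp: R_def intro!: add_less_le_mono psubset_card_mono card_mono)
      next
        case 2
        define R where "R = {v. (v, w) \<in> E} \<times> {w}"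
        have "card R < d" using 2 by (simp add: R_def card_cartesian_product)
        moreover have "snd ` (E - R) \<subset> snd ` E" using 2(1) by (force simp: R_def image_iff)
        moreover have "fst ` (E - R) \<subseteq> fst ` E" by blast
        ultimately show ?thesis
          using less.prems(1) 2(1)
          by (intro exI[of _ R]) (auto simp: R_def intro!: add_le_less_mono psubset_card_mono card_mono)
      qed
    qed
    then obtain R where R: "R \<subseteq> E" "R \<noteq> {}" "card R < d"
      "card (fst ` (E - R)) + card (snd ` (E - R)) < card (fst ` E) + card (snd ` E)" by blast
    have finR: "finite R" using R(1) less.prems(1) finite_subset by blast
    have cardD: "card (E - R) = card E - card R" by (rule card_Diff_subset[OF finR R(1)])
    have "0 < card R" using R(2) finR by (simp add: card_gt_0_iff)
    moreover have "card R \<le> card E" using R(1) less.prems(1) by (rule card_mono[rotated])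
    ultimately have lt: "card (E - R) < card E" using cardD by linarith
    have "d * Suc (card (fst ` (E - R)) + card (snd ` (E - R))) \<le> d * (card (fst ` E) + card (snd ` E))"
      using R(4) by (intro mult_left_mono) auto
    then have *: "d * (card (fst ` (E - R)) + card (snd ` (E - R))) + d \<le> card E"
      using less.prems(3) by simp
    then have **: "d * (card (fst ` (E - R)) + card (snd ` (E - R))) \<le> card (E - R)"
      unfolding cardD using R(3) by linarith
    \<comment> \<open>The density before the deletion provides \<open>d\<close> edges for the
      deleted vertex alone, more than \<open>R\<close> contains.\<close>
    have ne: "E - R \<noteq> {}"
    proof
      assume "E - R = {}"
      then have "card E = card R" using R(1) by (metis Diff_eq_empty_iff subset_antisym)
      then show False using * R(3) by linarith
    qed
    obtain E' where E': "E' \<subseteq> E - R" "E' \<noteq> {} \<and> (\<forall>v\<in>fst ` E'. d \<le> card {w. (v, w) \<in> E'}) \<and>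
      (\<forall>w\<in>snd ` E'. d \<le> card {v. (v, w) \<in> E'})"
      using less.hyps[OF lt finite_Diff[OF less.prems(1)] ne ** less.prems(4)] by (elim exE conjE) (rule that, auto)
    then show ?thesis by (intro exI[of _ E']) auto
  qed
qed

section \<open>Spiders and the thetas they close\<close>

lemma ex_not_in_small:
  assumes "card S < card N" "finite S"
  shows "\<exists>x\<in>N. x \<notin> S"
  using assms by (meson card_mono leD subsetI)

text \<open>One leg of a spider with centre \<open>q 0\<close>, avoiding the vertices in \<open>S\<close> and ending in a branch
  outside \<open>Bs\<close>; only the last step leaves \<open>E'\<close>.\<close>
lemma spider_leg:
  fixes E E' :: "('v \<times> 'v) set" and br :: "'v \<Rightarrow> 'b"
  assumes sub: "E' \<subseteq> E" and finE: "finite E"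
    and deg: "\<And>v. v \<in> fst ` E' \<Longrightarrow> T \<le> card {w. (v, w) \<in> E'}" "\<And>w. w \<in> snd ` E' \<Longrightarrow> T \<le> card {v. (v, w) \<in> E'}"
    and rich: "\<And>w. w \<in> snd ` E' \<Longrightarrow> T \<le> card (br ` {v. (v, w) \<in> E})"
    and Bs: "finite Bs"
  shows "\<lbrakk>l \<ge> 1; finite S; z \<in> S; card S + l + card Bs \<le> T; z \<in> (if even l then fst ` E' else snd ` E')\<rbrakk> \<Longrightarrow>
    \<exists>q. q 0 = z \<and> (\<forall>s<l. (q s, q (Suc s)) \<in> E \<union> E\<inverse>) \<and> (\<forall>s. 1 \<le> s \<and> s \<le> l \<longrightarrow> q s \<notin> S) \<and>
      inj_on q {..l} \<and> q l \<in> fst ` E \<and> br (q l) \<notin> Bs"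
proof (induction l arbitrary: z S)
  case 0
  then show ?case by simp
next
  case (Suc l)
  have finr: "finite {w. (v, w) \<in> E}" "finite {w. (w, v) \<in> E}" for v
    by (rule finite_subset[of _ "snd ` E"], force, simp add: finE)
      (rule finite_subset[of _ "fst ` E"], force, simp add: finE)
  show ?case
  proof (cases "l = 0")
    case True
    then have "z \<in> snd ` E'" using Suc.prems by simp
    from rich[OF this] have "card (Bs \<union> br ` S) < card (br ` {v. (v, z) \<in> E})"
      using Suc.prems card_Un_le[of Bs "br ` S"] card_image_le[of S br] True by linarith
    then obtain v where v: "(v, z) \<in> E" "br v \<notin> Bs" "v \<notin> S"
      using ex_not_in_small[of "Bs \<union> br ` S" "br ` {v. (v, z) \<in> E}"] Bs Suc.prems(2) by auto
    then show ?thesis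
      using True Suc.prems(3)
      by (intro exI[of _ "\<lambda>s. if s = 0 then z else v"])
        (auto simp: inj_on_def le_Suc_eq image_iff intro: bexI[of _ "(v, z)"])
  next
    case False
    \<comment> \<open>The parity of the remaining length fixes the side of the current vertex, so
      that the last step starts in the second class, where \<open>rich\<close> applies.\<close>
    have "\<exists>z'. z' \<notin> S \<and> (z, z') \<in> E \<union> E\<inverse> \<and> z' \<in> (if even l then fst ` E' else snd ` E')"
    proof (cases "even l")
      case True
      then have "z \<in> snd ` E'" using Suc.prems by simp
      then have "card S < card {v. (v, z) \<in> E'}"
        using deg(2)[of z] Suc.prems(4) by linarith
      then obtain v where "(v, z) \<in> E'" "v \<notin> S"
        using ex_not_in_small[of S "{v. (v, z) \<in> E'}"] Suc.prems(2) by auto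
      then show ?thesis using True sub by (intro exI[of _ v]) force
    next
      case odd: False
      then have "z \<in> fst ` E'" using Suc.prems by simp
      then have "card S < card {v. (z, v) \<in> E'}"
        using deg(1)[of z] Suc.prems(4) by linarith
      then obtain v where "(z, v) \<in> E'" "v \<notin> S"
        using ex_not_in_small[of S "{v. (z, v) \<in> E'}"] Suc.prems(2) by auto
      then show ?thesis using odd sub by (intro exI[of _ v]) force
    qed
    then obtain z' where z': "z' \<notin> S" "(z, z') \<in> E \<union> E\<inverse>" "z' \<in> (if even l then fst ` E' else snd ` E')"
      by blast
    \<comment> \<open>One more vertex to avoid and one step less to go: the budget \<open>T\<close>
      still suffices.\<close>
    have "card (insert z' S) + l + card Bs \<le> T" using z'(1) Suc.prems by simp
    from Suc.IH[OF _ _ _ this z'(3)] False Suc.prems(2)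
    obtain q where q: "q 0 = z'" "\<forall>s<l. (q s, q (Suc s)) \<in> E \<union> E\<inverse>"
      "\<forall>s. 1 \<le> s \<and> s \<le> l \<longrightarrow> q s \<notin> insert z' S" "inj_on q {..l}" "q l \<in> fst ` E" "br (q l) \<notin> Bs"
      by auto
    define q' where "q' s = (case s of 0 \<Rightarrow> z | Suc s \<Rightarrow> q s)" for s
    have notS: "q s \<notin> S" if "s \<le> l" for s
      using that q(1,3) z'(1) by (cases s) auto
    have "q' 0 = z" by (simp add: q'_def)
    moreover have "\<forall>s<Suc l. (q' s, q' (Suc s)) \<in> E \<union> E\<inverse>"
    proof (intro allI impI)
      fix s assume "s < Suc l"
      then show "(q' s, q' (Suc s)) \<in> E \<union> E\<inverse>"
        using z'(2) q(1,2) by (cases s) (auto simp: q'_def)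
    qed
    moreover have "\<forall>s. 1 \<le> s \<and> s \<le> Suc l \<longrightarrow> q' s \<notin> S"
      using notS by (auto simp: q'_def split: nat.splits)
    moreover have "inj_on q' {..Suc l}"
    proof (rule inj_onI)
      fix s s' assume "s \<in> {..Suc l}" "s' \<in> {..Suc l}" "q' s = q' s'"
      then show "s = s'"
        using notS Suc.prems(3) q(4) by (cases s; cases s') (auto simp: q'_def inj_on_def)
    qed
    moreover have "q' (Suc l) \<in> fst ` E" "br (q' (Suc l)) \<notin> Bs"
      using q(5,6) by (simp_all add: q'_def)
    ultimately show ?thesis by blast
  qed
qed

text \<open>Legs are added one at a time, each avoiding the earlier legs and their branches. The
  \<open>m\<close> earlier legs occupy at most \<open>Suc (m * l)\<close> vertices and
  \<open>m\<close> branches, whence the requirement on \<open>T\<close>.\<close>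

lemma spider:
  fixes E E' :: "('v \<times> 'v) set" and br :: "'v \<Rightarrow> 'b"
  assumes sub: "E' \<subseteq> E" and finE: "finite E"
    and deg: "\<And>v. v \<in> fst ` E' \<Longrightarrow> T \<le> card {w. (v, w) \<in> E'}" "\<And>w. w \<in> snd ` E' \<Longrightarrow> T \<le> card {v. (v, w) \<in> E'}"
    and rich: "\<And>w. w \<in> snd ` E' \<Longrightarrow> T \<le> card (br ` {v. (v, w) \<in> E})"
    and l: "l \<ge> 1" and z: "z \<in> (if even l then fst ` E' else snd ` E')"
    and T: "Suc (t * Suc l) + l \<le> T"
  shows "m \<le> t \<Longrightarrow> \<exists>q. (\<forall>a<m. q a 0 = z \<and> (\<forall>s<l. (q a s, q a (Suc s)) \<in> E \<union> E\<inverse>) \<and> q a l \<in> fst ` E) \<and>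
    (\<forall>a<m. \<forall>a'<m. \<forall>s\<le>l. \<forall>s'\<le>l. q a s = q a' s' \<longrightarrow> s = s' \<and> (s = 0 \<or> a = a')) \<and>
    inj_on (\<lambda>a. br (q a l)) {..<m}"
proof (induction m)
  case 0
  then show ?case by simp
next
  case (Suc m)
  obtain q where q1': "\<forall>a<m. q a 0 = z \<and> (\<forall>s<l. (q a s, q a (Suc s)) \<in> E \<union> E\<inverse>) \<and> q a l \<in> fst ` E"
    and q2': "\<forall>a<m. \<forall>a'<m. \<forall>s\<le>l. \<forall>s'\<le>l. q a s = q a' s' \<longrightarrow> s = s' \<and> (s = 0 \<or> a = a')"
    and q3: "inj_on (\<lambda>a. br (q a l)) {..<m}"
    using Suc.IH[OF Suc_leD[OF Suc.prems]] by (elim exE conjE) (rule that)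
  have q1: "q a 0 = z \<and> (\<forall>s<l. (q a s, q a (Suc s)) \<in> E \<union> E\<inverse>) \<and> q a l \<in> fst ` E" if "a < m" for a
    using q1' that by blast
  have q2: "s = s' \<and> (s = 0 \<or> a = a')"
    if "a < m" "a' < m" "s \<le> l" "s' \<le> l" "q a s = q a' s'" for a a' s s'
    using q2'[rule_format, OF that] .
  define S where "S = insert z ((\<lambda>(a, s). q a s) ` ({..<m} \<times> {1..l}))"
  define Bs where "Bs = (\<lambda>a. br (q a l)) ` {..<m}"
  have S: "finite S" "z \<in> S" by (auto simp: S_def)
  have "card S \<le> Suc (m * l)"
    unfolding S_def
    by (rule order_trans[OF card_insert_le_m1[of "Suc (m * l)"]])
      (auto intro: order_trans[OF card_image_le] simp: card_cartesian_product)
  moreover have "card Bs \<le> m" unfolding Bs_def using card_image_le[of "{..<m}"] by fastforce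
  moreover have "m * l + m \<le> t * Suc l"
    using mult_le_mono1[of m t "Suc l"] Suc.prems by simp
  ultimately have "card S + l + card Bs \<le> T" using T by linarith
  from spider_leg[OF sub finE deg rich _ l S this z] obtain r where
    r: "r 0 = z" "\<forall>s<l. (r s, r (Suc s)) \<in> E \<union> E\<inverse>" "\<forall>s. 1 \<le> s \<and> s \<le> l \<longrightarrow> r s \<notin> S"
      "inj_on r {..l}" "r l \<in> fst ` E" "br (r l) \<notin> Bs"
    by (auto simp: Bs_def)
  have S': "q a s \<in> S" if "a < m" "s \<le> l" for a s
    using that q1[of a] by (cases "s = 0") (force simp: S_def image_iff)+
  have mix: "s = 0 \<and> s' = 0" if "a < m" "s \<le> l" "s' \<le> l" "q a s = r s'" for a s s'
  proof -
    have "s' = 0" using r(3) S'[OF that(1,2)] that(3,4) by (metis One_nat_def Suc_leI neq0_conv)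
    then show ?thesis
      using q2[OF that(1) that(1) that(2), of 0] q1[OF that(1)] r(1) that(4) by simp
  qed
  define q' where "q' = q(m := r)"
  have "\<forall>a<Suc m. q' a 0 = z \<and> (\<forall>s<l. (q' a s, q' a (Suc s)) \<in> E \<union> E\<inverse>) \<and> q' a l \<in> fst ` E"
    using q1 r by (auto simp: q'_def less_Suc_eq)
  moreover have "s = s' \<and> (s = 0 \<or> a = a')"
    if "a < Suc m" "a' < Suc m" "s \<le> l" "s' \<le> l" "q' a s = q' a' s'" for a a' s s'
  proof -
    have "a < m \<or> a = m" "a' < m \<or> a' = m" using that(1,2) by auto
    then consider "a < m" "a' < m" | "a = m" "a' = m" | "a < m" "a' = m" | "a = m" "a' < m"
      by blast
    then show ?thesis
    proof cases
      case 1 then show ?thesis using q2 that by (simp add: q'_def)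
    next
      case 2 then show ?thesis using r(4) that by (auto simp: q'_def inj_on_def)
    next
      case 3 then show ?thesis using mix[of a s s'] that by (simp add: q'_def)
    next
      case 4 then show ?thesis using mix[of a' s' s] that by (simp add: q'_def)
    qed
  qed
  moreover have nb: "br (q a l) \<noteq> br (r l)" if "a < m" for a
    using r(6) that unfolding Bs_def by (metis imageI lessThan_iff)
  have "inj_on (\<lambda>a. br (q' a l)) {..<Suc m}"
    using q3 nb nb[symmetric] unfolding lessThan_Suc by (auto simp: q'_def inj_on_def)
  ultimately show ?case by (intro exI[of _ q']) blast
qed

text \<open>Tree paths of length \<open>Suc d\<close> descend from \<open>y\<close> to the ends of
  \<open>t\<close> spider legs of length \<open>k - Suc d\<close>, and the centre of the spider is
  the other end of the theta. Below \<open>y\<close> the tree paths are disjoint, lying in distinct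
  branches. They meet the legs only at the leg ends, because their other vertices have level below
  \<open>i\<close> and the spider stays in the levels \<open>i\<close> and
  \<open>Suc i\<close>.\<close>

lemma theta_from_spider:
  fixes par :: "'v \<Rightarrow> 'v" and lev :: "'v \<Rightarrow> nat"
  assumes k: "i < k" "Suc d \<le> i"
    and finE: "finite E" and E: "\<And>v w. (v, w) \<in> E \<Longrightarrow> lev v = i \<and> lev w = Suc i \<and> (v, w) \<in> G \<union> G\<inverse>"
    and V: "fst ` E \<subseteq> V"
    and par: "\<And>v. v \<in> V \<Longrightarrow> 1 \<le> lev v \<Longrightarrow> par v \<in> V \<and> Suc (lev (par v)) = lev v \<and> (par v, v) \<in> G \<union> G\<inverse>"
    and y: "\<And>v w. (v, w) \<in> E \<Longrightarrow> (par ^^ Suc d) v = y"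
    and T: "T = Suc t * Suc k"
    and R: "R \<subseteq> E" "R \<noteq> {}" "T * (card (fst ` R) + card (snd ` R)) \<le> card R"
    and rich: "\<And>w. w \<in> snd ` R \<Longrightarrow> T \<le> card ((par ^^ d) ` {v. (v, w) \<in> E})"
  shows "\<exists>g. theta_copy G k t g"
proof -
  have "finite R" using R(1) finE finite_subset by blast
  moreover have "T \<ge> 1" using T by simp
  ultimately obtain E' where E': "E' \<subseteq> R" "E' \<noteq> {}"
    "\<forall>v\<in>fst ` E'. T \<le> card {w. (v, w) \<in> E'}" "\<forall>w\<in>snd ` E'. T \<le> card {v. (v, w) \<in> E'}"
    using min_degree_subgraph[OF _ R(2,3)] by blast
  define l where "l = k - Suc d"
  have l: "l \<ge> 1" "k = Suc d + l" using k by (auto simp: l_def)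
  have "fst ` E' \<noteq> {}" "snd ` E' \<noteq> {}" using E'(2) by auto
  then obtain z where z: "z \<in> (if even l then fst ` E' else snd ` E')" by (cases "even l") auto
  have "t * l \<le> t * k" using l(2) by (intro mult_le_mono2) simp
  then have Tl: "Suc (t * Suc l) + l \<le> T" using l(2) by (simp add: T)
  have legs: "\<exists>q. (\<forall>a<t. q a 0 = z \<and> (\<forall>s<l. (q a s, q a (Suc s)) \<in> E \<union> E\<inverse>) \<and> q a l \<in> fst ` E) \<and>
    (\<forall>a<t. \<forall>a'<t. \<forall>s\<le>l. \<forall>s'\<le>l. q a s = q a' s' \<longrightarrow> s = s' \<and> (s = 0 \<or> a = a')) \<and>
    inj_on (\<lambda>a. (par ^^ d) (q a l)) {..<t}"
  proof (rule spider[OF order_trans[OF E'(1) R(1)] finE _ _ _ l(1) z Tl order_refl])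
    show "T \<le> card {w. (v, w) \<in> E'}" if "v \<in> fst ` E'" for v using E'(3) that by blast
    show "T \<le> card {v. (v, w) \<in> E'}" if "w \<in> snd ` E'" for w using E'(4) that by blast
    show "T \<le> card ((par ^^ d) ` {v. (v, w) \<in> E})" if "w \<in> snd ` E'" for w
      using rich E'(1) that by blast
  qed
  obtain q where q1: "\<forall>a<t. q a 0 = z \<and> (\<forall>s<l. (q a s, q a (Suc s)) \<in> E \<union> E\<inverse>) \<and> q a l \<in> fst ` E"
    and q2: "\<forall>a<t. \<forall>a'<t. \<forall>s\<le>l. \<forall>s'\<le>l. q a s = q a' s' \<longrightarrow> s = s' \<and> (s = 0 \<or> a = a')"
    and q3: "inj_on (\<lambda>a. (par ^^ d) (q a l)) {..<t}"
    using legs by (elim exE conjE) (rule that)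
  have up: "(par ^^ n) v \<in> V \<and> lev ((par ^^ n) v) = i - n" if "v \<in> fst ` E" "n \<le> i" for v n
    using that(2)
  proof (induction n)
    case 0 then show ?case using that(1) V E by auto
  next
    case (Suc n)
    then have h: "(par ^^ n) v \<in> V" "lev ((par ^^ n) v) = i - n" by auto
    then have "1 \<le> lev ((par ^^ n) v)" using Suc.prems by simp
    from par[OF h(1) this] show ?case using h(2) by auto
  qed
  have step: "((par ^^ Suc n) v, (par ^^ n) v) \<in> G \<union> G\<inverse>" if "v \<in> fst ` E" "Suc n \<le> i" for v n
    using up[OF that(1), of n] par[of "(par ^^ n) v"] that(2) by auto
  define p where "p a s = (if s \<le> Suc d then (par ^^ (Suc d - s)) (q a l) else q a (k - s))" for a s
  have p_low: "p a s = q a (k - s)" if "Suc d \<le> s" for a s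
    using that by (auto simp: p_def l(2) le_antisym)
  have lev_low: "lev (p a s) + Suc d = i + s" if "a < t" "s \<le> Suc d" for a s
    using up[of "q a l" "Suc d - s"] q1 that k by (simp add: p_def)
  have lev_q: "lev (q a s) \<ge> i" if "a < t" "s \<le> l" for a s
  proof (cases "s = 0")
    case True
    then have "q a s = z" using q1 that(1) by simp
    moreover have "z \<in> fst ` E \<union> snd ` E" using z E'(1) R(1) by (auto split: if_splits)
    ultimately show ?thesis using E by force
  next
    case False
    then have "s - 1 < l" using that(2) by simp
    then have "(q a (s - 1), q a (Suc (s - 1))) \<in> E \<union> E\<inverse>" using q1 that(1) by blast
    then show ?thesis using False E by force
  qed
  show ?thesis
  proof (rule theta_copyI)
    fix a assume a: "a < t"
    show "p a 0 = y" using q1 a y by (force simp: p_def)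
    show "p a k = z" using q1 a p_low[of k a] l by simp
  next
    fix a s assume a: "a < t" and s: "s < k"
    show "(p a s, p a (Suc s)) \<in> G \<union> G\<inverse>"
    proof (cases "s \<le> d")
      case True
      then have "p a s = (par ^^ Suc (d - s)) (q a l)" "p a (Suc s) = (par ^^ (d - s)) (q a l)"
        by (auto simp: p_def Suc_diff_le)
      then show ?thesis using step[of "q a l" "d - s"] q1 a k(2) by auto
    next
      case False
      then have e: "p a s = q a (Suc (k - Suc s))" "p a (Suc s) = q a (k - Suc s)"
        using p_low[of s a] p_low[of "Suc s" a] s by (auto simp: Suc_diff_Suc)
      have "k - Suc s < l" using False s l(2) by linarith
      then have "(p a (Suc s), p a s) \<in> E \<union> E\<inverse>" unfolding e using q1 a by blast
      then show ?thesis using E by blast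
    qed
  next
    fix a a' s s' assume a: "a < t" "a' < t" and s: "s \<le> k" "s' \<le> k" and eq: "p a s = p a' s'"
    have low: "s = s' \<and> (s = 0 \<or> s = k \<or> a = a')"
      if h: "a < t" "a' < t" "s \<le> Suc d" "s' \<le> Suc d" "p a s = p a' s'" for a a' s s'
    proof -
      have ss: "s = s'" using lev_low[OF h(1,3)] lev_low[OF h(2,4)] h(5) by simp
      \<comment> \<open>Climbing \<open>s - 1\<close> levels from position \<open>s\<close> reaches
        the child of \<open>y\<close> that names the branch, and the branches are distinct.\<close>
      have "a = a'" if "s \<noteq> 0"
      proof -
        have "(par ^^ (s - 1)) (p a s) = (par ^^ (s - 1)) (p a' s)" using h(5) ss by simp
        moreover have "(par ^^ (s - 1)) (p b s) = (par ^^ d) (q b l)" for b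
        proof -
          have "(par ^^ (s - 1)) (p b s) = (par ^^ (s - 1)) ((par ^^ (Suc d - s)) (q b l))"
            using h(3) by (simp add: p_def)
          also have "\<dots> = (par ^^ (s - 1 + (Suc d - s))) (q b l)"
            by (simp only: funpow_add o_apply)
          also have "s - 1 + (Suc d - s) = d" using h(3) that by simp
          finally show ?thesis .
        qed
        ultimately show ?thesis using q3 h(1,2) by (simp add: inj_on_def)
      qed
      then show ?thesis using ss by blast
    qed
    have high: "s = s' \<and> (s = 0 \<or> s = k \<or> a = a')" if h: "Suc d \<le> s" "Suc d \<le> s'"
    proof -
      have "k - s \<le> l" "k - s' \<le> l" using h s l(2) by linarith+
      moreover have "q a (k - s) = q a' (k - s')" using eq h by (simp add: p_low)
      ultimately have "k - s = k - s' \<and> (k - s = 0 \<or> a = a')" using q2 a by blast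
      then show ?thesis using s by auto
    qed
    have mixed: False if h: "a < t" "a' < t" "s \<le> d" "Suc d \<le> s'" "s' \<le> k" "p a s = p a' s'" for a a' s s'
    proof -
      have "lev (p a s) < i" using lev_low[of a s] h by simp
      moreover have "lev (p a' s') \<ge> i" using lev_q[of a' "k - s'"] h l(2) by (simp add: p_low)
      ultimately show False using h(6) by simp
    qed
    show "s = s' \<and> (s = 0 \<or> s = k \<or> a = a')"
    proof (cases "s \<le> Suc d \<and> s' \<le> Suc d")
      case True
      then show ?thesis using low[OF a _ _ eq] by blast
    next
      case False
      have "Suc d \<le> s"
      proof (rule ccontr)
        assume "\<not> ?thesis"
        then have "s \<le> d" "Suc d \<le> s'" using False by auto
        then show False using mixed[OF a(1,2) _ _ s(2) eq] by blast
      qed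
      moreover have "Suc d \<le> s'"
      proof (rule ccontr)
        assume "\<not> ?thesis"
        then have "s' \<le> d" "Suc d \<le> s" using False by auto
        then show False using mixed[OF a(2,1) _ _ s(1) eq[symmetric]] by blast
      qed
      ultimately show ?thesis by (rule high)
    qed
  qed
qed

section \<open>Dense graphs between consecutive levels\<close>

lemma popular_value:
  assumes "finite N" "N \<noteq> {}" "card (br ` N) \<le> T"
  shows "\<exists>c. card N \<le> T * card {v \<in> N. br v = c}"
proof (rule ccontr)
  assume "\<not> ?thesis"
  then have less: "T * card {v \<in> N. br v = c} < card N" for c by (simp add: not_le)
  have "card N = (\<Sum>c\<in>br ` N. card {v \<in> N. br v = c})"
    using sum.group[OF assms(1), of "br ` N" br "\<lambda>_. 1::nat"] assms(1) by simp
  then have "T * card N = (\<Sum>c\<in>br ` N. T * card {v \<in> N. br v = c})"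
    by (simp add: sum_distrib_left)
  also have "\<dots> < (\<Sum>c\<in>br ` N. card N)"
    by (rule sum_strict_mono) (use assms less in auto)
  also have "\<dots> \<le> T * card N" using assms(3) by simp
  finally show False by simp
qed

text \<open>Every \<open>w\<close> keeps only the edges to its most popular branch, which costs a
  factor \<open>T\<close>. The pieces for different branches then share no vertex on either side, so
  their densities average and one piece is at least as dense as the whole.\<close>

lemma popular_branch:
  fixes F :: "('u \<times> 'v) set" and br :: "'u \<Rightarrow> 'b"
  assumes F: "finite F" "F \<noteq> {}" and T: "T \<ge> 1"
    and poor: "\<And>w. w \<in> snd ` F \<Longrightarrow> card (br ` {v. (v, w) \<in> F}) \<le> T"
    and dense: "T * Q * (card (fst ` F) + card (snd ` F)) \<le> card F"
  shows "\<exists>c F'. F' \<subseteq> F \<and> F' \<noteq> {} \<and> (\<forall>v w. (v, w) \<in> F' \<longrightarrow> br v = c) \<and>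
    Q * (card (fst ` F') + card (snd ` F')) \<le> card F'"
proof -
  have finN: "finite {v. (v, w) \<in> F}" for w
    by (rule finite_subset[of _ "fst ` F"]) (use F in \<open>force+\<close>)
  have "\<exists>c. card {v. (v, w) \<in> F} \<le> T * card {v. (v, w) \<in> F \<and> br v = c}" if "w \<in> snd ` F" for w
  proof -
    have "{v. (v, w) \<in> F} \<noteq> {}" using that by auto
    from popular_value[OF finN this poor[OF that]] show ?thesis by simp
  qed
  then have "\<forall>w\<in>snd ` F. \<exists>c. card {v. (v, w) \<in> F} \<le> T * card {v. (v, w) \<in> F \<and> br v = c}"
    by blast
  from bchoice[OF this] obtain c where
    c: "\<forall>w\<in>snd ` F. card {v. (v, w) \<in> F} \<le> T * card {v. (v, w) \<in> F \<and> br v = c w}"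
    by (elim exE) (rule that)
  define F' where "F' = {(v, w). (v, w) \<in> F \<and> br v = c w}"
  have F': "F' \<subseteq> F" by (auto simp: F'_def)
  have finF': "finite F'" using F' F(1) finite_subset by blast
  have cnt: "card H = (\<Sum>w\<in>snd ` F. card {v. (v, w) \<in> H})" if "H \<subseteq> F" for H
  proof -
    have fin: "finite H" using that F(1) finite_subset by blast
    have "card H = (\<Sum>w\<in>snd ` F. card {x \<in> H. snd x = w})"
      using sum.group[OF fin, of "snd ` F" snd "\<lambda>_. 1::nat"] F(1) image_mono[OF that, of snd] by simp
    also have "\<dots> = (\<Sum>w\<in>snd ` F. card {v. (v, w) \<in> H})"
    proof (rule sum.cong[OF refl])
      fix w
      have "{x \<in> H. snd x = w} = (\<lambda>v. (v, w)) ` {v. (v, w) \<in> H}" by auto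
      then show "card {x \<in> H. snd x = w} = card {v. (v, w) \<in> H}"
        by (simp add: card_image inj_on_def)
    qed
    finally show ?thesis .
  qed
  have "card F \<le> (\<Sum>w\<in>snd ` F. T * card {v. (v, w) \<in> F'})"
    unfolding cnt[OF order_refl] by (rule sum_mono) (drule bspec[OF c], simp add: F'_def)
  also have "\<dots> = T * card F'" unfolding cnt[OF F'] by (simp add: sum_distrib_left)
  finally have big: "card F \<le> T * card F'" .
  then have "F' \<noteq> {}" using F by auto
  have "T * (Q * (card (fst ` F) + card (snd ` F))) \<le> T * card F'"
    using dense[unfolded mult.assoc] big by (rule order_trans)
  then have dense': "Q * (card (fst ` F) + card (snd ` F)) \<le> card F'" using T by simp
  define Fc where "Fc b = {(v, w). (v, w) \<in> F' \<and> br v = b}" for b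
  define C where "C = br ` fst ` F'"
  have finC: "finite C" using finF' by (simp add: C_def)
  have Fc: "Fc b \<subseteq> F'" for b by (auto simp: Fc_def)
  have FcF: "Fc b \<subseteq> F" for b using Fc F' by blast
  have finFc: "finite (Fc b)" for b using Fc finF' finite_subset by blast
  have ex: "\<exists>b\<in>C. Q * (card (fst ` Fc b) + card (snd ` Fc b)) \<le> card (Fc b)"
  proof (rule ccontr)
    assume "\<not> ?thesis"
    then have less: "\<And>b. b \<in> C \<Longrightarrow> card (Fc b) < Q * (card (fst ` Fc b) + card (snd ` Fc b))"
      by (auto simp: not_le)
    have "F' = (\<Union>b\<in>C. Fc b)" by (force simp: Fc_def C_def)
    then have "card F' = (\<Sum>b\<in>C. card (Fc b))"
      using card_UN_disjoint[OF finC, of Fc] finFc by (auto simp: Fc_def)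
    also have "\<dots> < (\<Sum>b\<in>C. Q * (card (fst ` Fc b) + card (snd ` Fc b)))"
      by (rule sum_strict_mono) (use finC less \<open>F' \<noteq> {}\<close> in \<open>auto simp: C_def\<close>)
    also have "\<dots> = Q * ((\<Sum>b\<in>C. card (fst ` Fc b)) + (\<Sum>b\<in>C. card (snd ` Fc b)))"
      by (simp only: sum_distrib_left[symmetric] sum.distrib)
    also have "(\<Sum>b\<in>C. card (fst ` Fc b)) = card (\<Union>b\<in>C. fst ` Fc b)"
      by (rule card_UN_disjoint[symmetric]) (use finC finFc in \<open>auto simp: Fc_def\<close>)
    also have "\<dots> \<le> card (fst ` F)"
      by (rule card_mono) (use F(1) in simp, use FcF in blast)
    also have "(\<Sum>b\<in>C. card (snd ` Fc b)) = card (\<Union>b\<in>C. snd ` Fc b)"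
      by (rule card_UN_disjoint[symmetric]) (use finC finFc in \<open>auto simp: Fc_def F'_def\<close>)
    also have "\<dots> \<le> card (snd ` F)"
      by (rule card_mono) (use F(1) in simp, use FcF in blast)
    finally show False using dense' by simp
  qed
  then obtain b where b: "b \<in> C" "Q * (card (fst ` Fc b) + card (snd ` Fc b)) \<le> card (Fc b)" by blast
  have "Fc b \<noteq> {}" using b(1) by (force simp: C_def Fc_def)
  moreover have "Fc b \<subseteq> F" using Fc F' by blast
  ultimately show ?thesis
    using b(2) by (intro exI[of _ b] exI[of _ "Fc b"]) (auto simp: Fc_def)
qed

text \<open>Induction on the height \<open>d\<close> of a common ancestor \<open>y\<close> of the
  left ends. If half of the edges lead to vertices with neighbours in at least \<open>T\<close>
  branches below \<open>y\<close>, a spider gives the theta; otherwise one branch stays dense and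
  \<open>d\<close> drops. The factor \<open>2 * T\<close> per level pays for the halving and for
  \<open>popular_branch\<close>. At \<open>d = 0\<close> the graph would be a star with more edges
  than leaves.\<close>

lemma theta_from_levels:
  fixes par :: "'v \<Rightarrow> 'v" and lev :: "'v \<Rightarrow> nat"
  assumes k: "i < k" and T: "T = Suc t * Suc k"
    and par: "\<And>v. v \<in> V \<Longrightarrow> 1 \<le> lev v \<Longrightarrow> par v \<in> V \<and> Suc (lev (par v)) = lev v \<and> (par v, v) \<in> G \<union> G\<inverse>"
  shows "d \<le> i \<Longrightarrow> finite E \<Longrightarrow> E \<noteq> {} \<Longrightarrow> fst ` E \<subseteq> V \<Longrightarrow>
    (\<And>v w. (v, w) \<in> E \<Longrightarrow> lev v = i \<and> lev w = Suc i \<and> (v, w) \<in> G \<union> G\<inverse>) \<Longrightarrow>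
    (\<And>v w. (v, w) \<in> E \<Longrightarrow> (par ^^ d) v = y) \<Longrightarrow>
    (2 * T) ^ d * (card (fst ` E) + card (snd ` E)) \<le> card E \<Longrightarrow> \<exists>g. theta_copy G k t g"
proof (induction d arbitrary: E y)
  case 0
  have "fst ` E = {y}" using 0(3,6) by force
  then have "card E \<le> card (snd ` E)" using card_edges_le[OF 0(2)] by simp
  moreover have "Suc (card (snd ` E)) \<le> card E" using 0(7) \<open>fst ` E = {y}\<close> by simp
  ultimately show ?case by simp
next
  case (Suc d)
  let ?br = "par ^^ d"
  define R where "R = {(v, w) \<in> E. T \<le> card (?br ` {v. (v, w) \<in> E})}"
  have R: "R \<subseteq> E" by (auto simp: R_def)
  have finR: "finite R" using R Suc.prems(2) finite_subset by blast
  have T1: "T \<ge> 1" by (simp add: T)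
  have mono: "card (fst ` H) + card (snd ` H) \<le> card (fst ` E) + card (snd ` E)" if "H \<subseteq> E" for H
    by (intro add_mono card_mono image_mono that) (use Suc.prems(2) in auto)
  have pos: "card E > 0" using Suc.prems(2,3) by (simp add: card_gt_0_iff)
  have "T * (2 * T) ^ d * (card (fst ` E) + card (snd ` E)) * 2 \<le> card E"
    using Suc.prems(7) by (simp add: mult_ac)
  moreover have split: "card E = card R + card (E - R)"
    using card_Diff_subset[OF finR R] card_mono[OF Suc.prems(2) R] by simp
  ultimately consider "T * (2 * T) ^ d * (card (fst ` E) + card (snd ` E)) \<le> card R" "card R > 0"
    | "T * (2 * T) ^ d * (card (fst ` E) + card (snd ` E)) \<le> card (E - R)" "card (E - R) > 0"
    using pos by linarith
  then show ?case
  proof cases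
    case 1
    have "T * 1 * (card (fst ` R) + card (snd ` R)) \<le> T * (2 * T) ^ d * (card (fst ` E) + card (snd ` E))"
      by (intro mult_mono mono R order_refl) (use T1 in auto)
    then have "T * (card (fst ` R) + card (snd ` R)) \<le> card R" using 1 by linarith
    moreover have "R \<noteq> {}" using 1(2) by auto
    moreover have "T \<le> card (?br ` {v. (v, w) \<in> E})" if "w \<in> snd ` R" for w
      using that by (auto simp: R_def)
    ultimately show ?thesis
      using Suc.prems(3)
    proof (intro theta_from_spider[where E = E and V = V and par = par and lev = lev and y = y and R = R])
      show "i < k" "Suc d \<le> i" "finite E" "fst ` E \<subseteq> V" "T = Suc t * Suc k" "R \<subseteq> E" by fact+
      show "lev v = i \<and> lev w = Suc i \<and> (v, w) \<in> G \<union> G\<inverse>" if "(v, w) \<in> E" for v w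
        by (rule Suc.prems(5)[OF that])
      show "par v \<in> V \<and> Suc (lev (par v)) = lev v \<and> (par v, v) \<in> G \<union> G\<inverse>" if "v \<in> V" "1 \<le> lev v" for v
        by (rule par[OF that])
      show "(par ^^ Suc d) v = y" if "(v, w) \<in> E" for v w by (rule Suc.prems(6)[OF that])
    qed
  next
    case 2
    have "card (?br ` {v. (v, w) \<in> E - R}) \<le> T" if "w \<in> snd ` (E - R)" for w
    proof -
      have "card (?br ` {v. (v, w) \<in> E - R}) \<le> card (?br ` {v. (v, w) \<in> E})"
        by (rule card_mono)
          (auto intro!: finite_imageI finite_subset[of "{v. (v, w) \<in> E}" "fst ` E"] simp: Suc.prems(2) image_iff, force)
      moreover have "\<dots> < T" using that by (auto simp: R_def)
      ultimately show ?thesis by linarith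
    qed
    moreover have "T * (2 * T) ^ d * (card (fst ` (E - R)) + card (snd ` (E - R))) \<le> card (E - R)"
      by (rule order_trans[OF mult_le_mono2[OF mono[OF Diff_subset]] 2(1)])
    moreover have "E - R \<noteq> {}" "finite (E - R)" using 2(2) Suc.prems(2) by (metis card.empty less_irrefl, simp)
    ultimately obtain c F where F: "F \<subseteq> E - R" "F \<noteq> {}" "\<forall>v w. (v, w) \<in> F \<longrightarrow> ?br v = c"
      "(2 * T) ^ d * (card (fst ` F) + card (snd ` F)) \<le> card F"
      using popular_branch[of "E - R" T ?br "(2 * T) ^ d"] T1 by blast
    have FE: "F \<subseteq> E" using F(1) by blast
    show ?thesis
    proof (rule Suc.IH[where E = F and y = c])
      show "d \<le> i" using Suc.prems(1) by simp
      show "finite F" using FE Suc.prems(2) finite_subset by blast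
      show "fst ` F \<subseteq> V" using FE Suc.prems(4) by blast
      show "\<And>v w. (v, w) \<in> F \<Longrightarrow> lev v = i \<and> lev w = Suc i \<and> (v, w) \<in> G \<union> G\<inverse>"
        using FE Suc.prems(5) by blast
    qed (use F in auto)
  qed
qed

section \<open>Breadth-first search\<close>

text \<open>A vertex of level \<open>Suc n\<close> has its \<open>D * (\<rho> + 3)\<close>
  neighbours in the two adjacent levels, whereas consecutive levels span at most \<open>D\<close>
  edges per vertex by \<open>theta_from_levels\<close>. This forces growth by the factor
  \<open>\<rho>\<close>. The summand 3 pays for level \<open>Suc n\<close>, which occurs in both
  pairs of levels, and for level \<open>n\<close>, which is no larger.\<close>

lemma theta_from_min_degree:
  fixes G :: "('v \<times> 'v) set"
  assumes G: "G \<subseteq> A \<times> B" "A \<inter> B = {}" "finite G" "G \<noteq> {}"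
    and D: "D = (2 * (Suc t * Suc k)) ^ k" and \<rho>: "\<rho> \<ge> 1"
    and deg: "\<And>v. v \<in> fst ` G \<Longrightarrow> D * (\<rho> + 3) \<le> card {w. (v, w) \<in> G}"
      "\<And>w. w \<in> snd ` G \<Longrightarrow> D * (\<rho> + 3) \<le> card {v. (v, w) \<in> G}"
    and free: "\<not> (\<exists>g. theta_copy G k t g)"
  shows "\<rho> ^ k \<le> card (fst ` G) + card (snd ` G)"
proof -
  define adj where "adj u v \<longleftrightarrow> (u, v) \<in> G \<union> G\<inverse>" for u v
  define W where "W = fst ` G \<union> snd ` G"
  define nbr where "nbr v = {u. adj v u}" for v
  have finW: "finite W" using G(3) by (simp add: W_def)
  have adj_sym: "adj u v \<longleftrightarrow> adj v u" for u v by (auto simp: adj_def)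
  have adjW: "adj u v \<Longrightarrow> u \<in> W \<and> v \<in> W" for u v by (force simp: adj_def W_def)
  have nbrW: "nbr v \<subseteq> W" for v using adjW by (auto simp: nbr_def)
  have finnbr: "finite (nbr v)" for v using nbrW finW finite_subset by blast
  have side: "adj u v \<Longrightarrow> (u \<in> A) \<noteq> (v \<in> A)" for u v using G(1,2) by (auto simp: adj_def)
  have degn: "D * (\<rho> + 3) \<le> card (nbr v)" if "v \<in> W" for v
  proof (cases "v \<in> fst ` G")
    case True
    have "card {w. (v, w) \<in> G} \<le> card (nbr v)" by (rule card_mono[OF finnbr]) (auto simp: nbr_def adj_def)
    then show ?thesis using deg(1)[OF True] by linarith
  next
    case False
    then have "v \<in> snd ` G" using that by (auto simp: W_def)
    moreover have "card {w. (w, v) \<in> G} \<le> card (nbr v)" by (rule card_mono[OF finnbr]) (auto simp: nbr_def adj_def)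
    ultimately show ?thesis using deg(2) by fastforce
  qed
  obtain r where r: "r \<in> W" using G(4) by (auto simp: W_def)
  define reach where "reach = rec_nat {r} (\<lambda>_ S. S \<union> {v. \<exists>u\<in>S. adj u v})"
  have reach0: "reach 0 = {r}" and reachS: "reach (Suc n) = reach n \<union> {v. \<exists>u\<in>reach n. adj u v}" for n
    by (simp_all add: reach_def)
  define Re where "Re = (\<Union>n. reach n)"
  \<comment> \<open>The distance from \<open>r\<close>; it is meaningful on \<open>Re\<close>, to
    which the levels \<open>Lv\<close> are confined.\<close>
  define lev where "lev v = (LEAST n. v \<in> reach n)" for v
  have lev_le: "v \<in> reach n \<Longrightarrow> lev v \<le> n" for v n unfolding lev_def by (rule Least_le)
  have lev_in: "v \<in> reach (lev v)" if "v \<in> Re" for v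
    using that unfolding lev_def Re_def by (auto intro: LeastI)
  have ReW: "Re \<subseteq> W"
  proof -
    have "reach n \<subseteq> W" for n by (induction n) (use r adjW in \<open>auto simp: reach0 reachS\<close>)
    then show ?thesis by (auto simp: Re_def)
  qed
  have lev_step: "v \<in> Re \<and> lev v \<le> Suc (lev u)" if "u \<in> Re" "adj u v" for u v
  proof -
    have "v \<in> reach (Suc (lev u))" using lev_in[OF that(1)] that(2) by (auto simp: reachS)
    then show ?thesis using lev_le by (auto simp: Re_def)
  qed
  have lev_r: "r \<in> Re" "lev r = 0" using reach0 lev_le[of r 0] by (auto simp: Re_def intro: exI[of _ 0])
  have lev0: "v = r" if "v \<in> Re" "lev v = 0" for v using lev_in[OF that(1)] that(2) reach0 by simp
  have pred: "\<exists>u\<in>Re. lev u = n \<and> adj u v" if "v \<in> Re" "lev v = Suc n" for v n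
  proof -
    have "v \<in> reach (Suc n)" "v \<notin> reach n" using lev_in[OF that(1)] lev_le[of v n] that(2) by auto
    then obtain u where u: "u \<in> reach n" "adj u v" by (auto simp: reachS)
    then have "u \<in> Re" by (auto simp: Re_def)
    moreover have "lev u \<le> n" using lev_le u(1) by blast
    moreover have "Suc n \<le> Suc (lev u)" using lev_step[OF \<open>u \<in> Re\<close> u(2)] that(2) by simp
    ultimately show ?thesis using u(2) by auto
  qed
  \<comment> \<open>The parity of the level determines the class, so no edge stays inside a
    level.\<close>
  have col: "v \<in> Re \<Longrightarrow> lev v = n \<Longrightarrow> (v \<in> A) = ((r \<in> A) = even n)" for v n
  proof (induction n arbitrary: v)
    case 0 then show ?case using lev0 by auto
  next
    case (Suc n)
    then obtain u where "u \<in> Re" "lev u = n" "adj u v" using pred by blast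
    then show ?case using Suc.IH side by fastforce
  qed
  define par where "par v = (SOME u. u \<in> Re \<and> Suc (lev u) = lev v \<and> adj u v)" for v
  have par: "par v \<in> Re \<and> Suc (lev (par v)) = lev v \<and> (par v, v) \<in> G \<union> G\<inverse>" if "v \<in> Re" "1 \<le> lev v" for v
  proof -
    have "\<exists>u. u \<in> Re \<and> Suc (lev u) = lev v \<and> adj u v"
      using pred[OF that(1), of "lev v - 1"] that(2) by auto
    from someI_ex[OF this] show ?thesis unfolding par_def adj_def by blast
  qed
  have par_top: "(par ^^ n) v = r" if "v \<in> Re" "lev v = n" for v n
    using that
  proof (induction n arbitrary: v)
    case 0 then show ?case using lev0 by simp
  next
    case (Suc n)
    then show ?case using par[of v] by (simp add: funpow_swap1)
  qed
  define Lv where "Lv n = {v \<in> Re. lev v = n}" for n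
  define e where "e n = {(u, v). u \<in> Lv n \<and> v \<in> Lv (Suc n) \<and> adj u v}" for n
  have finL: "finite (Lv n)" for n using ReW finW by (auto simp: Lv_def intro: finite_subset)
  have esub: "e n \<subseteq> Lv n \<times> Lv (Suc n)" for n by (auto simp: e_def)
  have fine: "finite (e n)" for n using esub finL by (meson finite_SigmaI finite_subset)
  have fe: "fst ` e n \<subseteq> Lv n" "snd ` e n \<subseteq> Lv (Suc n)" for n using esub by force+
  have D1: "D \<ge> 1" unfolding D by simp
  have sparse: "card (e n) \<le> D * (card (Lv n) + card (Lv (Suc n)))" if n: "n < k" for n
  proof (rule ccontr)
    assume "\<not> ?thesis"
    then have gt: "D * (card (Lv n) + card (Lv (Suc n))) < card (e n)" by simp
    have "(2 * (Suc t * Suc k)) ^ n \<le> D" unfolding D using n by (intro power_increasing) auto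
    then have "(2 * (Suc t * Suc k)) ^ n * (card (fst ` e n) + card (snd ` e n)) \<le> D * (card (Lv n) + card (Lv (Suc n)))"
      by (intro mult_mono add_mono card_mono finL fe) auto
    then have dense: "(2 * (Suc t * Suc k)) ^ n * (card (fst ` e n) + card (snd ` e n)) \<le> card (e n)" using gt by linarith
    have "e n \<noteq> {}" using gt by auto
    have "\<exists>g. theta_copy G k t g"
    proof (rule theta_from_levels[OF n refl par order_refl fine \<open>e n \<noteq> {}\<close> _ _ _ dense])
      show "fst ` e n \<subseteq> Re" using fe(1)[of n] by (auto simp: Lv_def)
      show "\<And>v w. (v, w) \<in> e n \<Longrightarrow> lev v = n \<and> lev w = Suc n \<and> (v, w) \<in> G \<union> G\<inverse>"
        by (auto simp: e_def Lv_def adj_def)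
      show "\<And>v w. (v, w) \<in> e n \<Longrightarrow> (par ^^ n) v = r" by (auto simp: e_def Lv_def par_top)
    qed
    then show False using free by blast
  qed
  have cnt_up: "(\<Sum>v\<in>Lv n. card (nbr v \<inter> Lv (Suc n))) = card (e n)" for n
  proof -
    have "e n = (SIGMA v:Lv n. nbr v \<inter> Lv (Suc n))" by (auto simp: e_def nbr_def)
    then show ?thesis by (simp add: finL)
  qed
  have cnt_down: "(\<Sum>v\<in>Lv (Suc n). card (nbr v \<inter> Lv n)) = card (e n)" for n
  proof -
    have "(e n)\<inverse> = (SIGMA v:Lv (Suc n). nbr v \<inter> Lv n)" using adj_sym by (auto simp: e_def nbr_def)
    then have "card ((e n)\<inverse>) = (\<Sum>v\<in>Lv (Suc n). card (nbr v \<inter> Lv n))" by (simp add: finL)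
    then show ?thesis by simp
  qed
  have nbr_lev: "u \<in> Re \<and> lev u \<le> Suc (lev v) \<and> lev v \<le> Suc (lev u) \<and> lev u \<noteq> lev v"
    if "v \<in> Re" "u \<in> nbr v" for u v
  proof -
    have a: "adj v u" using that(2) by (simp add: nbr_def)
    from lev_step[OF that(1) a] have u: "u \<in> Re" "lev u \<le> Suc (lev v)" by auto
    moreover have "lev v \<le> Suc (lev u)" using lev_step[OF u(1)] a adj_sym by blast
    moreover have "lev u \<noteq> lev v" using col[OF u(1) refl] col[OF that(1) refl] side[OF a] by metis
    ultimately show ?thesis by blast
  qed
  have low: "D * (\<rho> + 3) * card (Lv (Suc n)) \<le> card (e n) + card (e (Suc n))" for n
  proof -
    have "D * (\<rho> + 3) * card (Lv (Suc n)) = (\<Sum>v\<in>Lv (Suc n). D * (\<rho> + 3))" by simp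
    also have "\<dots> \<le> (\<Sum>v\<in>Lv (Suc n). card (nbr v \<inter> Lv n) + card (nbr v \<inter> Lv (Suc (Suc n))))"
    proof (rule sum_mono)
      fix v assume v: "v \<in> Lv (Suc n)"
      then have vR: "v \<in> Re" "lev v = Suc n" by (auto simp: Lv_def)
      have "nbr v \<subseteq> (nbr v \<inter> Lv n) \<union> (nbr v \<inter> Lv (Suc (Suc n)))"
        using nbr_lev[OF vR(1)] vR(2) by (fastforce simp: Lv_def)
      then have "card (nbr v) \<le> card ((nbr v \<inter> Lv n) \<union> (nbr v \<inter> Lv (Suc (Suc n))))"
        by (rule card_mono[rotated]) (simp add: finL)
      also have "\<dots> \<le> card (nbr v \<inter> Lv n) + card (nbr v \<inter> Lv (Suc (Suc n)))" by (rule card_Un_le)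
      finally show "D * (\<rho> + 3) \<le> card (nbr v \<inter> Lv n) + card (nbr v \<inter> Lv (Suc (Suc n)))"
        using degn[of v] ReW vR(1) by (meson le_trans subsetD)
    qed
    also have "\<dots> = card (e n) + card (e (Suc n))" by (simp add: sum.distrib cnt_up cnt_down)
    finally show ?thesis .
  qed
  have L0: "Lv 0 = {r}" 
  proof
    show "Lv 0 \<subseteq> {r}"
    proof
      fix v assume "v \<in> Lv 0"
      then show "v \<in> {r}" using lev0[of v] unfolding Lv_def by blast
    qed
    show "{r} \<subseteq> Lv 0" using lev_r by (simp add: Lv_def)
  qed
  have growth: "\<rho> * card (Lv n) \<le> card (Lv (Suc n))" if "n < k" for n
    using that
  proof (induction n)
    case 0
    have "nbr r \<subseteq> Lv 1"
    proof
      fix u assume "u \<in> nbr r"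
      from nbr_lev[OF lev_r(1) this] show "u \<in> Lv 1" unfolding Lv_def lev_r(2) by simp
    qed
    then have "card (nbr r) \<le> card (Lv 1)" by (rule card_mono[OF finL])
    moreover have "1 * \<rho> \<le> D * (\<rho> + 3)" using D1 by (intro mult_mono) auto
    ultimately have "\<rho> \<le> card (Lv 1)" using degn[OF r] by linarith
    then show ?case by (simp add: L0)
  next
    case (Suc n)
    have le: "card (Lv n) \<le> card (Lv (Suc n))"
      using Suc.IH Suc.prems \<rho> by (metis One_nat_def Suc_lessD dual_order.trans mult_le_mono1 nat_mult_1)
    have "D * ((\<rho> + 3) * card (Lv (Suc n))) \<le> D * (card (Lv n) + card (Lv (Suc n))) + D * (card (Lv (Suc n)) + card (Lv (Suc (Suc n))))"
      using low[of n] sparse[of n] sparse[of "Suc n"] Suc.prems unfolding mult.assoc by linarith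
    then have "D * ((\<rho> + 3) * card (Lv (Suc n))) \<le> D * (card (Lv n) + 2 * card (Lv (Suc n)) + card (Lv (Suc (Suc n))))"
      by (simp add: distrib_left)
    then have "(\<rho> + 3) * card (Lv (Suc n)) \<le> card (Lv n) + 2 * card (Lv (Suc n)) + card (Lv (Suc (Suc n)))"
      using D1 by simp
    then show ?case using le by (simp add: distrib_right)
  qed
  have "\<rho> ^ n \<le> card (Lv n)" if "n \<le> k" for n
    using that
  proof (induction n)
    case 0 then show ?case by (simp add: L0)
  next
    case (Suc n)
    have "\<rho> ^ Suc n \<le> \<rho> * card (Lv n)" using Suc by simp
    also have "\<dots> \<le> card (Lv (Suc n))" using growth Suc.prems by simp
    finally show ?case .
  qed
  then have "\<rho> ^ k \<le> card (Lv k)" by simp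
  also have "\<dots> \<le> card W" by (rule card_mono[OF finW]) (use ReW in \<open>auto simp: Lv_def\<close>)
  also have "\<dots> \<le> card (fst ` G) + card (snd ` G)" unfolding W_def by (rule card_Un_le)
  finally show ?thesis .
qed

text \<open>A denser graph has a subgraph of minimum degree at least
  \<open>D * (\<rho> + 3)\<close>, whose levels would need \<open>\<rho> ^ k\<close> vertices. With
  \<open>\<rho>\<close> just above the k-th root of \<open>card A + card B\<close>, this is the
  classical edge bound for theta-free bipartite graphs.\<close>

lemma theta_free_card_le:
  fixes E :: "('v \<times> 'v) set"
  assumes E: "E \<subseteq> A \<times> B" "A \<inter> B = {}" "finite A" "finite B"
    and D: "D = (2 * (Suc t * Suc k)) ^ k" and \<rho>: "card A + card B < \<rho> ^ k" "k \<ge> 1"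
    and free: "\<not> (\<exists>g. theta_copy E k t g)"
  shows "card E \<le> D * (\<rho> + 3) * (card A + card B)"
proof (rule ccontr)
  assume "\<not> ?thesis"
  then have gt: "D * (\<rho> + 3) * (card A + card B) < card E" by simp
  have finE: "finite E" using E finite_subset by blast
  have sub: "fst ` E \<subseteq> A" "snd ` E \<subseteq> B" using E(1) by auto
  have D1: "D \<ge> 1" unfolding D by simp
  have "D * (\<rho> + 3) * (card (fst ` E) + card (snd ` E)) \<le> D * (\<rho> + 3) * (card A + card B)"
    by (intro mult_left_mono add_mono card_mono E sub) simp
  then have dense: "D * (\<rho> + 3) * (card (fst ` E) + card (snd ` E)) \<le> card E" using gt by linarith
  have "E \<noteq> {}" using gt by auto
  moreover have "D * (\<rho> + 3) \<ge> 1" using D1 by simp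
  ultimately obtain G where G: "G \<subseteq> E" "G \<noteq> {}" "\<forall>v\<in>fst ` G. D * (\<rho> + 3) \<le> card {w. (v, w) \<in> G}"
    "\<forall>w\<in>snd ` G. D * (\<rho> + 3) \<le> card {v. (v, w) \<in> G}"
    using min_degree_subgraph[OF finE _ dense] by blast
  have "\<rho> \<ge> 1" using \<rho> by (cases \<rho>) (auto simp: power_0_left)
  have "\<rho> ^ k \<le> card (fst ` G) + card (snd ` G)"
  proof (rule theta_from_min_degree[OF _ E(2) _ G(2) D \<open>\<rho> \<ge> 1\<close>])
    show "G \<subseteq> A \<times> B" "finite G" using G(1) E(1) finE finite_subset by blast+
    show "\<not> (\<exists>g. theta_copy G k t g)" using free theta_copy_mono[OF _ G(1)] by blast
  qed (use G in auto)
  also have "\<dots> \<le> card A + card B"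
    using order_trans[OF image_mono[OF G(1)] sub(1)] order_trans[OF image_mono[OF G(1)] sub(2)]
    by (intro add_mono card_mono E)
  finally show False using \<rho> by simp
qed

section \<open>The upper bound\<close>

definition E_plus_free :: "('v \<times> 'v) set \<Rightarrow> nat \<Rightarrow> nat \<Rightarrow> bool" where
  "E_plus_free E k t \<longleftrightarrow> \<not> (\<exists>\<phi>. inj_on \<phi> (verts (E_plus k t)) \<and>
     (\<forall>u\<in>verts (E_plus k t). \<forall>v\<in>verts (E_plus k t). {u, v} \<in> edges (E_plus k t) \<longrightarrow> (\<phi> u, \<phi> v) \<in> E \<union> E\<inverse>))"

lemma E_plus_free_subset:
  assumes "E_plus_free E k t" "E' \<subseteq> E"
  shows "E_plus_free E' k t"
proof -
  have sub: "E' \<union> E'\<inverse> \<subseteq> E \<union> E\<inverse>" using assms(2) by blast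
  show ?thesis
    unfolding E_plus_free_def
  proof
    assume "\<exists>\<phi>. inj_on \<phi> (verts (E_plus k t)) \<and> (\<forall>u\<in>verts (E_plus k t). \<forall>v\<in>verts (E_plus k t).
      {u, v} \<in> edges (E_plus k t) \<longrightarrow> (\<phi> u, \<phi> v) \<in> E' \<union> E'\<inverse>)"
    then obtain \<phi> where \<phi>: "inj_on \<phi> (verts (E_plus k t))" "\<forall>u\<in>verts (E_plus k t). \<forall>v\<in>verts (E_plus k t).
      {u, v} \<in> edges (E_plus k t) \<longrightarrow> (\<phi> u, \<phi> v) \<in> E' \<union> E'\<inverse>" by (elim exE conjE) (rule that)
    have "\<forall>u\<in>verts (E_plus k t). \<forall>v\<in>verts (E_plus k t). {u, v} \<in> edges (E_plus k t) \<longrightarrow> (\<phi> u, \<phi> v) \<in> E \<union> E\<inverse>"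
      using \<phi>(2) subsetD[OF sub] by blast
    with \<phi>(1) assms(1)[unfolded E_plus_free_def] show False by blast
  qed
qed

lemma E_plus_free_converse: "E_plus_free (E\<inverse>) k t \<longleftrightarrow> E_plus_free E k t"
proof -
  have "E\<inverse> \<union> (E\<inverse>)\<inverse> = E \<union> E\<inverse>" by (simp add: Un_commute)
  then show ?thesis unfolding E_plus_free_def by (rule ssubst) (rule refl)
qed

lemma E_plus_edge_cases:
  assumes "{u, v} \<in> edges (E_plus k t)"
    and sym: "\<And>u v. (\<phi> u, \<phi> v) \<in> R \<Longrightarrow> (\<phi> v, \<phi> u) \<in> R"
    and "(\<phi> E_vertex.X, \<phi> E_vertex.Y) \<in> R"
    and "\<And>i j. i < t \<Longrightarrow> j \<le> k \<Longrightarrow> even j \<Longrightarrow> (\<phi> E_vertex.X, \<phi> (Theta (theta_pos k i j))) \<in> R"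
    and "\<And>i j. i < t \<Longrightarrow> j \<le> k \<Longrightarrow> odd j \<Longrightarrow> (\<phi> E_vertex.Y, \<phi> (Theta (theta_pos k i j))) \<in> R"
    and "\<And>i j. i < t \<Longrightarrow> j < k \<Longrightarrow> (\<phi> (Theta (theta_pos k i j)), \<phi> (Theta (theta_pos k i (Suc j)))) \<in> R"
  shows "(\<phi> u, \<phi> v) \<in> R"
proof -
  have *: ?thesis if "{u, v} = {a, b}" "(\<phi> a, \<phi> b) \<in> R" for a b
    using that sym by (auto simp: doubleton_eq_iff)
  have "{u, v} = {E_vertex.X, E_vertex.Y} \<or> (\<exists>e\<in>edges (theta k t). {u, v} = Theta ` e) \<or>
      (\<exists>a\<in>theta_A k t. {u, v} = {E_vertex.X, Theta a}) \<or> (\<exists>b\<in>theta_B k t. {u, v} = {E_vertex.Y, Theta b})"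
    using assms(1) unfolding E_plus_def E_graph_def graph.sel by blast
  moreover have "\<exists>i j. i < t \<and> j < k \<and> {u, v} = {Theta (theta_pos k i j), Theta (theta_pos k i (Suc j))}"
    if e: "e \<in> edges (theta k t)" "{u, v} = Theta ` e" for e
  proof -
    obtain i j where "i < t" "j < k" "e = {theta_pos k i j, theta_pos k i (Suc j)}"
      using e(1) unfolding theta_def graph.sel by blast
    then show ?thesis using e(2) by (intro exI[of _ i] exI[of _ j]) simp
  qed
  moreover have "\<exists>i j. i < t \<and> j \<le> k \<and> even j \<and> a = theta_pos k i j" if "a \<in> theta_A k t" for a
    using that unfolding theta_A_def by blast
  moreover have "\<exists>i j. i < t \<and> j \<le> k \<and> odd j \<and> b = theta_pos k i j" if "b \<in> theta_B k t" for b
    using that unfolding theta_B_def by blast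
  ultimately consider "{u, v} = {E_vertex.X, E_vertex.Y}"
    | i j where "i < t" "j < k" "{u, v} = {Theta (theta_pos k i j), Theta (theta_pos k i (Suc j))}"
    | i j where "i < t" "j \<le> k" "even j" "{u, v} = {E_vertex.X, Theta (theta_pos k i j)}"
    | i j where "i < t" "j \<le> k" "odd j" "{u, v} = {E_vertex.Y, Theta (theta_pos k i j)}"
    by metis
  then show ?thesis
    by cases (auto intro: * assms(3-6))
qed

text \<open>The vertices \<open>x\<close> and \<open>y\<close> play the roles of \<open>X\<close> and \<open>Y\<close> in the order determined by
  the side on which the source of the theta lies.\<close>
lemma link_no_theta:
  assumes E: "E \<subseteq> U \<times> V" "U \<inter> V = {}" and free: "E_plus_free E k t" and t: "t \<ge> 1" and k: "k \<ge> 1"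
    and xy: "(x, y) \<in> E"
    and F: "\<And>a b. (a, b) \<in> F \<Longrightarrow> (a, b) \<in> E \<and> (a, y) \<in> E \<and> a \<noteq> x \<and> (x, b) \<in> E \<and> b \<noteq> y"
  shows "\<not> (\<exists>g. theta_copy F k t g)"
proof
  assume "\<exists>g. theta_copy F k t g"
  then obtain g where inj: "inj_on g (verts (theta k t))"
    and adj: "\<And>i j. i < t \<Longrightarrow> j < k \<Longrightarrow> (g (theta_pos k i j), g (theta_pos k i (Suc j))) \<in> F \<union> F\<inverse>"
    unfolding theta_copy_def by blast
  have "F \<subseteq> E" using F by auto
  then have FE: "F \<union> F\<inverse> \<subseteq> E \<union> E\<inverse>" by blast
  define src where "src \<longleftrightarrow> g Source \<in> U"
  have flip: "(p \<in> U) \<noteq> (q \<in> U)" if "(p, q) \<in> F \<union> F\<inverse>" for p q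
    using that FE E by blast
  have side: "g (theta_pos k i j) \<in> U \<longleftrightarrow> even j = src" if "i < t" "j \<le> k" for i j
    using that(2)
  proof (induction j)
    case 0 then show ?case by (simp add: theta_pos_def src_def)
  next
    case (Suc j) then show ?case using flip[OF adj[OF that(1), of j]] by auto
  qed
  \<comment> \<open>Every vertex of the theta is an end of an edge in \<open>F\<close>, so the
    hypotheses on \<open>F\<close> apply to it.\<close>
  have field: "\<exists>q. (g (theta_pos k i j), q) \<in> F \<union> F\<inverse>" if "i < t" "j \<le> k" for i j
  proof (cases j)
    case 0 then show ?thesis using adj[OF that(1), of 0] k by auto
  next
    case (Suc j') then show ?thesis using adj[OF that(1), of j'] that(2) by auto
  qed
  have xyUV: "x \<in> U" "y \<in> V" "x \<notin> V" "y \<notin> U" using xy E by blast+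
  have inU: "(g (theta_pos k i j), y) \<in> E \<and> g (theta_pos k i j) \<noteq> x" if "i < t" "j \<le> k" "even j = src" for i j
    using field[OF that(1,2)] side[OF that(1,2)] that(3) F E by blast
  have inV: "(x, g (theta_pos k i j)) \<in> E \<and> g (theta_pos k i j) \<noteq> y" if "i < t" "j \<le> k" "even j \<noteq> src" for i j
    using field[OF that(1,2)] side[OF that(1,2)] that(3) F E by blast
  have ne: "g v \<noteq> x \<and> g v \<noteq> y" if v: "v \<in> verts (theta k t)" for v
  proof -
    obtain i j where ij: "v = theta_pos k i j" "i < t" "j \<le> k" using v by (auto simp: theta_def)
    show ?thesis
    proof (cases "even j = src")
      case True then show ?thesis using inU[OF ij(2,3) True] side[OF ij(2,3)] xyUV ij(1) by auto
    next
      case False then show ?thesis using inV[OF ij(2,3) False] side[OF ij(2,3)] xyUV ij(1) by auto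
    qed
  qed
  define \<phi> where "\<phi> u = (case u of E_vertex.X \<Rightarrow> if src then y else x
    | E_vertex.Y \<Rightarrow> if src then x else y | Theta v \<Rightarrow> g v)" for u
  have "x \<noteq> y" using xyUV by auto
  have "inj_on \<phi> (verts (E_plus k t))"
  proof (rule inj_onI)
    fix u v assume "u \<in> verts (E_plus k t)" "v \<in> verts (E_plus k t)" "\<phi> u = \<phi> v"
    then show "u = v"
      using ne \<open>x \<noteq> y\<close> inj
      by (cases u; cases v) (auto simp: \<phi>_def E_plus_def E_graph_def inj_on_def split: if_splits)
  qed
  moreover have "(\<phi> u, \<phi> v) \<in> E \<union> E\<inverse>" if "{u, v} \<in> edges (E_plus k t)" for u v
    using that
  proof (rule E_plus_edge_cases)
    show "(\<phi> E_vertex.X, \<phi> E_vertex.Y) \<in> E \<union> E\<inverse>" using xy by (simp add: \<phi>_def)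
    show "(\<phi> E_vertex.X, \<phi> (Theta (theta_pos k i j))) \<in> E \<union> E\<inverse>" if "i < t" "j \<le> k" "even j" for i j
      using inU[OF that(1,2)] inV[OF that(1,2)] that(3) by (auto simp: \<phi>_def)
    show "(\<phi> E_vertex.Y, \<phi> (Theta (theta_pos k i j))) \<in> E \<union> E\<inverse>" if "i < t" "j \<le> k" "odd j" for i j
      using inU[OF that(1,2)] inV[OF that(1,2)] that(3) by (auto simp: \<phi>_def)
    show "(\<phi> (Theta (theta_pos k i j)), \<phi> (Theta (theta_pos k i (Suc j)))) \<in> E \<union> E\<inverse>" if "i < t" "j < k" for i j
      using adj[OF that] FE by (auto simp: \<phi>_def)
  qed auto
  ultimately show False using free unfolding E_plus_free_def by blast
qed

lemma embedding_contains_copy: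
  assumes H: "simple_graph H" and \<phi>: "inj_on \<phi> (verts H)" "\<phi> ` verts H \<subseteq> verts G"
    and edge: "\<And>u v. u \<in> verts H \<Longrightarrow> v \<in> verts H \<Longrightarrow> {u, v} \<in> edges H \<Longrightarrow> {\<phi> u, \<phi> v} \<in> edges G"
  shows "contains_copy G H"
proof -
  define C where "C = Graph (\<phi> ` verts H) ((`) \<phi> ` edges H)"
  have sub: "e \<subseteq> verts H" "card e = 2" if "e \<in> edges H" for e
    using H that by (auto simp: simple_graph_def)
  have "simple_graph C"
    unfolding simple_graph_def C_def graph.sel
  proof (intro conjI ballI)
    show "finite (\<phi> ` verts H)" using H by (simp add: simple_graph_def)
    fix e assume "e \<in> (`) \<phi> ` edges H"
    then obtain e' where e': "e' \<in> edges H" "e = \<phi> ` e'" by blast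
    show "e \<subseteq> \<phi> ` verts H" using e' sub(1)[OF e'(1)] by blast
    show "card e = 2" using card_image[OF inj_on_subset[OF \<phi>(1) sub(1)[OF e'(1)]]] sub(2) e' by simp
  qed
  moreover have "edges C \<subseteq> edges G"
  proof
    fix e assume "e \<in> edges C"
    then obtain e' where e': "e' \<in> edges H" "e = \<phi> ` e'" by (auto simp: C_def)
    obtain u v where uv: "e' = {u, v}" using sub(2)[OF e'(1)] by (auto simp: card_2_iff)
    show "e \<in> edges G" using edge[of u v] sub(1)[OF e'(1)] e' uv by simp
  qed
  moreover have "isomorphic C H"
  proof -
    let ?f = "inv_into (verts H) \<phi>"
    have "bij_betw \<phi> (verts H) (verts C)" using \<phi>(1) by (simp add: C_def bij_betw_def)
    then have "bij_betw ?f (verts C) (verts H)" by (rule bij_betw_inv_into)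
    moreover have "{\<phi> u, \<phi> v} \<in> edges C \<longleftrightarrow> {u, v} \<in> edges H" if "u \<in> verts H" "v \<in> verts H" for u v
    proof
      assume "{\<phi> u, \<phi> v} \<in> edges C"
      then obtain e where e: "e \<in> edges H" "\<phi> ` e = \<phi> ` {u, v}" by (auto simp: C_def)
      have "e = {u, v}" using inj_on_image_eq_iff[OF \<phi>(1) sub(1)[OF e(1)], of "{u, v}"] e(2) that by simp
      then show "{u, v} \<in> edges H" using e(1) by simp
    next
      assume "{u, v} \<in> edges H"
      from imageI[OF this, of "(`) \<phi>"] show "{\<phi> u, \<phi> v} \<in> edges C" by (simp add: C_def)
    qed
    ultimately show ?thesis
      unfolding isomorphic_def using \<phi>(1) by (intro exI[of _ ?f]) (auto simp: C_def)
  qed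
  ultimately show ?thesis
    unfolding contains_copy_def subgraph_def using \<phi>(2) by (intro exI[of _ C]) (auto simp: C_def)
qed

section \<open>Cuts, convexity and four-cycles\<close>

text \<open>Vertices join one by one the side on which they gain more crossing edges. The left side
  counts every edge in both orders and the right side only once, which turns the usual factor 2 into
  4.\<close>

lemma large_cut:
  assumes "finite W" and sym: "\<And>x y. R x y \<Longrightarrow> R y x" and irr: "\<And>x. \<not> R x x"
  shows "\<exists>U\<subseteq>W. card {(x, y). x \<in> W \<and> y \<in> W \<and> R x y} \<le> 4 * card {(x, y). x \<in> U \<and> y \<in> W - U \<and> R x y}"
  using assms(1)
proof (induction W rule: finite_induct)
  case empty
  then show ?case by simp
next
  case (insert v W)
  then obtain U where U: "U \<subseteq> W"
    "card {(x, y). x \<in> W \<and> y \<in> W \<and> R x y} \<le> 4 * card {(x, y). x \<in> U \<and> y \<in> W - U \<and> R x y}" by blast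
  define N1 where "N1 = {u \<in> U. R v u}"
  define N2 where "N2 = {u \<in> W - U. R v u}"
  have fin: "finite N1" "finite N2" using U(1) insert.hyps(1) by (auto simp: N1_def N2_def intro: finite_subset)
  have finp: "finite {(x, y). x \<in> A \<and> y \<in> B \<and> R x y}" if "finite A" "finite B" for A B :: "'a set"
    by (rule finite_subset[of _ "A \<times> B"]) (use that in auto)
  have finU: "finite U" using U(1) insert.hyps(1) finite_subset by blast
  let ?M = "{(x, y). x \<in> W \<and> y \<in> W \<and> R x y}" and ?c = "{(x, y). x \<in> U \<and> y \<in> W - U \<and> R x y}"
  have "{(x, y). x \<in> insert v W \<and> y \<in> insert v W \<and> R x y} \<subseteq> ?M \<union> (Pair v ` (N1 \<union> N2) \<union> (\<lambda>u. (u, v)) ` (N1 \<union> N2))"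
    using sym irr by (auto simp: N1_def N2_def)
  then have "card {(x, y). x \<in> insert v W \<and> y \<in> insert v W \<and> R x y}
      \<le> card (?M \<union> (Pair v ` (N1 \<union> N2) \<union> (\<lambda>u. (u, v)) ` (N1 \<union> N2)))"
    by (rule card_mono[rotated]) (use fin finp insert.hyps in simp)
  also have "\<dots> \<le> card ?M + (card (Pair v ` (N1 \<union> N2)) + card ((\<lambda>u. (u, v)) ` (N1 \<union> N2)))"
    by (intro order_trans[OF card_Un_le] add_left_mono card_Un_le)
  also have "\<dots> \<le> card ?M + (card (N1 \<union> N2) + card (N1 \<union> N2))"
    by (intro add_left_mono add_mono card_image_le) (use fin in auto)
  also have "\<dots> \<le> 4 * card ?c + ((card N1 + card N2) + (card N1 + card N2))"
    by (intro add_mono U(2) card_Un_le)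
  also have "\<dots> = 4 * card ?c + 2 * (card N1 + card N2)" by simp
  finally have main: "card {(x, y). x \<in> insert v W \<and> y \<in> insert v W \<and> R x y} \<le> 4 * card ?c + 2 * (card N1 + card N2)" .
  show ?case
  proof (cases "card N1 \<le> card N2")
    case True
    have "card (?c \<union> Pair v ` N2) \<le> card {(x, y). x \<in> insert v U \<and> y \<in> insert v W - insert v U \<and> R x y}"
      by (rule card_mono) (use finp[of "insert v U" "insert v W - insert v U"] finU insert.hyps in \<open>auto simp: N2_def\<close>)
    moreover have "card (?c \<union> Pair v ` N2) = card ?c + card N2"
    proof -
      have "card (?c \<union> Pair v ` N2) = card ?c + card (Pair v ` N2)"
        by (rule card_Un_disjoint) (use finp[of U "W - U"] finU fin insert.hyps U(1) in auto)
      also have "card (Pair v ` N2) = card N2" by (rule card_image) (simp add: inj_on_def)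
      finally show ?thesis .
    qed
    ultimately show ?thesis
      using main True U(1) by (intro exI[of _ "insert v U"]) auto
  next
    case False
    have "card (?c \<union> (\<lambda>u. (u, v)) ` N1) \<le> card {(x, y). x \<in> U \<and> y \<in> insert v W - U \<and> R x y}"
      by (rule card_mono)
        (use finp[of U "insert v W - U"] finU insert.hyps U(1) sym in \<open>auto simp: N1_def\<close>)
    moreover have "card (?c \<union> (\<lambda>u. (u, v)) ` N1) = card ?c + card N1"
    proof -
      have "card (?c \<union> (\<lambda>u. (u, v)) ` N1) = card ?c + card ((\<lambda>u. (u, v)) ` N1)"
        by (rule card_Un_disjoint) (use finp[of U "W - U"] finU fin insert.hyps in auto)
      also have "card ((\<lambda>u. (u, v)) ` N1) = card N1" by (rule card_image) (simp add: inj_on_def)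
      finally show ?thesis .
    qed
    ultimately show ?thesis
      using main False U(1) by (intro exI[of _ U]) auto
  qed
qed

text \<open>Cauchy-Schwarz, from expanding the sum of the squares of
  \<open>c * f i - s\<close>.\<close>

lemma sum_power2_le_card_mult:
  fixes f :: "'b \<Rightarrow> real"
  assumes "finite I"
  shows "(\<Sum>i\<in>I. f i)\<^sup>2 \<le> card I * (\<Sum>i\<in>I. (f i)\<^sup>2)"
proof (cases "I = {}")
  case False
  define s where "s = (\<Sum>i\<in>I. f i)"
  define c where "c = real (card I)"
  have c: "c > 0" using assms False by (simp add: c_def card_gt_0_iff)
  have "0 \<le> (\<Sum>i\<in>I. (c * f i - s)\<^sup>2)" by (rule sum_nonneg) simp
  also have "\<dots> = (\<Sum>i\<in>I. c\<^sup>2 * (f i)\<^sup>2 - 2 * c * s * f i + s\<^sup>2)"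
    by (rule sum.cong[OF refl]) (simp add: power2_diff power_mult_distrib)
  also have "\<dots> = c\<^sup>2 * (\<Sum>i\<in>I. (f i)\<^sup>2) - 2 * c * s * s + c * s\<^sup>2"
    by (simp add: sum.distrib sum_subtractf sum_distrib_left[symmetric] c_def s_def)
  also have "\<dots> = c * (c * (\<Sum>i\<in>I. (f i)\<^sup>2) - s\<^sup>2)"
    by (simp add: algebra_simps power2_eq_square)
  finally show ?thesis using c by (simp add: zero_le_mult_iff s_def c_def)
qed simp

lemma blocks_exist:
  assumes "finite N" "m > 0"
  shows "\<exists>bl :: 'v \<Rightarrow> nat. (\<forall>y\<in>N. bl y \<le> card N div m) \<and> (\<forall>i. card {y \<in> N. bl y = i} \<le> m)"
proof -
  obtain h where h: "bij_betw h N {..<card N}"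
    using ex_bij_betw_finite_nat[OF assms(1)] by (auto simp: atLeast0LessThan)
  have "card {y \<in> N. h y div m = i} \<le> m" for i
  proof -
    have "h ` {y \<in> N. h y div m = i} \<subseteq> {i * m..<i * m + m}"
    proof
      fix z assume "z \<in> h ` {y \<in> N. h y div m = i}"
      then have "z div m = i" by auto
      then show "z \<in> {i * m..<i * m + m}"
        using assms(2) div_mult_mod_eq[of z m] mod_less_divisor[OF assms(2), of z] by auto
    qed
    moreover have "inj_on h {y \<in> N. h y div m = i}" using h by (auto simp: bij_betw_def inj_on_def)
    ultimately have "card {y \<in> N. h y div m = i} \<le> card {i * m..<i * m + m}"
      by (intro card_inj_on_le) auto
    then show ?thesis by simp
  qed
  moreover have "h y div m \<le> card N div m" if "y \<in> N" for y
    using bij_betwE[OF h] that by (intro div_le_mono) (simp add: less_imp_le)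
  ultimately show ?thesis by (intro exI[of _ "\<lambda>y. h y div m"]) auto
qed

text \<open>The four-cycles \<open>x y x' b\<close> counted are those in which \<open>y\<close> and \<open>b\<close> lie in the same block
  of the neighbourhood of \<open>x\<close>: splitting the neighbourhoods into blocks of size about \<open>d\<close> removes
  the need for bounded degrees on the side of \<open>U\<close>.\<close>
lemma one_sided_cycle_count:
  fixes d :: real and n :: nat
  assumes E: "E \<subseteq> U \<times> V" "U \<inter> V = {}" "finite U" "finite V" and free: "E_plus_free E k t"
    and t: "t \<ge> 1" and k: "k \<ge> 1" and n: "card U + card V \<le> n" "n \<ge> 1"
    and d: "d \<ge> 12" "72 * real n \<le> d\<^sup>2"
    and cardE: "d * n / 3 \<le> card E" "card E \<le> d * n"
    and deg: "\<And>y. card {x. (x, y) \<in> E} \<le> 8 * d"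
    and \<rho>: "10 * d < real (\<rho> ^ k)" and D: "D = (2 * (Suc t * Suc k)) ^ k"
  shows "d\<^sup>2 \<le> 8640 * n * (D * (\<rho> + 3))"
proof -
  have n0: "real n > 0" using n(2) by simp
  have finE: "finite E" using E finite_subset by blast
  \<comment> \<open>The block size is at least \<open>d\<close>, which keeps the number of blocks
    below \<open>2 * n\<close>, and at most \<open>2 * d\<close>, which keeps the links
    small.\<close>
  define m where "m = nat \<lceil>d\<rceil>"
  have m: "m > 0" "d \<le> real m" "real m \<le> 2 * d" using d(1) by (auto simp: m_def; linarith)+
  define N where "N x = {y. (x, y) \<in> E}" for x
  have NV: "N x \<subseteq> V" for x using E(1) by (auto simp: N_def)
  have finN: "finite (N x)" for x using NV E(4) finite_subset by blast
  have "\<exists>bl :: 'a \<Rightarrow> nat. (\<forall>y\<in>N x. bl y \<le> card (N x) div m) \<and> (\<forall>i. card {y \<in> N x. bl y = i} \<le> m)" for x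
    by (rule blocks_exist[OF finN m(1)])
  then obtain bl :: "'a \<Rightarrow> 'a \<Rightarrow> nat" where
    bl: "\<And>x y. y \<in> N x \<Longrightarrow> bl x y \<le> card (N x) div m" "\<And>x i. card {y \<in> N x. bl x y = i} \<le> m"
    by metis
  \<comment> \<open>The pair \<open>(x, i)\<close> names the \<open>i\<close>-th block at
    \<open>x\<close>; it acts as a copy of \<open>x\<close> whose degree is at most
    \<open>m\<close>.\<close>
  define P where "P = (SIGMA x:U. {..card (N x) div m})"
  define B where "B p = {y \<in> N (fst p). bl (fst p) y = snd p}" for p
  have finP: "finite P" using E(3) by (simp add: P_def)
  have finB: "finite (B p)" for p using finN by (simp add: B_def)
  have Esig: "E = (SIGMA x:U. N x)" using E(1) by (auto simp: N_def)
  have cardEN: "card E = (\<Sum>x\<in>U. card (N x))" using E(3) finN by (subst Esig) simp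
  have cardP: "card P \<le> 2 * real n"
  proof -
    have "real (card P) = (\<Sum>x\<in>U. real (card (N x) div m) + 1)"
      using E(3) by (simp add: P_def add.commute)
    also have "\<dots> \<le> (\<Sum>x\<in>U. real (card (N x)) / d + 1)"
    proof (intro sum_mono add_right_mono)
      fix x
      have "real (card (N x) div m) \<le> real (card (N x)) / real m" by (rule of_nat_div_le_of_nat)
      also have "\<dots> \<le> real (card (N x)) / d" using m d(1) by (intro divide_left_mono) auto
      finally show "real (card (N x) div m) \<le> real (card (N x)) / d" .
    qed
    also have "\<dots> = real (card E) / d + card U"
      by (simp add: sum.distrib sum_divide_distrib[symmetric] cardEN)
    also have "real (card E) / d \<le> n" using cardE(2) d(1) by (simp add: divide_le_eq mult.commute)
    finally show ?thesis using n by linarith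
  qed
  have EP: "E = (\<lambda>(p, y). (fst p, y)) ` (SIGMA p:P. B p)"
    using bl(1) unfolding Esig by (force simp: P_def B_def image_iff)
  have injEP: "inj_on (\<lambda>(p, y). (fst p, y)) (SIGMA p:P. B p)"
    by (auto simp: inj_on_def B_def)
  define Same where "Same x y b \<longleftrightarrow> (x, y) \<in> E \<and> (x, b) \<in> E \<and> bl x y = bl x b \<and> y \<noteq> b" for x y b
  define S where "S = {(x, y, b). Same x y b}"
  have finS: "finite S"
    by (rule finite_subset[of _ "U \<times> V \<times> V"]) (use E in \<open>auto simp: S_def Same_def\<close>)
  define e where "e = real (card E)"
  define s where "s = real (card S)"
  have e_sum: "e = (\<Sum>p\<in>P. real (card (B p)))"
  proof -
    have "card E = card (SIGMA p:P. B p)" by (subst EP) (rule card_image[OF injEP])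
    then show ?thesis using finP finB by (simp add: e_def)
  qed
  \<comment> \<open>The pairs with \<open>y = b\<close>, which \<open>S\<close> excludes, contribute
    the summand \<open>e\<close>.\<close>
  have s_sum: "s + e = (\<Sum>p\<in>P. (real (card (B p)))\<^sup>2)"
  proof -
    have "S \<union> (\<lambda>(x, y). (x, y, y)) ` E = (\<lambda>(p, y, b). (fst p, y, b)) ` (SIGMA p:P. B p \<times> B p)" (is "?l = ?r")
    proof
      show "?l \<subseteq> ?r"
      proof
        fix q assume "q \<in> ?l"
        then obtain x y b where q: "q = (x, y, b)" "(x, y) \<in> E" "(x, b) \<in> E" "bl x y = bl x b"
          by (auto simp: S_def Same_def)
        then have "((x, bl x y), y, b) \<in> (SIGMA p:P. B p \<times> B p)"
          using E(1) bl(1)[of y x] by (auto simp: P_def B_def N_def)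
        from imageI[OF this, of "\<lambda>(p, y, b). (fst p, y, b)"] show "q \<in> ?r" using q(1) by simp
      qed
      show "?r \<subseteq> ?l" by (auto simp: S_def Same_def B_def N_def image_iff)
    qed
    moreover have "inj_on (\<lambda>(p, y, b). (fst p, y, b)) (SIGMA p:P. B p \<times> B p)"
      by (auto simp: inj_on_def B_def)
    ultimately have "card (S \<union> (\<lambda>(x, y). (x, y, y)) ` E) = card (SIGMA p:P. B p \<times> B p)"
      by (simp only: card_image)
    moreover have "card (S \<union> (\<lambda>(x, y). (x, y, y)) ` E) = card S + card ((\<lambda>(x, y). (x, y, y)) ` E)"
      by (rule card_Un_disjoint) (use finS finE in \<open>auto simp: S_def Same_def\<close>)
    moreover have "card ((\<lambda>(x, y). (x, y, y)) ` E) = card E"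
      by (rule card_image) (auto simp: inj_on_def)
    moreover have "card (SIGMA p:P. B p \<times> B p) = (\<Sum>p\<in>P. (card (B p))\<^sup>2)"
      using finP finB by (simp add: card_cartesian_product power2_eq_square)
    ultimately have "card S + card E = (\<Sum>p\<in>P. (card (B p))\<^sup>2)" by simp
    then have "real (card S + card E) = real (\<Sum>p\<in>P. (card (B p))\<^sup>2)" by simp
    then show ?thesis by (simp add: s_def e_def)
  qed
  have s_low: "e\<^sup>2 \<le> 2 * n * (s + e)"
  proof -
    have "e\<^sup>2 \<le> card P * (s + e)" unfolding e_sum s_sum[unfolded e_sum] by (rule sum_power2_le_card_mult[OF finP])
    also have "\<dots> \<le> 2 * n * (s + e)" using cardP by (intro mult_right_mono) (auto simp: s_def e_def)
    finally show ?thesis .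
  qed
  define p where "p yb = real (card {x. Same x (fst yb) (snd yb)})" for yb
  define Q where "Q = {(x, x', y, b). Same x y b \<and> Same x' y b \<and> x' \<noteq> x}"
  have finSame: "finite {x. Same x y b}" for y b
    by (rule finite_subset[OF _ E(3)]) (use E(1) in \<open>auto simp: Same_def\<close>)
  have finQ: "finite Q"
    by (rule finite_subset[of _ "U \<times> U \<times> V \<times> V"]) (use E in \<open>auto simp: Q_def Same_def\<close>)
  have s_p: "s = (\<Sum>yb\<in>V \<times> V. p yb)"
  proof -
    have "S = (\<lambda>(yb, x). (x, fst yb, snd yb)) ` (SIGMA yb:V \<times> V. {x. Same x (fst yb) (snd yb)})"
      using E(1) by (force simp: S_def Same_def image_iff)
    moreover have "inj_on (\<lambda>(yb, x). (x, fst yb, snd yb)) (SIGMA yb:V \<times> V. {x. Same x (fst yb) (snd yb)})"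
      by (auto simp: inj_on_def)
    ultimately have "card S = card (SIGMA yb:V \<times> V. {x. Same x (fst yb) (snd yb)})"
      by (simp only: card_image)
    then show ?thesis using E(4) finSame by (simp add: s_def p_def)
  qed
  \<comment> \<open>Likewise the degenerate cycles with \<open>x = x'\<close> contribute the summand
    \<open>s\<close>.\<close>
  have q_p: "real (card Q) + s = (\<Sum>yb\<in>V \<times> V. (p yb)\<^sup>2)"
  proof -
    have "Q \<union> (\<lambda>(x, y, b). (x, x, y, b)) ` S = (\<lambda>(yb, x, x'). (x, x', fst yb, snd yb)) `
        (SIGMA yb:V \<times> V. {x. Same x (fst yb) (snd yb)} \<times> {x. Same x (fst yb) (snd yb)})" (is "?l = ?r")
    proof
      show "?l \<subseteq> ?r"
      proof
        fix q assume "q \<in> ?l"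
        then obtain x x' y b where q: "q = (x, x', y, b)" "Same x y b" "Same x' y b"
          by (auto simp: S_def Q_def)
        then have "((y, b), x, x') \<in> (SIGMA yb:V \<times> V. {x. Same x (fst yb) (snd yb)} \<times> {x. Same x (fst yb) (snd yb)})"
          using E(1) by (auto simp: Same_def)
        from imageI[OF this, of "\<lambda>(yb, x, x'). (x, x', fst yb, snd yb)"] show "q \<in> ?r" using q(1) by simp
      qed
      show "?r \<subseteq> ?l" by (auto simp: S_def Q_def image_iff)
    qed
    moreover have "inj_on (\<lambda>(yb, x, x'). (x, x', fst yb, snd yb))
        (SIGMA yb:V \<times> V. {x. Same x (fst yb) (snd yb)} \<times> {x. Same x (fst yb) (snd yb)})"
      by (auto simp: inj_on_def)
    ultimately have "card (Q \<union> (\<lambda>(x, y, b). (x, x, y, b)) ` S) =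
        card (SIGMA yb:V \<times> V. {x. Same x (fst yb) (snd yb)} \<times> {x. Same x (fst yb) (snd yb)})"
      by (simp only: card_image)
    moreover have "card (Q \<union> (\<lambda>(x, y, b). (x, x, y, b)) ` S) = card Q + card ((\<lambda>(x, y, b). (x, x, y, b)) ` S)"
      by (rule card_Un_disjoint) (use finS finQ in \<open>auto simp: Q_def\<close>)
    moreover have "card ((\<lambda>(x, y, b). (x, x, y, b)) ` S) = card S"
      by (rule card_image) (auto simp: inj_on_def)
    ultimately have "card Q + card S = (\<Sum>yb\<in>V \<times> V. (card {x. Same x (fst yb) (snd yb)})\<^sup>2)"
      using E(4) finSame by (simp add: card_cartesian_product power2_eq_square)
    then have "real (card Q + card S) = real (\<Sum>yb\<in>V \<times> V. (card {x. Same x (fst yb) (snd yb)})\<^sup>2)" by simp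
    then show ?thesis by (simp add: s_def p_def)
  qed
  have q_low: "s\<^sup>2 \<le> (real n)\<^sup>2 * (card Q + s)"
  proof -
    have "s\<^sup>2 \<le> card (V \<times> V) * (card Q + s)"
      unfolding q_p unfolding s_p by (rule sum_power2_le_card_mult) (simp add: E(4))
    also have "\<dots> \<le> (real n)\<^sup>2 * (card Q + s)"
    proof (rule mult_right_mono)
      have "real (card V) \<le> real n" using n by simp
      then show "real (card (V \<times> V)) \<le> (real n)\<^sup>2"
        by (simp add: card_cartesian_product power2_eq_square mult_mono)
    qed (simp add: s_def)
    finally show ?thesis .
  qed
  \<comment> \<open>Bounds the edges of one restricted link, whose vertices are up to
    \<open>8 * d\<close> neighbours of \<open>y\<close> and up to \<open>2 * d\<close> members of a
    block.\<close>
  define M where "M = real (D * (\<rho> + 3)) * (10 * d)"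
  have q_up: "card Q \<le> e * M"
  proof -
    define Fl where "Fl xy = {(a, b). (a, b) \<in> E \<and> (a, snd xy) \<in> E \<and> a \<noteq> fst xy \<and> b \<in> B (fst xy, bl (fst xy) (snd xy)) \<and> b \<noteq> snd xy}" for xy
    have finF: "finite (Fl xy)" for xy by (rule finite_subset[OF _ finE]) (auto simp: Fl_def)
    have "Q \<subseteq> (\<lambda>((x, y), (a, b)). (x, a, y, b)) ` (SIGMA xy:E. Fl xy)"
    proof
      fix q assume "q \<in> Q"
      then obtain x x' y b where q: "q = (x, x', y, b)" "Same x y b" "Same x' y b" "x' \<noteq> x" by (auto simp: Q_def)
      then have "((x, y), (x', b)) \<in> (SIGMA xy:E. Fl xy)" by (auto simp: Fl_def Same_def B_def N_def)
      from imageI[OF this, of "\<lambda>((x, y), (a, b)). (x, a, y, b)"]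
      show "q \<in> (\<lambda>((x, y), (a, b)). (x, a, y, b)) ` (SIGMA xy:E. Fl xy)" using q(1) by simp
    qed
    then have "card Q \<le> card ((\<lambda>((x, y), (a, b)). (x, a, y, b)) ` (SIGMA xy:E. Fl xy))"
      by (rule card_mono[rotated]) (use finE finF in auto)
    also have "\<dots> \<le> card (SIGMA xy:E. Fl xy)" by (rule card_image_le) (use finE finF in auto)
    also have "\<dots> = (\<Sum>xy\<in>E. card (Fl xy))" using finE finF by simp
    finally have "real (card Q) \<le> (\<Sum>xy\<in>E. real (card (Fl xy)))" by (metis of_nat_le_iff of_nat_sum)
    also have "\<dots> \<le> (\<Sum>xy\<in>E. M)"
    proof (rule sum_mono)
      fix xy assume xy: "xy \<in> E"
      obtain x y where xy_def: "xy = (x, y)" by (cases xy)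
      let ?A = "{a. (a, y) \<in> E}" and ?B = "B (x, bl x y)"
      have "card ?B \<le> 2 * d" using bl(2)[of x "bl x y"] m(3) by (simp add: B_def)
      then have AB: "real (card ?A + card ?B) \<le> 10 * d" using deg[of y] by simp
      then have small: "card ?A + card ?B < \<rho> ^ k" using \<rho> by linarith
      have fl_free: "\<not> (\<exists>g. theta_copy (Fl xy) k t g)"
        by (rule link_no_theta[OF E(1,2) free t k, of x y]) (use xy xy_def in \<open>auto simp: Fl_def B_def N_def\<close>)
      have "card (Fl xy) \<le> D * (\<rho> + 3) * (card ?A + card ?B)"
        by (rule theta_free_card_le[OF _ _ _ finB D small k fl_free])
          (use E finite_subset[OF _ E(3), of ?A] in \<open>auto simp: Fl_def xy_def B_def N_def\<close>)
      then have "real (card (Fl xy)) \<le> real (D * (\<rho> + 3)) * real (card ?A + card ?B)"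
        by (metis of_nat_le_iff of_nat_mult)
      also have "\<dots> \<le> M" unfolding M_def using AB by (intro mult_left_mono) auto
      finally show "real (card (Fl xy)) \<le> M" .
    qed
    also have "\<dots> = e * M" by (simp add: e_def)
    finally show ?thesis .
  qed
  have e: "d * n / 3 \<le> e" "e \<le> d * n" using cardE by (simp_all add: e_def)
  have epos: "e > 0" using e(1) d(1) n0 by (smt (verit) divide_pos_pos mult_pos_pos)
  \<comment> \<open>Convexity gives \<open>s + e \<ge> e * d / 6\<close>, and
    \<open>d \<ge> 12\<close> lets half of it absorb the degenerate summand
    \<open>e\<close>.\<close>
  have s1: "e * d / 12 \<le> s"
  proof -
    have "e * (d * n / 3) \<le> e * e" using e epos by (intro mult_left_mono) auto
    then have "2 * n * (s + e) \<ge> e * (d * n / 3)" using s_low by (simp add: power2_eq_square)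
    then have "real n * (2 * (s + e)) \<ge> real n * (e * d / 3)" by (simp add: mult_ac)
    then have "2 * (s + e) \<ge> e * d / 3" using n0 by (simp only: mult_le_cancel_left_pos)
    moreover have "e * 12 \<le> e * d" using d(1) epos by (intro mult_left_mono) auto
    ultimately show ?thesis by simp
  qed
  \<comment> \<open>With \<open>s\<close> this large, the degenerate cycles account for at most half
    of \<open>s * s\<close> in \<open>q_low\<close>.\<close>
  have s2: "s \<ge> 2 * (real n)\<^sup>2"
  proof -
    have "2 * (real n)\<^sup>2 = real n * (72 * n) / 36" by (simp add: power2_eq_square)
    also have "\<dots> \<le> real n * d\<^sup>2 / 36" using d(2) by (intro divide_right_mono mult_left_mono) auto
    also have "\<dots> = (d * n / 3) * d / 12" by (simp add: power2_eq_square)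
    also have "\<dots> \<le> e * d / 12" using e(1) d(1) by (intro divide_right_mono mult_right_mono) auto
    finally show ?thesis using s1 by linarith
  qed
  have spos: "s > 0" using s1 epos d(1) by (smt (verit) divide_pos_pos mult_pos_pos)
  have "s * s \<le> 2 * (real n)\<^sup>2 * card Q"
  proof -
    have "s * (2 * (real n)\<^sup>2) \<le> s * s" using s2 spos by (intro mult_left_mono) auto
    then have "2 * ((real n)\<^sup>2 * s) \<le> s * s" by (simp add: mult_ac)
    then show ?thesis using q_low by (simp add: power2_eq_square[of s] distrib_left)
  qed
  then have "s * s \<le> 2 * (real n)\<^sup>2 * (e * M)"
    by (rule order_trans) (intro mult_left_mono q_up, simp)
  moreover have "(e * d / 12) * (e * d / 12) \<le> s * s"
    using s1 epos d(1) spos by (intro mult_mono) auto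
  moreover have "(d * n / 3) * (e * d\<^sup>2 / 144) \<le> e * (e * d\<^sup>2 / 144)"
    using e epos by (intro mult_right_mono) auto
  ultimately have "(d * n / 3) * (e * d\<^sup>2 / 144) \<le> 2 * (real n)\<^sup>2 * (e * M)"
    by (simp add: power2_eq_square mult_ac)
  \<comment> \<open>8640 = 3 * 144 * 2 * 10: from the lower bound on \<open>e\<close>, the square of
    \<open>s1\<close>, the halving, and \<open>M\<close>.\<close>
  then have "(e * n * d) * d\<^sup>2 \<le> (e * n * d) * (8640 * n * (D * (\<rho> + 3)))"
    by (simp add: M_def power2_eq_square field_simps)
  moreover have "e * n * d > 0" using epos n0 d(1) by simp
  ultimately show ?thesis by (simp only: mult_le_cancel_left_pos)
qed

text \<open>With \<open>\<rho>\<close> the least integer above \<open>z\<close>, the k-th root of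
  \<open>10 * d\<close>, the hypothesis becomes d ^ (2 - 1 / k) = O(n). As
  \<open>\<rho> + 3 \<le> 5 * z\<close> and \<open>z\<close> is at most 10 times the k-th root of
  \<open>d\<close>, the constant is 8640 * 5 * 10 = 432000.\<close>

lemma cycle_count_exponent:
  fixes d n :: real
  assumes k: "k \<ge> 2" and d: "d \<ge> 12" and n: "n > 0" and D: "D \<ge> 1"
    and le: "\<And>\<rho>. 10 * d < real (\<rho> ^ k) \<Longrightarrow> d\<^sup>2 \<le> 8640 * n * (real D * (real \<rho> + 3))"
  shows "d \<le> (432000 * real D * n) powr (real k / (2 * real k - 1))"
proof -
  define z where "z = (10 * d) powr (1 / k)"
  define \<rho> where "\<rho> = nat \<lfloor>z\<rfloor> + 1"
  have z1: "z \<ge> 1" using d k by (simp add: z_def ge_one_powr_ge_zero)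
  have zk: "z ^ k = 10 * d"
  proof -
    have "z ^ k = z powr real k" using z1 by (simp add: powr_realpow)
    also have "\<dots> = 10 * d" using k d by (simp add: z_def powr_powr)
    finally show ?thesis .
  qed
  have \<rho>: "z < real \<rho>" "real \<rho> \<le> z + 1" using z1 by (auto simp: \<rho>_def; linarith)+
  have "10 * d < real (\<rho> ^ k)"
    using power_strict_mono[OF \<rho>(1), of k] z1 k zk by simp
  from le[OF this] have "d\<^sup>2 \<le> 8640 * n * (real D * (real \<rho> + 3))" .
  also have "\<dots> \<le> 8640 * n * (real D * (5 * z))"
    using \<rho>(2) z1 n by (intro mult_left_mono) auto
  also have "\<dots> \<le> 8640 * n * (real D * (5 * (10 * d powr (1 / k))))"
  proof -
    have "z = 10 powr (1 / k) * d powr (1 / k)" using d by (simp add: z_def powr_mult)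
    also have "\<dots> \<le> 10 powr 1 * d powr (1 / k)"
      using k by (intro mult_right_mono powr_mono) auto
    finally show ?thesis using n by (intro mult_left_mono) auto
  qed
  finally have "d powr 2 \<le> 432000 * real D * n * d powr (1 / k)"
    using d by (simp add: powr_numeral mult_ac)
  then have "d powr 2 / d powr (1 / k) \<le> 432000 * real D * n"
    using d by (simp add: divide_le_eq)
  then have "d powr (2 - 1 / k) \<le> 432000 * real D * n"
    by (simp add: powr_diff)
  then have "(d powr (2 - 1 / k)) powr (real k / (2 * real k - 1)) \<le> (432000 * real D * n) powr (real k / (2 * real k - 1))"
    using k by (intro powr_mono2) (auto intro!: divide_nonneg_nonneg)
  moreover have "(2 - 1 / real k) * (real k / (2 * real k - 1)) = 1"
    using k by (simp add: field_simps)
  ultimately have "d powr 1 \<le> (432000 * real D * n) powr (real k / (2 * real k - 1))"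
    by (simp only: powr_powr)
  then show ?thesis using d by simp
qed

text \<open>Suppose the bound fails, with \<open>d\<close> edges per vertex. At most
  \<open>n / 4\<close> vertices have degree above \<open>8 * d\<close>, and by induction at most a
  quarter of the edges run between two of them. Hence at least a third of the edges avoid the large
  degrees on one side, and \<open>one_sided_cycle_count\<close> for \<open>E1\<close> or for the
  converse of \<open>E2\<close> bounds \<open>d\<close>.\<close>

lemma E_plus_free_edge_bound:
  assumes k: "k \<ge> 2" and t: "t \<ge> 1"
  defines "\<gamma> \<equiv> (3 * real k - 1) / (2 * real k - 1)"
    and "C \<equiv> 432000 * real ((2 * (Suc t * Suc k)) ^ k)"
  shows "finite U \<Longrightarrow> finite V \<Longrightarrow> U \<inter> V = {} \<Longrightarrow> E \<subseteq> U \<times> V \<Longrightarrow> E_plus_free E k t \<Longrightarrow>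
    real (card E) \<le> C * real (card U + card V) powr \<gamma>"
proof (induction "card U + card V" arbitrary: U V E rule: less_induct)
  case less
  define D where "D = (2 * (Suc t * Suc k)) ^ k"
  define n where "n = card U + card V"
  define \<beta> where "\<beta> = real k / (2 * real k - 1)"
  have C: "C = 432000 * real D" by (simp add: C_def D_def)
  have D1: "D \<ge> 1" unfolding D_def by simp
  have C1: "C \<ge> 432000" using D1 by (simp add: C)
  have \<gamma>\<beta>: "\<gamma> = 1 + \<beta>" using k by (simp add: \<gamma>_def \<beta>_def field_simps)
  have \<beta>: "1 / 2 \<le> \<beta>" "\<beta> \<le> 1" using k by (simp_all add: \<beta>_def field_simps)
  have finE: "finite E" using less.prems finite_subset by blast
  have "real (card E) \<le> C * real n powr \<gamma>"
  proof (rule ccontr)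
    assume "\<not> ?thesis"
    then have gt: "C * real n powr \<gamma> < real (card E)" by simp
    have "0 \<le> C * real n powr \<gamma>" using C1 by simp
    then have "E \<noteq> {}" using gt by auto
    then have "U \<noteq> {}" using less.prems(4) by auto
    then have n1: "n \<ge> 1" using less.prems(1) by (simp add: n_def Suc_le_eq card_gt_0_iff)
    define d where "d = real (card E) / real n"
    have dn: "d * real n = real (card E)" using n1 by (simp add: d_def)
    have d_gt: "C * real n powr \<beta> < d"
    proof -
      have "real n powr \<gamma> = real n * real n powr \<beta>" using n1 by (simp add: \<gamma>\<beta> powr_add)
      then show ?thesis using gt n1 by (simp add: d_def field_simps)
    qed
    have n\<beta>: "1 \<le> real n powr \<beta>" using n1 \<beta> by (simp add: ge_one_powr_ge_zero)
    have "C * 1 \<le> C * real n powr \<beta>" using n\<beta> C1 by (intro mult_left_mono) auto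
    then have d12: "d \<ge> 12" using d_gt C1 by linarith
    \<comment> \<open>This is where \<open>\<beta> \<ge> 1 / 2\<close> enters: the square of
      \<open>real n powr \<beta>\<close> is at least \<open>n\<close>.\<close>
    have d72: "72 * real n \<le> d\<^sup>2"
    proof -
      have "real n powr 1 \<le> real n powr (\<beta> + \<beta>)" using n1 \<beta> by (intro powr_mono) auto
      then have "real n \<le> real n powr \<beta> * real n powr \<beta>" unfolding powr_add using n1 by simp
      then have "72 * real n \<le> (72 * real n powr \<beta>) * (1 * real n powr \<beta>)" by simp
      also have "\<dots> \<le> d * d"
      proof (intro mult_mono)
        have "72 * real n powr \<beta> \<le> C * real n powr \<beta>" using C1 by (intro mult_right_mono) auto
        then show "72 * real n powr \<beta> \<le> d" using d_gt by linarith
        then show "1 * real n powr \<beta> \<le> d" using n\<beta> by linarith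
      qed (use d12 in auto)
      finally show ?thesis by (simp add: power2_eq_square)
    qed
    define dU where "dU x = card {y. (x, y) \<in> E}" for x
    define dV where "dV y = card {x. (x, y) \<in> E}" for y
    define HU where "HU = {x \<in> U. 8 * d < dU x}"
    define HV where "HV = {y \<in> V. 8 * d < dV y}"
    have finH: "finite HU" "finite HV" using less.prems by (auto simp: HU_def HV_def)
    have sumU: "(\<Sum>x\<in>U. dU x) = card E"
    proof -
      have "E = (SIGMA x:U. {y. (x, y) \<in> E})" using less.prems(4) by auto
      then have "card E = card (SIGMA x:U. {y. (x, y) \<in> E})" by simp
      also have "\<dots> = (\<Sum>x\<in>U. dU x)" unfolding dU_def
        by (rule card_SigmaI) (use less.prems in \<open>auto intro: finite_subset[of _ V]\<close>)
      finally show ?thesis by simp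
    qed
    have sumV: "(\<Sum>y\<in>V. dV y) = card E"
    proof -
      have "E\<inverse> = (SIGMA y:V. {x. (x, y) \<in> E})" using less.prems(4) by auto
      then have "card (E\<inverse>) = card (SIGMA y:V. {x. (x, y) \<in> E})" by simp
      also have "\<dots> = (\<Sum>y\<in>V. dV y)" unfolding dV_def
        by (rule card_SigmaI) (use less.prems in \<open>auto intro: finite_subset[of _ U]\<close>)
      finally show ?thesis by simp
    qed
    have hi: "8 * d * card H \<le> card E" if "H = {x \<in> S. 8 * d < real (f x)}" "finite S" "(\<Sum>x\<in>S. f x) = card E"
      for H S and f :: "'a \<Rightarrow> nat"
    proof -
      have "8 * d * card H = (\<Sum>x\<in>H. 8 * d)" by simp
      also have "\<dots> \<le> (\<Sum>x\<in>H. real (f x))" by (rule sum_mono) (use that(1) in auto)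
      also have "\<dots> \<le> (\<Sum>x\<in>S. real (f x))" by (rule sum_mono2) (use that in auto)
      also have "\<dots> = card E" using that(3) by (metis of_nat_sum)
      finally show ?thesis .
    qed
    have "8 * d * real (card HU + card HV) \<le> 2 * (d * n)"
      using hi[OF HU_def less.prems(1) sumU] hi[OF HV_def less.prems(2) sumV] dn by (simp add: distrib_left)
    then have "d * (8 * real (card HU + card HV)) \<le> d * (2 * n)" by (simp add: mult_ac)
    then have "8 * real (card HU + card HV) \<le> 2 * n" using d12 by simp
    then have Hn: "real (card HU + card HV) \<le> n / 4" by simp
    define EH where "EH = E \<inter> (HU \<times> HV)"
    have "card HU + card HV < card U + card V"
    proof -
      have "real (card HU + card HV) < real n" using Hn n1 by linarith
      then show ?thesis unfolding n_def by (simp only: of_nat_less_iff)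
    qed
    then have "real (card EH) \<le> C * real (card HU + card HV) powr \<gamma>"
      by (rule less.hyps[OF _ finH]) (use less.prems E_plus_free_subset[OF less.prems(5), of EH] in
        \<open>auto simp: EH_def HU_def HV_def\<close>)
    \<comment> \<open>Since \<open>\<gamma> \<ge> 1\<close>, a quarter of the vertices costs at most
      a quarter of the bound, with the same \<open>C\<close>.\<close>
    also have "\<dots> \<le> C * (real n powr \<gamma> / 4)"
    proof -
      have "real (card HU + card HV) powr \<gamma> \<le> (real n / 4) powr \<gamma>"
        using Hn \<gamma>\<beta> \<beta> by (intro powr_mono2) auto
      also have "\<dots> = real n powr \<gamma> * (1 / 4) powr \<gamma>" by (simp add: powr_divide)
      also have "(1 / 4 :: real) powr \<gamma> \<le> (1 / 4) powr 1"
        using \<gamma>\<beta> \<beta> by (intro powr_mono') auto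
      finally show ?thesis using C1 by (simp add: mult_left_mono)
    qed
    finally have EH: "4 * real (card EH) \<le> card E" using gt by simp
    define E1 where "E1 = {(x, y) \<in> E. y \<notin> HV}"
    define E2 where "E2 = {(x, y) \<in> E. x \<notin> HU}"
    have sub: "E1 \<subseteq> E" "E2 \<subseteq> E" by (auto simp: E1_def E2_def)
    have fin12: "finite E1" "finite E2" using sub finE finite_subset by blast+
    have "E \<subseteq> EH \<union> (E1 \<union> E2)" using less.prems(4) by (auto simp: EH_def E1_def E2_def)
    then have "card E \<le> card (EH \<union> (E1 \<union> E2))"
      by (rule card_mono[rotated]) (use finE fin12 in \<open>auto simp: EH_def\<close>)
    also have "\<dots> \<le> card EH + (card E1 + card E2)"
      by (intro order_trans[OF card_Un_le] add_left_mono card_Un_le)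
    finally have "real (card E) \<le> real (card EH + (card E1 + card E2))" by (simp only: of_nat_le_iff)
    \<comment> \<open>With at most a quarter of the edges in \<open>EH\<close>, the larger of
      \<open>E1\<close> and \<open>E2\<close> has at least three eighths of them.\<close>
    moreover have "a / 3 \<le> b \<or> a / 3 \<le> c" if "a \<le> h + (b + c)" "4 * h \<le> a" "0 \<le> a" for a b c h :: real
      using that by linarith
    ultimately have big: "d * n / 3 \<le> card E1 \<or> d * n / 3 \<le> card E2"
      unfolding dn of_nat_add using EH of_nat_0_le_iff by blast
    have small: "card E1 \<le> d * n" "card E2 \<le> d * n"
      unfolding dn using card_mono[OF finE] sub by auto
    have deg1: "card {x. (x, y) \<in> E1} \<le> 8 * d" for y
    proof (cases "y \<in> V - HV")
      case True
      have "card {x. (x, y) \<in> E1} \<le> dV y"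
        unfolding dV_def by (rule card_mono) (use less.prems sub in \<open>auto intro: finite_subset[of _ U]\<close>)
      then have "real (card {x. (x, y) \<in> E1}) \<le> real (dV y)"
        by (simp only: of_nat_le_iff)
      then show ?thesis using True by (auto simp: HV_def)
    next
      case False
      then have "{x. (x, y) \<in> E1} = {}" using less.prems(4) by (auto simp: E1_def)
      then show ?thesis using d12 by simp
    qed
    have deg2: "card {y. (y, x) \<in> E2\<inverse>} \<le> 8 * d" for x
    proof (cases "x \<in> U - HU")
      case True
      have "card {y. (y, x) \<in> E2\<inverse>} \<le> dU x"
        unfolding dU_def by (rule card_mono) (use less.prems sub in \<open>auto intro: finite_subset[of _ V]\<close>)
      then have "real (card {y. (y, x) \<in> E2\<inverse>}) \<le> real (dU x)"
        by (simp only: of_nat_le_iff)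
      then show ?thesis using True by (auto simp: HU_def)
    next
      case False
      then have "{y. (y, x) \<in> E2\<inverse>} = {}" using less.prems(4) by (auto simp: E2_def)
      then show ?thesis using d12 by simp
    qed
    have k1: "k \<ge> 1" using k by simp
    have "d\<^sup>2 \<le> 8640 * real n * (real D * (real \<rho> + 3))" if \<rho>: "10 * d < real (\<rho> ^ k)" for \<rho>
      using big
    proof
      assume b: "d * n / 3 \<le> card E1"
      have s: "E1 \<subseteq> U \<times> V" using sub less.prems(4) by blast
      have "d\<^sup>2 \<le> real (8640 * n * (D * (\<rho> + 3)))"
        by (rule one_sided_cycle_count[OF s less.prems(3,1,2) E_plus_free_subset[OF less.prems(5) sub(1)] t k1
              _ n1 d12 d72 b small(1) deg1 \<rho> D_def]) (simp add: n_def)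
      then show ?thesis by simp
    next
      assume b: "d * n / 3 \<le> card E2"
      have s: "E2\<inverse> \<subseteq> V \<times> U" "V \<inter> U = {}" using sub less.prems(3,4) by blast+
      have b': "d * n / 3 \<le> card (E2\<inverse>)" "card (E2\<inverse>) \<le> d * n" using b small(2) by simp_all
      have "d\<^sup>2 \<le> real (8640 * n * (D * (\<rho> + 3)))"
        by (rule one_sided_cycle_count[OF s less.prems(2,1) E_plus_free_converse[THEN iffD2, OF E_plus_free_subset[OF less.prems(5) sub(2)]]
              t k1 _ n1 d12 d72 b' deg2 \<rho> D_def]) (simp add: n_def)
      then show ?thesis by simp
    qed
    from cycle_count_exponent[OF k d12 _ D1 this] n1
    have "d \<le> (432000 * real D * real n) powr (real k / (2 * real k - 1))" by simp
    also have "real k / (2 * real k - 1) = \<beta>" by (simp add: \<beta>_def)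
    also have "(432000 * real D * real n) powr \<beta> = C powr \<beta> * real n powr \<beta>"
      using D1 n1 by (simp add: C powr_mult)
    \<comment> \<open>As \<open>C \<ge> 1\<close> and \<open>\<beta> \<le> 1\<close>, the constant
      \<open>C\<close> itself returns, against \<open>d_gt\<close>.\<close>
    also have "\<dots> \<le> C powr 1 * real n powr \<beta>"
      using \<beta> C1 by (intro mult_right_mono powr_mono) auto
    finally show False using d_gt C1 by simp
  qed
  then show ?case by (simp add: n_def)
qed

text \<open>Some cut of an extremal graph carries at least a quarter of its edges. A copy inside the
  cut stays within \<open>verts G\<close>, because \<open>E_plus\<close> has no isolated
  vertices.\<close>

lemma extremal_number_upper:
  assumes k: "k \<ge> 2" and t: "t \<ge> 1"
  shows "\<exists>C. \<forall>n. real (extremal_number n (E_plus k t)) \<le> C * real n powr ((3 * real k - 1) / (2 * real k - 1))"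
proof -
  define C where "C = 432000 * real ((2 * (Suc t * Suc k)) ^ k)"
  have "real (extremal_number n (E_plus k t)) \<le> 4 * C * real n powr ((3 * real k - 1) / (2 * real k - 1))" for n
  proof -
    have H: "simple_graph (E_plus k t)" "edges (E_plus k t) \<noteq> {}"
      using simple_graph_E_plus[OF k] E_plus_edges(1) by blast+
    have "extremal_number n (E_plus k t) \<in> {card (edges G) | G :: nat graph.
        simple_graph G \<and> card (verts G) = n \<and> \<not> contains_copy G (E_plus k t)}"
      unfolding extremal_number_def by (rule Max_in[OF host_edge_counts[OF H]])
    then obtain G :: "nat graph" where G: "extremal_number n (E_plus k t) = card (edges G)"
      "simple_graph G" "card (verts G) = n" "\<not> contains_copy G (E_plus k t)" by auto
    have finG: "finite (verts G)" using G(2) by (simp add: simple_graph_def)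
    have eG: "e \<subseteq> verts G" "card e = 2" if "e \<in> edges G" for e using G(2) that by (auto simp: simple_graph_def)
    define R where "R x y \<longleftrightarrow> {x, y} \<in> edges G" for x y
    have R: "R x y \<Longrightarrow> R y x" "\<not> R x x" for x y using eG(2)[of "{x, x}"] by (auto simp: R_def insert_commute)
    obtain U where U: "U \<subseteq> verts G"
      "card {(x, y). x \<in> verts G \<and> y \<in> verts G \<and> R x y} \<le> 4 * card {(x, y). x \<in> U \<and> y \<in> verts G - U \<and> R x y}"
      using large_cut[OF finG, of R] R by blast
    define E where "E = {(x, y). x \<in> U \<and> y \<in> verts G - U \<and> R x y}"
    have "edges G \<subseteq> (\<lambda>(x, y). {x, y}) ` {(x, y). x \<in> verts G \<and> y \<in> verts G \<and> R x y}"
    proof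
      fix e assume e: "e \<in> edges G"
      then obtain x y where xy: "e = {x, y}" using eG(2)[OF e] by (auto simp: card_2_iff)
      then have "(x, y) \<in> {(x, y). x \<in> verts G \<and> y \<in> verts G \<and> R x y}" using e eG(1)[OF e] by (auto simp: R_def)
      from imageI[OF this, of "\<lambda>(x, y). {x, y}"] show "e \<in> (\<lambda>(x, y). {x, y}) ` {(x, y). x \<in> verts G \<and> y \<in> verts G \<and> R x y}"
        using xy by simp
    qed
    moreover have fin: "finite {(x, y). x \<in> verts G \<and> y \<in> verts G \<and> R x y}"
      by (rule finite_subset[of _ "verts G \<times> verts G"]) (use finG in auto)
    ultimately have "card (edges G) \<le> card {(x, y). x \<in> verts G \<and> y \<in> verts G \<and> R x y}"
      by (meson card_image_le card_mono finite_imageI le_trans)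
    then have "card (edges G) \<le> 4 * card E" using U(2) unfolding E_def by linarith
    moreover have "real (card E) \<le> C * real (card U + card (verts G - U)) powr ((3 * real k - 1) / (2 * real k - 1))"
      unfolding C_def
    proof (rule E_plus_free_edge_bound[OF k t])
      show "finite U" using U(1) finG finite_subset by blast
      show "finite (verts G - U)" using finG by simp
      show "U \<inter> (verts G - U) = {}" "E \<subseteq> U \<times> (verts G - U)" by (auto simp: E_def)
      have EG: "{x, y} \<in> edges G \<and> x \<in> verts G \<and> y \<in> verts G" if "(x, y) \<in> E \<union> E\<inverse>" for x y
        using that U(1) by (auto simp: E_def R_def insert_commute)
      show "E_plus_free E k t"
        unfolding E_plus_free_def
      proof
        assume "\<exists>\<phi>. inj_on \<phi> (verts (E_plus k t)) \<and> (\<forall>u\<in>verts (E_plus k t). \<forall>v\<in>verts (E_plus k t).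
          {u, v} \<in> edges (E_plus k t) \<longrightarrow> (\<phi> u, \<phi> v) \<in> E \<union> E\<inverse>)"
        then obtain \<phi> where \<phi>: "inj_on \<phi> (verts (E_plus k t))"
          "\<And>u v. u \<in> verts (E_plus k t) \<Longrightarrow> v \<in> verts (E_plus k t) \<Longrightarrow> {u, v} \<in> edges (E_plus k t) \<Longrightarrow> (\<phi> u, \<phi> v) \<in> E \<union> E\<inverse>"
          by blast
        have "contains_copy G (E_plus k t)"
        proof (rule embedding_contains_copy[OF H(1) \<phi>(1)])
          show "\<phi> ` verts (E_plus k t) \<subseteq> verts G"
          proof (rule image_subsetI)
            fix u assume u: "u \<in> verts (E_plus k t)"
            obtain v where "v \<in> verts (E_plus k t)" "{u, v} \<in> edges (E_plus k t)"
              using E_plus_no_isolated[OF u] by blast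
            then show "\<phi> u \<in> verts G" using EG[OF \<phi>(2)[OF u]] by blast
          qed
          show "{\<phi> u, \<phi> v} \<in> edges G"
            if "u \<in> verts (E_plus k t)" "v \<in> verts (E_plus k t)" "{u, v} \<in> edges (E_plus k t)" for u v
            using EG[OF \<phi>(2)[OF that]] by blast
        qed
        then show False using G(4) by blast
      qed
    qed
    moreover have "card U + card (verts G - U) = n"
      using card_Diff_subset[OF finite_subset[OF U(1) finG] U(1)] card_mono[OF finG U(1)] G(3) by simp
    ultimately show ?thesis unfolding G(1) by simp
  qed
  then show ?thesis by blast
qed

theorem theorem1p2:
  fixes k :: nat
  assumes "k \<ge> 2"
  shows "\<exists>t0::nat. \<forall>t\<ge>t0.
    (\<lambda>n::nat. real (extremal_number n (E_plus k t)))
      \<in> \<Theta>(\<lambda>n. real n powr ((3 * real k - 1) / (2 * real k - 1)))"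
proof -
  define \<gamma> where "\<gamma> = (3 * real k - 1) / (2 * real k - 1)"
  obtain t0 r0 where lower: "\<forall>t\<ge>t0. \<forall>r\<ge>r0. \<forall>n. 2 * (2 ^ r) ^ (2 * k - 1) \<le> n \<longrightarrow>
      (2 ^ r) ^ (3 * k - 1) \<le> extremal_number n (E_plus k t)"
    using extremal_number_lower[OF assms] by (elim exE) (rule that)
  have "(\<lambda>n::nat. real (extremal_number n (E_plus k t))) \<in> \<Theta>(\<lambda>n. real n powr \<gamma>)"
    if t: "t \<ge> max 1 t0" for t
  proof (rule bigthetaI)
    obtain C where "\<And>n. real (extremal_number n (E_plus k t)) \<le> C * real n powr \<gamma>"
      using extremal_number_upper[OF assms, of t] t unfolding \<gamma>_def by auto
    then show "(\<lambda>n::nat. real (extremal_number n (E_plus k t))) \<in> O(\<lambda>n. real n powr \<gamma>)"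
      by (intro bigoI[of _ C]) auto
    \<comment> \<open>Admissible orders for consecutive \<open>r\<close> differ by the factor
      \<open>2 ^ (2 * k - 1)\<close>; with the factor 2 for the two sides, \<open>n\<close> is less
      than \<open>2 ^ (2 * k)\<close> times \<open>q ^ (2 * k - 1)\<close> for the largest fitting
      \<open>q\<close>.\<close>
    define c where "c = 1 / (2 ^ (2 * k)) powr \<gamma>"
    have "c > 0" by (simp add: c_def)
    moreover have "c * real n powr \<gamma> \<le> real (extremal_number n (E_plus k t))"
      if n: "n \<ge> 2 * (2 ^ r0) ^ (2 * k - 1)" for n
    proof -
      \<comment> \<open>The exponents \<open>r\<close> whose graph fits on \<open>n\<close>
        vertices; maximality of the chosen one bounds \<open>n\<close> from above.\<close>
      define R where "R = {r. 2 * (2 ^ r) ^ (2 * k - 1) \<le> n}"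
      have "R \<subseteq> {..n}"
      proof
        fix r assume "r \<in> R"
        moreover have "(2 ^ r) ^ 1 \<le> ((2::nat) ^ r) ^ (2 * k - 1)" using assms by (intro power_increasing) auto
        ultimately have "2 ^ r \<le> n" by (simp add: R_def)
        moreover have "r < (2::nat) ^ r" by (rule less_exp)
        ultimately have "r \<le> n" by linarith
        then show "r \<in> {..n}" by simp
      qed
      then have finR: "finite R" by (rule finite_subset) simp
      have "r0 \<in> R" using n by (simp add: R_def)
      define r where "r = Max R"
      have le_r: "x \<le> r" if "x \<in> R" for x unfolding r_def by (rule Max_ge[OF finR that])
      have r: "r \<in> R" "r0 \<le> r" "Suc r \<notin> R"
        using Max_in[OF finR] le_r \<open>r0 \<in> R\<close> not_less_eq_eq by (auto simp: r_def)
      define q where "q = (2::real) ^ r"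
      have q: "q > 0" by (simp add: q_def)
      have "n < 2 * (2 ^ Suc r) ^ (2 * k - 1)" using r(3) by (simp add: R_def)
      then have "real n \<le> real (2 * (2 ^ Suc r) ^ (2 * k - 1))" by (simp only: of_nat_le_iff)
      also have "\<dots> = 2 * 2 ^ (2 * k - 1) * q ^ (2 * k - 1)" by (simp add: q_def power_mult_distrib)
      also have "(2::real) * 2 ^ (2 * k - 1) = 2 ^ (2 * k)"
        using assms by (simp flip: power_Suc)
      finally have "real n powr \<gamma> \<le> (2 ^ (2 * k) * q ^ (2 * k - 1)) powr \<gamma>"
        using assms by (intro powr_mono2) (auto simp: \<gamma>_def)
      also have "\<dots> = (2 ^ (2 * k)) powr \<gamma> * (q ^ (2 * k - 1)) powr \<gamma>"
        using q by (simp add: powr_mult)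
      also have "(q ^ (2 * k - 1)) powr \<gamma> = q powr (real (2 * k - 1) * \<gamma>)"
        using q by (simp add: powr_powr flip: powr_realpow)
      \<comment> \<open>\<open>\<gamma>\<close> is the ratio of the exponents of \<open>q\<close> in
        the numbers of edges and of vertices.\<close>
      also have "real (2 * k - 1) * \<gamma> = real (3 * k - 1)"
        using assms by (simp add: \<gamma>_def of_nat_diff)
      also have "q powr real (3 * k - 1) = q ^ (3 * k - 1)" using q by (simp add: powr_realpow)
      finally have "c * real n powr \<gamma> \<le> q ^ (3 * k - 1)"
        by (simp add: c_def field_simps)
      also have "\<dots> = real ((2 ^ r) ^ (3 * k - 1))" by (simp add: q_def)
      also have "\<dots> \<le> real (extremal_number n (E_plus k t))"
        using lower[rule_format, of t r n] r t by (simp only: of_nat_le_iff) (simp add: R_def)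
      finally show ?thesis .
    qed
    then have "eventually (\<lambda>n. c * norm (real n powr \<gamma>) \<le> norm (real (extremal_number n (E_plus k t)))) sequentially"
      by (intro eventually_sequentiallyI[of "2 * (2 ^ r0) ^ (2 * k - 1)"]) simp
    ultimately show "(\<lambda>n::nat. real (extremal_number n (E_plus k t))) \<in> \<Omega>(\<lambda>n. real n powr \<gamma>)"
      by (rule landau_omega.bigI)
  qed
  then show ?thesis unfolding \<gamma>_def by blast
qed

end
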